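(* In the control problem described in the context, suppose $T=ML$ with $M\ge1$ an integer and $L>0$, and that there are functions $\widetilde\lambda,\widetilde e$ on $[0,L)$ such that $\lambda((m-1)L+s)=\widetilde\lambda(s)$ and $e((m-1)L+s)=\widetilde e(s)$ for all $s\in[0,L)$ and $m=1,\ldots,M$. Then for every $m=1,\ldots,M-1$, $i=1,\ldots,N$ and $s\in[0,L]$, $$\Delta_i((m-1)L+s)\ge\Delta_i(mL+s).$$ Consequently, for every $m=1,\ldots,M-1$ and $s\in[0,L)$, $\mathcal I_{(m-1)L+s}\supseteq\mathcal I_{mL+s}$, and hence $i_{(m-1)L+s}^{\min}\le i_{mL+s}^{\min}$.
   Context: Let $N\ge1$ and $K\ge 1$ be integers, $T\in(0,\infty)$, $\pi>0$, and $\mathcal S=\{0,1,\ldots,N\}$; write $a\wedge b=\min\{a,b\}$. The functions $\lambda,e:[0,T]\to(0,\infty)$ are deterministic, bounded, right-continuous, continuously differentiable except at finitely many time points, with $\inf_{t\in[0,T]}\lambda(t)>0$ and $\inf_{t\in[0,T]}e(t)>0$ (they may have jumps at the exceptional points). The state $I(t)\in\mathcal S$ is the number of depleted units. When $I(t)=i$ the feasible actions are $\mathcal U(i)=\{0,1,\ldots,i\wedge K\}$. Under action $u$ at time $t$, the state jumps from $i$ to $i+1$ at rate $\lambda(t)$ if $i<N$, and from $i$ to $i-1$ at rate $u$; in state $N$ arrivals (at rate $\lambda(t)$) are lost and leave the state unchanged. The cost rate is $c(t,i,u)=e(t)u+\pi\lambda(t)\mathbf 1_{\{i=N\}}$. A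 control $u=\{u(t)\}$ is admissible if it is non-anticipative and $u(t)\in\mathcal U(I(t))$ at all times. The cost-to-go is $J^u(t,i)=\mathbb E\left[\int_t^T c(s,I(s),u(s))\,ds\,\middle|\,I(t)=i\right]$, and the value function is $V(t,i)=\inf_u J^u(t,i)$ for $(t,i)\in[0,T]\times\mathcal S$, with $V(T,i)=0$. The marginal costs are $\Delta_i(t):=V(t,i)-V(t,i-1)$ for $i=1,\ldots,N$. Let $\mathcal I_t:=\{i\in\{1,\ldots,N\}:\Delta_i(t)>e(t)\}$ and $i_t^{\min}:=\min\mathcal I_t$, with the convention $i_t^{\min}=N+1$ if $\mathcal I_t=\emptyset$. *)

theory Defs
  imports "HOL-Probability.Probability"
begin

text \<open>
  Coefficients on \<open>[0,T]\<close>. \<open>C1_differentiable_on\<close> uses two-sided derivatives; the endpoints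
  \<open>0\<close> and \<open>T\<close> can always be put into the finite exceptional set, so values outside \<open>[0,T]\<close>
  play no role.
\<close>

definition coefficient :: "real \<Rightarrow> (real \<Rightarrow> real) \<Rightarrow> bool" where
  "coefficient T g \<longleftrightarrow>
     (\<forall>t\<in>{0..T}. 0 < g t) \<and>
     bounded (g ` {0..T}) \<and>
     (\<forall>t\<in>{0..<T}. continuous (at_right t) g) \<and>
     (\<exists>D. finite D \<and> g C1_differentiable_on ({0..T} - D)) \<and>
     0 < (INF t\<in>{0..T}. g t)"

definition feasible :: "nat \<Rightarrow> nat \<Rightarrow> nat set" where
  "feasible K i = {0..min i K}"

definition cost_rate ::
  "nat \<Rightarrow> real \<Rightarrow> (real \<Rightarrow> real) \<Rightarrow> (real \<Rightarrow> real) \<Rightarrow> real \<Rightarrow> nat \<Rightarrow> nat \<Rightarrow> real" where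
  "cost_rate N p lam e t i a = e t * real a + p * lam t * (if i = N then 1 else 0)"

definition jump_rate :: "nat \<Rightarrow> (real \<Rightarrow> real) \<Rightarrow> real \<Rightarrow> nat \<Rightarrow> nat \<Rightarrow> nat \<Rightarrow> real" where
  "jump_rate N lam t a i j =
     (if i < N \<and> j = i + 1 then lam t else if i = j + 1 then real a else 0)"

definition generator ::
  "nat \<Rightarrow> (real \<Rightarrow> real) \<Rightarrow> real \<Rightarrow> nat \<Rightarrow> (nat \<Rightarrow> real) \<Rightarrow> nat \<Rightarrow> real" where
  "generator N lam t a f i = (\<Sum>j\<in>{0..N}. jump_rate N lam t a i j * (f j - f i))"

text \<open>
  An admissible controlled process on \<open>[0,T]\<close>, in the weak formulation: a probability space \<open>P\<close>
  with filtration \<open>F\<close>, a piecewise constant right-continuous state process \<open>I\<close> adapted to \<open>F\<close>,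
  and a control \<open>u\<close>. Non-anticipativity of \<open>u\<close> is progressive measurability with respect to \<open>F\<close>.
  That \<open>I\<close> jumps with the (random) rates \<open>jump_rate\<close>, given the past \<open>F\<close>, is the controlled
  martingale problem: for every \<open>f\<close>, the process \<open>f (I s) - \<integral> generator f dv\<close> is an
  \<open>F\<close>-martingale (all quantities are bounded, and the last clause is the martingale property
  written out). The initial law is unrestricted.
\<close>

definition admissible ::
  "nat \<Rightarrow> nat \<Rightarrow> real \<Rightarrow> (real \<Rightarrow> real) \<Rightarrow> 'w measure \<Rightarrow> (real \<Rightarrow> 'w measure)
     \<Rightarrow> (real \<Rightarrow> 'w \<Rightarrow> nat) \<Rightarrow> (real \<Rightarrow> 'w \<Rightarrow> nat) \<Rightarrow> bool" where
  "admissible N K T lam P F I u \<longleftrightarrow>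
     prob_space P \<and>
     filtration (space P) F \<and> (\<forall>s. subalgebra P (F s)) \<and>
     (\<forall>s\<in>{0..T}. I s \<in> measurable (F s) (count_space UNIV)) \<and>
     (\<forall>s\<in>{0..T}. \<forall>\<omega>\<in>space P. I s \<omega> \<in> {0..N}) \<and>
     (\<forall>s\<in>{0..<T}. \<forall>\<omega>\<in>space P. eventually (\<lambda>r. I r \<omega> = I s \<omega>) (at_right s)) \<and>
     (\<forall>s\<in>{0<..T}. \<forall>\<omega>\<in>space P. \<exists>j. eventually (\<lambda>r. I r \<omega> = j) (at_left s)) \<and>
     (\<forall>s\<in>{0..T}. (\<lambda>(v, \<omega>). u v \<omega>) \<in>
        measurable (restrict_space borel {0..s} \<Otimes>\<^sub>M F s) (count_space UNIV)) \<and>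
     (\<forall>s\<in>{0..T}. \<forall>\<omega>\<in>space P. u s \<omega> \<in> feasible K (I s \<omega>)) \<and>
     (\<forall>f r s A. 0 \<le> r \<longrightarrow> r \<le> s \<longrightarrow> s \<le> T \<longrightarrow> A \<in> sets (F r) \<longrightarrow>
        (LINT \<omega>:A|P. f (I s \<omega>) - f (I r \<omega>)
           - (LINT v:{r..s}|lborel. generator N lam v (u v \<omega>) f (I v \<omega>))) = 0)"

text \<open>
  Cost-to-go given \<open>I t = i\<close>: elementary conditional expectation on that event, meaningful
  when the event has positive probability.
\<close>

definition cost_to_go ::
  "nat \<Rightarrow> real \<Rightarrow> real \<Rightarrow> (real \<Rightarrow> real) \<Rightarrow> (real \<Rightarrow> real) \<Rightarrow> 'w measure
     \<Rightarrow> (real \<Rightarrow> 'w \<Rightarrow> nat) \<Rightarrow> (real \<Rightarrow> 'w \<Rightarrow> nat) \<Rightarrow> real \<Rightarrow> nat \<Rightarrow> real" where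
  "cost_to_go N T p lam e P I u t i =
     (LINT \<omega>:{\<omega> \<in> space P. I t \<omega> = i}|P.
        (LINT s:{t..T}|lborel. cost_rate N p lam e s (I s \<omega>) (u s \<omega>)))
     / measure P {\<omega> \<in> space P. I t \<omega> = i}"

text \<open>
  The infimum ranges over all admissible controlled processes with sample space in
  \<open>nat \<Rightarrow> real\<close> (any \<open>\<sigma>\<close>-algebra, any probability measure), since HOL cannot quantify over types
  inside a term. This type carries every countable family of real random variables, in
  particular the randomness driving a controlled jump process.
\<close>

definition V ::
  "nat \<Rightarrow> nat \<Rightarrow> real \<Rightarrow> real \<Rightarrow> (real \<Rightarrow> real) \<Rightarrow> (real \<Rightarrow> real) \<Rightarrow> real \<Rightarrow> nat \<Rightarrow> real" where
  "V N K T p lam e t i =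
     Inf {cost_to_go N T p lam e P I u t i | (P :: (nat \<Rightarrow> real) measure) F I u.
            admissible N K T lam P F I u \<and> 0 < measure P {\<omega> \<in> space P. I t \<omega> = i}}"

definition marginal ::
  "nat \<Rightarrow> nat \<Rightarrow> real \<Rightarrow> real \<Rightarrow> (real \<Rightarrow> real) \<Rightarrow> (real \<Rightarrow> real) \<Rightarrow> nat \<Rightarrow> real \<Rightarrow> real" where
  "marginal N K T p lam e i t = V N K T p lam e t i - V N K T p lam e t (i - 1)"

definition active_set ::
  "nat \<Rightarrow> nat \<Rightarrow> real \<Rightarrow> real \<Rightarrow> (real \<Rightarrow> real) \<Rightarrow> (real \<Rightarrow> real) \<Rightarrow> real \<Rightarrow> nat set" where
  "active_set N K T p lam e t = {i \<in> {1..N}. e t < marginal N K T p lam e i t}"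

definition i_min ::
  "nat \<Rightarrow> nat \<Rightarrow> real \<Rightarrow> real \<Rightarrow> (real \<Rightarrow> real) \<Rightarrow> (real \<Rightarrow> real) \<Rightarrow> real \<Rightarrow> nat" where
  "i_min N K T p lam e t =
     (if active_set N K T p lam e t = {} then N + 1 else Min (active_set N K T p lam e t))"

end

theory Submission
  imports Defs
begin

text \<open>
  The marginal costs \<open>\<Delta>\<^sub>i\<close> solve, backward from \<open>\<Delta>(T) = 0\<close> and with the convention \<open>\<Delta>\<^sub>N\<^sub>+\<^sub>1 = p\<close>,
  the system \<open>- \<Delta>\<^sub>i' = \<lambda> (\<Delta>\<^sub>i\<^sub>+\<^sub>1 - \<Delta>\<^sub>i) - (i \<and> K) (\<Delta>\<^sub>i - e)\<^sup>+ + ((i - 1) \<and> K) (\<Delta>\<^sub>i\<^sub>-\<^sub>1 - e)\<^sup>+\<close>.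
  Every \<open>\<Delta>\<^sub>j\<close> with \<open>j \<noteq> i\<close> enters the equation of \<open>\<Delta>\<^sub>i\<close> with a nonnegative sign, and after discounting at
  a rate \<open>R \<ge> \<lambda> + K\<close> so does \<open>\<Delta>\<^sub>i\<close> itself. The system is therefore the fixed point equation of a monotone
  integral operator, and \<open>\<Delta>\<close> is the increasing limit of its iterates started at \<open>0\<close>. With periodic
  coefficients each iterate satisfies \<open>d(t + L) \<le> d(t)\<close>: shifting the integral over \<open>[t + L, T]\<close> back by
  one period turns it into an integral over the shorter interval \<open>[t, T - L]\<close> of a smaller integrand
  (\<open>\<Delta>_periodic_decreasing\<close>). The claims about the active sets and their minima follow, because \<open>e\<close> takes
  the same values in both periods.

  The main work is to show that this \<open>\<Delta>\<close> is the marginal cost of the control problem. Let \<open>w\<close> be the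
  solution of the Hamilton-Jacobi-Bellman equation that has increments \<open>\<Delta>\<close> in the state. Every
  admissible process costs at least \<open>w\<close>: the martingale problem gives a Dynkin formula for the
  time dependent function \<open>w\<close> (\<open>dynkin_formula\<close>), and the Bellman inequality bounds its integrand by
  the cost rate (\<open>verification\<close>).

  The bound is attained by the feedback rule \<open>U\<close> that works at full capacity exactly when \<open>\<Delta>\<^sub>i > e\<close>, once
  some admissible process follows this rule. Such a process is built on a Poisson number of
  independent uniform points \<open>(t, z)\<close> in a rectangle: a point at time \<open>t\<close> moves the state up, down or
  not at all, according to where the mark \<open>z\<close> falls. The martingale property is then the Mecke formula
  \<open>E (\<Sum>y\<in>\<eta>. h y \<eta>) = \<integral> E (h y (\<eta> + \<delta>\<^sub>y)) dy\<close> (\<open>poisson_mecke\<close>): the increment of \<open>f (I s)\<close> is a sum over the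
  points of \<open>\<eta>\<close>, inserting a point \<open>y\<close> does not change anything that happened before \<open>y\<close>, and integrating
  over the mark of \<open>y\<close> yields the generator (\<open>feedback_martingale\<close>).
\<close>


section \<open>Poisson point configurations and the Mecke formula\<close>

text \<open>
  The labels are forgotten because the Mecke formula inserts a point without giving it a place in
  the enumeration.
\<close>
definition config :: "nat \<Rightarrow> (nat \<Rightarrow> 'x) \<Rightarrow> 'x multiset" where
  "config n x = mset (map x [0..<n])"

lemma config_Suc_case_nat: "config (Suc n) (case_nat y x) = add_mset y (config n x)"
  unfolding config_def by (simp add: upt_conv_Cons map_Suc_upt[symmetric] comp_def del: upt_Suc)

lemma config_transpose:
  assumes "k < n"
  shows "config n (x \<circ> Transposition.transpose 0 k) = config n x"
proof -
  have "bij_betw (Transposition.transpose 0 k) {0..<n} {0..<n}"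
    using assms by (intro bij_betw_byWitness[where f' = "Transposition.transpose 0 k"])
      (auto simp: Transposition.transpose_def)
  hence "image_mset (Transposition.transpose 0 k) (mset_set {0..<n}) = mset_set {0..<n}"
    by (simp add: bij_betw_def image_mset_mset_set)
  hence "image_mset x (image_mset (Transposition.transpose 0 k) (mset_set {0..<n})) = image_mset x (mset_set {0..<n})"
    by simp
  thus ?thesis unfolding config_def
    by (simp add: multiset.map_comp comp_def)
qed

text \<open>
  Independent identically distributed points are exchangeable and \<open>config\<close> ignores their order.
  So coordinate \<open>k\<close> can be swapped with coordinate \<open>0\<close>, and coordinate \<open>0\<close> is independent of the rest.
\<close>
lemma (in sequence_space) nn_integral_config_point:
  fixes h :: "'a \<Rightarrow> 'a multiset \<Rightarrow> ennreal"
  assumes h[measurable]: "\<And>n. (\<lambda>(y, x). h y (config n x)) \<in> borel_measurable (M \<Otimes>\<^sub>M S)"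
    and k: "k \<le> n"
  shows "(\<integral>\<^sup>+x. h (x k) (config (Suc n) x) \<partial>S) = (\<integral>\<^sup>+y. \<integral>\<^sup>+x. h y (add_mset y (config n x)) \<partial>S \<partial>M)"
proof -
  let ?t = "Transposition.transpose 0 k"
  have [measurable]: "(\<lambda>x. h (x j) (config m x)) \<in> borel_measurable S" for j m
    by (rule measurable_compose[where f="\<lambda>x. (x j, x)", OF _ h[of m], simplified]) measurable
  have swap: "distr S S (\<lambda>x. x \<circ> ?t) = S"
    using distr_PiM_reindex[where K="UNIV::nat set" and I="UNIV::nat set" and M="\<lambda>_. M" and f="?t"]
    by (simp add: prob_space_axioms M.prob_space_axioms comp_def restrict_def)
  have [measurable]: "(\<lambda>x. x \<circ> ?t) \<in> measurable S S"
    unfolding comp_def by (rule measurable_PiM_single') (auto simp: space_PiM)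
  have "(\<integral>\<^sup>+x. h (x k) (config (Suc n) x) \<partial>S) = (\<integral>\<^sup>+x. h (x 0) (config (Suc n) x) \<partial>S)"
    using k by (subst swap[symmetric], subst nn_integral_distr) (auto simp: config_transpose)
  also have "\<dots> = (\<integral>\<^sup>+z. h (fst z) (config (Suc n) (case z of (y, x) \<Rightarrow> case_nat y x)) \<partial>(M \<Otimes>\<^sub>M S))"
    by (subst PiM_iter[symmetric], subst nn_integral_distr) (auto simp: case_prod_beta)
  also have "\<dots> = (\<integral>\<^sup>+z. h (fst z) (add_mset (fst z) (config n (snd z))) \<partial>(M \<Otimes>\<^sub>M S))"
    by (simp add: config_Suc_case_nat case_prod_beta)
  also have "\<dots> = (\<integral>\<^sup>+y. \<integral>\<^sup>+x. h y (add_mset y (config n x)) \<partial>S \<partial>M)"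
  proof (subst nn_integral_fst[symmetric])
    have "(\<lambda>z. h (fst z) (config (Suc n) (case z of (y, x) \<Rightarrow> case_nat y x))) \<in> borel_measurable (M \<Otimes>\<^sub>M S)"
      by (rule measurable_compose[where f="\<lambda>z. (fst z, case z of (y, x) \<Rightarrow> case_nat y x)", OF _ h[of "Suc n"], simplified])
        measurable
    thus "(\<lambda>z. h (fst z) (add_mset (fst z) (config n (snd z)))) \<in> borel_measurable (M \<Otimes>\<^sub>M S)"
      by (simp add: config_Suc_case_nat case_prod_beta)
  qed simp
  finally show ?thesis .
qed

text \<open>
  Each of the \<open>n\<close> points contributes the same amount, in which only \<open>n - 1\<close> points remain random. The
  Poisson weights satisfy \<open>n * pmf n = c * pmf (n - 1)\<close>, and this relation is what makes the point count
  on the right Poisson again.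
\<close>
lemma (in sequence_space) poisson_mecke:
  fixes h :: "'a \<Rightarrow> 'a multiset \<Rightarrow> ennreal"
  assumes c: "0 < c"
    and h[measurable]: "\<And>n. (\<lambda>(y, x). h y (config n x)) \<in> borel_measurable (M \<Otimes>\<^sub>M S)"
  shows "(\<integral>\<^sup>+n. \<integral>\<^sup>+x. (\<Sum>k<n. h (x k) (config n x)) \<partial>S \<partial>measure_pmf (poisson_pmf c)) =
    ennreal c * (\<integral>\<^sup>+n. (\<integral>\<^sup>+y. \<integral>\<^sup>+x. h y (add_mset y (config n x)) \<partial>S \<partial>M) \<partial>measure_pmf (poisson_pmf c))"
proof -
  have [measurable]: "(\<lambda>x. h (x j) (config m x)) \<in> borel_measurable S" for j m
    by (rule measurable_compose[where f="\<lambda>x. (x j, x)", OF _ h[of m], simplified]) measurable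
  define a where "a n = (\<integral>\<^sup>+y. \<integral>\<^sup>+x. h y (add_mset y (config n x)) \<partial>S \<partial>M)" for n
  have s: "(\<integral>\<^sup>+x. (\<Sum>k<n. h (x k) (config n x)) \<partial>S) = of_nat n * a (n - 1)" for n
  proof (cases n)
    case (Suc m)
    have "(\<integral>\<^sup>+x. (\<Sum>k<n. h (x k) (config n x)) \<partial>S) = (\<Sum>k<n. \<integral>\<^sup>+x. h (x k) (config n x) \<partial>S)"
      by (rule nn_integral_sum) measurable
    also have "\<dots> = (\<Sum>k<n. a m)" unfolding a_def Suc
      by (intro sum.cong refl nn_integral_config_point h) auto
    finally show ?thesis using Suc by simp
  qed simp
  have w: "ennreal (pmf (poisson_pmf c) (Suc n)) * of_nat (Suc n) = ennreal c * ennreal (pmf (poisson_pmf c) n)" for n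
  proof -
    have "pmf (poisson_pmf c) (Suc n) * real (Suc n) = c * pmf (poisson_pmf c) n"
      unfolding pmf_poisson[OF c] fact_Suc by (simp del: of_nat_Suc)
    thus ?thesis using c by (simp add: ennreal_mult[symmetric] ennreal_of_nat_eq_real_of_nat del: of_nat_Suc)
  qed
  have "(\<integral>\<^sup>+n. of_nat n * a (n - 1) \<partial>measure_pmf (poisson_pmf c))
      = (\<Sum>n. ennreal (pmf (poisson_pmf c) n) * (of_nat n * a (n - 1)))"
    by (simp add: nn_integral_measure_pmf nn_integral_count_space_nat)
  also have "\<dots> = (\<Sum>n. ennreal (pmf (poisson_pmf c) (Suc n)) * (of_nat (Suc n) * a n))"
    by (subst suminf_offset[of _ 1]) auto
  also have "\<dots> = (\<Sum>n. ennreal c * (ennreal (pmf (poisson_pmf c) n) * a n))"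
    by (simp add: mult.assoc[symmetric] w del: pmf_poisson of_nat_Suc)
  also have "\<dots> = ennreal c * (\<integral>\<^sup>+n. a n \<partial>measure_pmf (poisson_pmf c))"
    by (simp add: nn_integral_measure_pmf nn_integral_count_space_nat)
  finally show ?thesis by (simp add: s a_def)
qed

text \<open>
  The two properties of a Poisson point configuration with intensity \<open>mu\<close> from which the controlled
  process is derived. That the configuration may be empty keeps the process at its initial state with
  positive probability, so that conditioning on a state at a later time makes sense.
\<close>
locale poisson_configuration = prob_space P for P :: "'w measure" +
  fixes mu :: "'x measure" and cnt :: "'w \<Rightarrow> nat" and pts :: "'w \<Rightarrow> nat \<Rightarrow> 'x"
  assumes measurable_cnt[measurable]: "cnt \<in> measurable P (count_space UNIV)"
    and measurable_pts[measurable]: "\<And>k. (\<lambda>\<omega>. pts \<omega> k) \<in> measurable P mu"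
    and empty_pos: "0 < prob {\<omega> \<in> space P. cnt \<omega> = 0}"
    and mecke: "\<And>h :: 'x \<Rightarrow> 'x multiset \<Rightarrow> ennreal.
      (\<lambda>(y, \<omega>). h y (config (cnt \<omega>) (pts \<omega>))) \<in> borel_measurable (mu \<Otimes>\<^sub>M P) \<Longrightarrow>
      (\<integral>\<^sup>+\<omega>. (\<Sum>k<cnt \<omega>. h (pts \<omega> k) (config (cnt \<omega>) (pts \<omega>))) \<partial>P) =
      (\<integral>\<^sup>+y. \<integral>\<^sup>+\<omega>. h y (add_mset y (config (cnt \<omega>) (pts \<omega>))) \<partial>P \<partial>mu)"

text \<open>
  A point count and a sequence of planar points as one real sequence: the count sits at index \<open>0\<close>,
  point \<open>k\<close> at the indices \<open>2 * k + 1\<close> and \<open>2 * k + 2\<close>.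
\<close>
definition encode :: "nat \<times> (nat \<Rightarrow> real \<times> real) \<Rightarrow> nat \<Rightarrow> real" where
  "encode = (\<lambda>(n, x) i. if i = 0 then real n else if odd i then fst (x (i div 2)) else snd (x (i div 2 - 1)))"

definition decode_points :: "(nat \<Rightarrow> real) \<Rightarrow> nat \<Rightarrow> real \<times> real" where
  "decode_points \<omega> k = (\<omega> (2 * k + 1), \<omega> (2 * k + 2))"

lemma encode_0: "encode (n, x) 0 = real n"
  by (simp add: encode_def)

lemma decode_encode: "decode_points (encode (n, x)) = x"
  by (auto simp: decode_points_def encode_def fun_eq_iff)

text \<open>
  Normalising \<open>mu\<close> gives the law of a single point; its total mass \<open>c\<close> is the mean of the point count.
  The configuration is carried over to the sample space of real sequences by \<open>encode\<close>.
\<close>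
lemma poisson_configuration_exists:
  fixes mu :: "(real \<times> real) measure"
  assumes "finite_measure mu" and sets_mu[measurable_cong]: "sets mu = sets borel" and pos: "emeasure mu (space mu) \<noteq> 0"
  shows "\<exists>(P :: (nat \<Rightarrow> real) measure) cnt pts. poisson_configuration P mu cnt pts"
proof -
  interpret mu: finite_measure mu by fact
  define c where "c = measure mu (space mu)"
  have c: "emeasure mu (space mu) = ennreal c" "0 < c"
    using pos by (auto simp: c_def mu.emeasure_eq_measure less_le)
  define M where "M = density mu (\<lambda>_. ennreal (1 / c))"
  have sets_M[measurable_cong]: "sets M = sets borel" by (simp add: M_def sets_mu)
  have space_M: "space M = UNIV" using sets_eq_imp_space_eq[OF sets_M] by simp
  have M_int: "ennreal c * (\<integral>\<^sup>+y. f y \<partial>M) = (\<integral>\<^sup>+y. f y \<partial>mu)" if [measurable]: "f \<in> borel_measurable borel" for f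
    using c(2) by (simp add: M_def nn_integral_density nn_integral_cmult mult.assoc[symmetric] ennreal_mult[symmetric])
  have "prob_space M"
    using c by (intro prob_spaceI) (simp add: M_def emeasure_density nn_integral_cmult ennreal_mult[symmetric])
  then interpret M: prob_space M .
  interpret sequence_space M ..
  define Pn where "Pn = measure_pmf (poisson_pmf c)"
  interpret Pn: prob_space Pn unfolding Pn_def by (rule measure_pmf.prob_space_axioms)
  have sets_Pn[measurable_cong]: "sets Pn = sets (count_space UNIV)" by (simp add: Pn_def)
  define Q where "Q = Pn \<Otimes>\<^sub>M S"
  interpret Q: pair_prob_space Pn S ..
  define P where "P = distr Q (PiM UNIV (\<lambda>_. borel)) encode"
  have sets_P[measurable_cong]: "sets P = sets (PiM UNIV (\<lambda>_. borel))" by (simp add: P_def)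
  have coord[measurable]: "(\<lambda>x. x k) \<in> measurable S borel" for k
  proof -
    have "(\<lambda>x. x k) \<in> measurable S M" by measurable
    thus ?thesis using measurable_cong_sets[OF refl sets_M] by blast
  qed
  have enc_n[measurable]: "(\<lambda>x. encode (n, x)) \<in> measurable S (PiM UNIV (\<lambda>_. borel))" for n
  proof (rule measurable_PiM_single')
    show "(\<lambda>x. encode (n, x) i) \<in> borel_measurable S" for i
      unfolding encode_def prod.case
      by (cases "i = 0"; cases "odd i")
        (auto intro!: measurable_compose[OF coord] borel_measurable_continuous_onI continuous_intros)
  qed (auto simp: space_PiM)
  have enc[measurable]: "encode \<in> measurable Q (PiM UNIV (\<lambda>_. borel))"
  proof -
    have "(\<lambda>z. (\<lambda>n z. encode (n, snd z)) (fst z) z) \<in> measurable Q (PiM UNIV (\<lambda>_. borel))"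
      unfolding Q_def by (rule measurable_compose_countable) measurable
    thus ?thesis by simp
  qed
  define cnt where "cnt \<omega> = nat \<lfloor>\<omega> 0\<rfloor>" for \<omega> :: "nat \<Rightarrow> real"
  have cnt_enc[simp]: "cnt (encode (n, x)) = n" for n x by (simp add: cnt_def encode_0)
  have [measurable]: "cnt \<in> measurable P (count_space UNIV)"
    unfolding cnt_def by measurable
  have [measurable]: "(\<lambda>\<omega>. decode_points \<omega> k) \<in> measurable P borel" for k
    unfolding decode_points_def by measurable
  have int_P: "(\<integral>\<^sup>+\<omega>. f \<omega> \<partial>P) = (\<integral>\<^sup>+n. \<integral>\<^sup>+x. f (encode (n, x)) \<partial>S \<partial>Pn)"
    if [measurable]: "f \<in> borel_measurable P" for f :: "(nat \<Rightarrow> real) \<Rightarrow> ennreal"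
  proof -
    have [measurable]: "f \<in> borel_measurable (PiM UNIV (\<lambda>_. borel))"
      using that measurable_cong_sets[OF sets_P refl] by blast
    have "(\<integral>\<^sup>+\<omega>. f \<omega> \<partial>P) = (\<integral>\<^sup>+q. f (encode q) \<partial>Q)"
      unfolding P_def by (rule nn_integral_distr) measurable
    also have "\<dots> = (\<integral>\<^sup>+n. \<integral>\<^sup>+x. f (encode (n, x)) \<partial>S \<partial>Pn)"
      unfolding Q_def by (subst P.nn_integral_fst[symmetric]) (simp_all add: Q_def[symmetric])
    finally show ?thesis .
  qed
  have "prob_space P"
    unfolding P_def using Q.P.prob_space_axioms by (intro prob_space.prob_space_distr) (auto simp: Q_def[symmetric])
  then interpret PP: prob_space P .
  have "poisson_configuration P mu cnt decode_points"
  proof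
    show "cnt \<in> measurable P (count_space UNIV)" by measurable
    show "(\<lambda>\<omega>. decode_points \<omega> k) \<in> measurable P mu" for k by measurable
    have "emeasure P {\<omega> \<in> space P. cnt \<omega> = 0} = (\<integral>\<^sup>+\<omega>. indicator {\<omega> \<in> space P. cnt \<omega> = 0} \<omega> \<partial>P)"
      by simp
    also have "\<dots> = (\<integral>\<^sup>+n. \<integral>\<^sup>+x. indicator {0} n \<partial>S \<partial>Pn)"
    proof (subst int_P, measurable, intro nn_integral_cong)
      fix n x assume "x \<in> space S"
      hence "encode (n, x) \<in> space P" using measurable_space[OF enc_n] by (auto simp: P_def)
      thus "indicator {\<omega> \<in> space P. cnt \<omega> = 0} (encode (n, x)) = (indicator {0} n :: ennreal)"
        by (auto simp: indicator_def)
    qed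
    also have "\<dots> = ennreal (exp (-c))"
      using c(2) by (simp add: P.emeasure_space_1 Pn_def emeasure_pmf_single)
    finally show "0 < PP.prob {\<omega> \<in> space P. cnt \<omega> = 0}"
      by (simp add: PP.emeasure_eq_measure)
  next
    fix h :: "real \<times> real \<Rightarrow> (real \<times> real) multiset \<Rightarrow> ennreal"
    assume h[measurable]: "(\<lambda>(y, \<omega>). h y (config (cnt \<omega>) (decode_points \<omega>))) \<in> borel_measurable (mu \<Otimes>\<^sub>M P)"
    \<comment> \<open>Measurability of \<open>h\<close> on the coded space, pulled back along \<open>encode\<close> with \<open>n\<close> points.\<close>
    have hn[measurable]: "(\<lambda>(y, x). h y (config n x)) \<in> borel_measurable (M \<Otimes>\<^sub>M S)" for n
    proof -
      have "(\<lambda>z. (fst z, encode (n, snd z))) \<in> measurable (M \<Otimes>\<^sub>M S) (mu \<Otimes>\<^sub>M P)"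
        by measurable
      from measurable_compose[OF this h] show ?thesis
        by (simp add: decode_encode case_prod_beta)
    qed
    have hk: "(\<lambda>\<omega>. h (decode_points \<omega> k) (config (cnt \<omega>) (decode_points \<omega>))) \<in> borel_measurable P" for k
      by (rule measurable_compose[where f="\<lambda>\<omega>. (decode_points \<omega> k, \<omega>)", OF _ h, simplified]) measurable
    have [measurable]: "(\<lambda>\<omega>. \<Sum>k<cnt \<omega>. h (decode_points \<omega> k) (config (cnt \<omega>) (decode_points \<omega>))) \<in> borel_measurable P"
      by (rule measurable_compose_countable[where f="\<lambda>n \<omega>. \<Sum>k<n. h (decode_points \<omega> k) (config (cnt \<omega>) (decode_points \<omega>))"])
        (use hk in measurable)
    have h_add: "(\<lambda>(y, x). h y (add_mset y (config n x))) \<in> borel_measurable (M \<Otimes>\<^sub>M S)" for n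
    proof -
      have "(\<lambda>z. (fst z, case z of (y, x) \<Rightarrow> case_nat y x)) \<in> measurable (M \<Otimes>\<^sub>M S) (M \<Otimes>\<^sub>M S)"
        by measurable
      from measurable_compose[OF this hn[of "Suc n"]] show ?thesis
        by (simp add: config_Suc_case_nat case_prod_beta)
    qed
    define a where "a n y = (\<integral>\<^sup>+x. h y (add_mset y (config n x)) \<partial>S)" for n y
    have [measurable]: "(\<lambda>y. a n y) \<in> borel_measurable M" for n
      unfolding a_def using h_add[of n] by measurable
    have a_pair[measurable]: "(\<lambda>(n, y). a n y) \<in> borel_measurable (Pn \<Otimes>\<^sub>M M)"
    proof -
      have "(\<lambda>z. (\<lambda>n z. a n (snd z)) (fst z) z) \<in> borel_measurable (Pn \<Otimes>\<^sub>M M)"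
        by (rule measurable_compose_countable) measurable
      thus ?thesis by (simp add: case_prod_beta)
    qed
    interpret nM: pair_sigma_finite Pn M ..
    have "(\<integral>\<^sup>+\<omega>. (\<Sum>k<cnt \<omega>. h (decode_points \<omega> k) (config (cnt \<omega>) (decode_points \<omega>))) \<partial>P)
       = (\<integral>\<^sup>+n. \<integral>\<^sup>+x. (\<Sum>k<n. h (x k) (config n x)) \<partial>S \<partial>Pn)"
      by (subst int_P) (simp_all add: decode_encode)
    also have "\<dots> = ennreal c * (\<integral>\<^sup>+n. \<integral>\<^sup>+y. a n y \<partial>M \<partial>Pn)"
      unfolding Pn_def a_def using c(2) by (intro poisson_mecke hn) auto
    also have "(\<integral>\<^sup>+n. \<integral>\<^sup>+y. a n y \<partial>M \<partial>Pn) = (\<integral>\<^sup>+y. \<integral>\<^sup>+n. a n y \<partial>Pn \<partial>M)"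
      by (rule nM.Fubini'[symmetric]) measurable
    also have "ennreal c * \<dots> = (\<integral>\<^sup>+y. \<integral>\<^sup>+n. a n y \<partial>Pn \<partial>mu)"
    proof (rule M_int)
      have "(\<lambda>y. \<integral>\<^sup>+n. a n y \<partial>Pn) \<in> borel_measurable M" 
        using a_pair by measurable
      thus "(\<lambda>y. \<integral>\<^sup>+n. a n y \<partial>Pn) \<in> borel_measurable borel"
        using measurable_cong_sets[OF sets_M refl] by blast
    qed
    also have "\<dots> = (\<integral>\<^sup>+y. \<integral>\<^sup>+\<omega>. h y (add_mset y (config (cnt \<omega>) (decode_points \<omega>))) \<partial>P \<partial>mu)"
    proof (rule nn_integral_cong)
      fix y
      have y: "y \<in> space M" by (simp add: space_M)
      have q: "(\<lambda>\<omega>. h y (add_mset y (config (cnt \<omega>) (decode_points \<omega>)))) \<in> borel_measurable P"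
      proof (rule measurable_compose_countable[where f="\<lambda>n \<omega>. h y (add_mset y (config n (decode_points \<omega>)))" and g=cnt])
        fix n
        have "decode_points \<in> measurable P S"
          by (rule measurable_PiM_single') (auto simp: space_M, measurable)
        hence "(\<lambda>\<omega>. (y, decode_points \<omega>)) \<in> measurable P (M \<Otimes>\<^sub>M S)"
          using y by measurable
        from measurable_compose[OF this h_add[of n]]
        show "(\<lambda>\<omega>. h y (add_mset y (config n (decode_points \<omega>)))) \<in> borel_measurable P" by simp
      qed measurable
      show "(\<integral>\<^sup>+n. a n y \<partial>Pn) = (\<integral>\<^sup>+\<omega>. h y (add_mset y (config (cnt \<omega>) (decode_points \<omega>))) \<partial>P)"
        by (subst int_P[OF q]) (simp add: a_def decode_encode)
    qed
    finally show "(\<integral>\<^sup>+\<omega>. (\<Sum>k<cnt \<omega>. h (decode_points \<omega> k) (config (cnt \<omega>) (decode_points \<omega>))) \<partial>P) =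
      (\<integral>\<^sup>+y. \<integral>\<^sup>+\<omega>. h y (add_mset y (config (cnt \<omega>) (decode_points \<omega>))) \<partial>P \<partial>mu)" .
  qed
  thus ?thesis by blast
qed

section \<open>Trajectories driven by a finite point configuration\<close>

text \<open>
  Times carrying exactly one point. Ties have probability zero; ignoring them in the definition makes
  the path properties hold at every sample point.
\<close>
definition solo :: "(real \<times> 'z) multiset \<Rightarrow> real set" where
  "solo \<eta> = {t. size {#x \<in># \<eta>. fst x = t#} = 1}"

text \<open>
  Meaningful at \<open>solo\<close> times only.
\<close>
definition mark :: "(real \<times> 'z) multiset \<Rightarrow> real \<Rightarrow> 'z" where
  "mark \<eta> t = snd (THE x. x \<in># \<eta> \<and> fst x = t)"

text \<open>
  The state reached from \<open>i0\<close> when the points with time in \<open>C\<close> act in chronological order. With \<open>C = {..t}\<close>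
  it is the state at time \<open>t\<close>, with \<open>C = {..<t}\<close> the state just before \<open>t\<close>.
\<close>
definition trajectory :: "(real \<Rightarrow> 'z \<Rightarrow> 's \<Rightarrow> 's) \<Rightarrow> 's \<Rightarrow> (real \<times> 'z) multiset \<Rightarrow> real set \<Rightarrow> 's" where
  "trajectory mv i0 \<eta> C = foldl (\<lambda>i t. mv t (mark \<eta> t) i) i0 (sorted_list_of_set (solo \<eta> \<inter> C))"

lemma finite_solo: "finite (solo \<eta>)"
proof (rule finite_subset)
  show "solo \<eta> \<subseteq> fst ` set_mset \<eta>"
  proof
    fix t assume "t \<in> solo \<eta>"
    hence "size {#x \<in># \<eta>. fst x = t#} \<noteq> 0" by (simp add: solo_def)
    hence "{#x \<in># \<eta>. fst x = t#} \<noteq> {#}" by force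
    then obtain x where "x \<in># {#x \<in># \<eta>. fst x = t#}" by (metis multiset_nonemptyE)
    thus "t \<in> fst ` set_mset \<eta>" by auto
  qed
qed simp

lemma trajectory_cong_set: "solo \<eta> \<inter> C = solo \<eta> \<inter> D \<Longrightarrow> trajectory mv i0 \<eta> C = trajectory mv i0 \<eta> D"
  by (simp add: trajectory_def)

text \<open>
  Behind both adaptedness of the process and insensitivity of the past to points that are inserted
  later.
\<close>
lemma trajectory_restrict:
  assumes "{#x \<in># \<eta>. fst x \<in> C#} = {#x \<in># \<eta>'. fst x \<in> C#}"
  shows "trajectory mv i0 \<eta> C = trajectory mv i0 \<eta>' C"
proof -
  have f: "{#x \<in># \<eta>. fst x = t#} = {#x \<in># \<eta>'. fst x = t#}" if "t \<in> C" for t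
  proof -
    have "{#x \<in># \<eta>. fst x = t#} = {#x \<in># {#x \<in># \<eta>. fst x \<in> C#}. fst x = t#}" for \<eta> :: "(real \<times> 'a) multiset"
      using that by (auto simp: filter_filter_mset intro!: filter_mset_cong)
    thus ?thesis using assms by metis
  qed
  hence s: "solo \<eta> \<inter> C = solo \<eta>' \<inter> C" by (auto simp: solo_def)
  have m: "mark \<eta> t = mark \<eta>' t" if "t \<in> C" for t
  proof -
    have "x \<in># \<eta> \<and> fst x = t \<longleftrightarrow> x \<in># \<eta>' \<and> fst x = t" for x
      using arg_cong[OF f[OF that], of "\<lambda>M. x \<in># M"] by simp
    thus ?thesis by (simp add: mark_def)
  qed
  show ?thesis unfolding trajectory_def s
    by (intro foldl_cong) (auto simp: m finite_solo)
qed

lemma trajectory_step: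
  assumes "t \<in> solo \<eta>" and "solo \<eta> \<inter> D = insert t (solo \<eta> \<inter> C)" and "\<And>s. s \<in> solo \<eta> \<inter> C \<Longrightarrow> s < t"
  shows "trajectory mv i0 \<eta> D = mv t (mark \<eta> t) (trajectory mv i0 \<eta> C)"
proof -
  have fin: "finite (solo \<eta> \<inter> C)" "finite (solo \<eta> \<inter> D)" using finite_solo by auto
  have "sorted_list_of_set (solo \<eta> \<inter> D) = sorted_list_of_set (solo \<eta> \<inter> C) @ [t]"
  proof (rule strict_sorted_equal)
    show "sorted_wrt (<) (sorted_list_of_set (solo \<eta> \<inter> D))" by simp
    show "sorted_wrt (<) (sorted_list_of_set (solo \<eta> \<inter> C) @ [t])"
      using assms(3) fin(1) by (auto simp: sorted_wrt_append)
    show "set (sorted_list_of_set (solo \<eta> \<inter> D)) = set (sorted_list_of_set (solo \<eta> \<inter> C) @ [t])"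
      unfolding set_sorted_list_of_set[OF fin(2)] by (simp add: fin(1) assms(2))
  qed
  thus ?thesis by (simp add: trajectory_def)
qed

lemma trajectory_invariant:
  assumes "Q i0" and "\<And>t z i. Q i \<Longrightarrow> Q (mv t z i)"
  shows "Q (trajectory mv i0 \<eta> C)"
proof -
  have "Q (foldl (\<lambda>i t. mv t (mark \<eta> t) i) i0 l)" for l
    by (induction l rule: rev_induct) (auto simp: assms)
  thus ?thesis by (simp add: trajectory_def)
qed

text \<open>
  Telescoping over the jumps in \<open>(r, s)\<close>, by induction on their number: the last one is split off, and
  what precedes it ends just before a jump time again. This is why the left limit is treated first.
\<close>
lemma trajectory_increment_left:
  fixes f :: "'s \<Rightarrow> real"
  assumes "r < s"
  shows "f (trajectory mv i0 \<eta> {..<s}) - f (trajectory mv i0 \<eta> {..r}) =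
    (\<Sum>t\<in>solo \<eta> \<inter> {r<..<s}. f (mv t (mark \<eta> t) (trajectory mv i0 \<eta> {..<t})) - f (trajectory mv i0 \<eta> {..<t}))"
  using assms
proof (induction "card (solo \<eta> \<inter> {r<..<s})" arbitrary: s rule: less_induct)
  case less
  let ?X = "solo \<eta> \<inter> {r<..<s}"
  have fin: "finite ?X" using finite_solo by blast
  show ?case
  proof (cases "?X = {}")
    case True
    hence "solo \<eta> \<inter> {..<s} = solo \<eta> \<inter> {..r}" using less.prems by force
    hence "trajectory mv i0 \<eta> {..<s} = trajectory mv i0 \<eta> {..r}" by (rule trajectory_cong_set)
    thus ?thesis using True by simp
  next
    case False
    define t where "t = Max ?X"
    have t: "t \<in> ?X" using Max_in[OF fin False] by (simp add: t_def)
    have t_max: "u \<le> t" if "u \<in> ?X" for u using Max_ge[OF fin that] by (simp add: t_def)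
    have X: "?X = insert t (solo \<eta> \<inter> {r<..<t})" using t t_max by force
    have card: "card (solo \<eta> \<inter> {r<..<t}) < card ?X"
      unfolding X using finite_solo by (subst card_insert_disjoint) auto
    have "solo \<eta> \<inter> {..<s} = insert t (solo \<eta> \<inter> {..<t})"
    proof -
      have "u < t \<or> u = t" if "u \<in> solo \<eta>" "u < s" for u
        using t_max[of u] that t by (cases "r < u") auto
      thus ?thesis using t by auto
    qed
    hence step: "trajectory mv i0 \<eta> {..<s} = mv t (mark \<eta> t) (trajectory mv i0 \<eta> {..<t})"
      using t by (intro trajectory_step) auto
    have "(\<Sum>t\<in>?X. f (mv t (mark \<eta> t) (trajectory mv i0 \<eta> {..<t})) - f (trajectory mv i0 \<eta> {..<t}))
       = f (mv t (mark \<eta> t) (trajectory mv i0 \<eta> {..<t})) - f (trajectory mv i0 \<eta> {..<t}) 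
         + (f (trajectory mv i0 \<eta> {..<t}) - f (trajectory mv i0 \<eta> {..r}))"
      unfolding X using less.hyps[OF card] t finite_solo by (subst sum.insert) auto
    thus ?thesis by (simp add: step)
  qed
qed

lemma trajectory_increment:
  fixes f :: "'s \<Rightarrow> real"
  assumes "r \<le> s"
  shows "f (trajectory mv i0 \<eta> {..s}) - f (trajectory mv i0 \<eta> {..r}) =
    (\<Sum>t\<in>solo \<eta> \<inter> {r<..s}. f (mv t (mark \<eta> t) (trajectory mv i0 \<eta> {..<t})) - f (trajectory mv i0 \<eta> {..<t}))"
proof (cases "r = s")
  case False
  hence rs: "r < s" using assms by simp
  show ?thesis
  proof (cases "s \<in> solo \<eta>")
    case True
    have "trajectory mv i0 \<eta> {..s} = mv s (mark \<eta> s) (trajectory mv i0 \<eta> {..<s})"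
      using True by (intro trajectory_step) auto
    moreover have "solo \<eta> \<inter> {r<..s} = insert s (solo \<eta> \<inter> {r<..<s})" using True rs by auto
    moreover have "finite (solo \<eta> \<inter> {r<..<s})" using finite_solo by blast
    ultimately show ?thesis using trajectory_increment_left[OF rs, of f mv i0 \<eta>]
      by (simp add: sum.insert)
  next
    case False
    have "trajectory mv i0 \<eta> {..s} = trajectory mv i0 \<eta> {..<s}"
      using False by (intro trajectory_cong_set) (auto simp: less_le)
    moreover have "solo \<eta> \<inter> {r<..s} = solo \<eta> \<inter> {r<..<s}" using False by (auto simp: less_le)
    ultimately show ?thesis using trajectory_increment_left[OF rs, of f mv i0 \<eta>] by simp
  qed
qed simp

lemma eventually_trajectory_right: "eventually (\<lambda>r. trajectory mv i0 \<eta> {..r} = trajectory mv i0 \<eta> {..s}) (at_right s)"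
proof -
  have "eventually (\<lambda>r. \<forall>t\<in>solo \<eta>. s < t \<longrightarrow> r < t) (at_right s)"
  proof (rule eventually_ball_finite[OF finite_solo], rule ballI)
    fix t show "eventually (\<lambda>r. s < t \<longrightarrow> r < t) (at_right s)"
      by (cases "s < t") (auto simp: eventually_at_right)
  qed
  moreover have "eventually (\<lambda>r. s < r) (at_right s)" by (rule eventually_at_right_less)
  ultimately show ?thesis
  proof eventually_elim
    case (elim r)
    have "solo \<eta> \<inter> {..r} = solo \<eta> \<inter> {..s}" using elim by force
    thus ?case by (rule trajectory_cong_set)
  qed
qed

lemma eventually_trajectory_left: "eventually (\<lambda>r. trajectory mv i0 \<eta> {..r} = trajectory mv i0 \<eta> {..<s}) (at_left s)"
proof -
  have "eventually (\<lambda>r. \<forall>t\<in>solo \<eta>. t < s \<longrightarrow> t < r) (at_left s)"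
  proof (rule eventually_ball_finite[OF finite_solo], rule ballI)
    fix t show "eventually (\<lambda>r. t < s \<longrightarrow> t < r) (at_left s)"
      by (cases "t < s") (auto simp: eventually_at_left)
  qed
  moreover have "eventually (\<lambda>r. r < s) (at_left s)" by (simp add: eventually_at_filter)
  ultimately show ?thesis
  proof eventually_elim
    case (elim r)
    have "solo \<eta> \<inter> {..r} = solo \<eta> \<inter> {..<s}" using elim by force
    thus ?case by (rule trajectory_cong_set)
  qed
qed

lemma size_filter_config: "size {#y \<in># config n x. Q y#} = card {k. k < n \<and> Q (x k)}"
proof (induction n)
  case (Suc n)
  have "{k. k < Suc n \<and> Q (x k)} = (if Q (x n) then insert n {k. k < n \<and> Q (x k)} else {k. k < n \<and> Q (x k)})"
    by (auto simp: less_Suc_eq)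
  thus ?case using Suc by (simp add: config_def)
qed (simp add: config_def)

lemma set_config: "set_mset (config n x) = x ` {..<n}"
  by (auto simp: config_def)

lemma solo_config_iff: "t \<in> solo (config n x) \<longleftrightarrow> (\<exists>!k. k < n \<and> fst (x k) = t)"
  by (simp add: solo_def size_filter_config card_1_singleton_iff set_eq_iff) metis

lemma solo_config_point: 
  assumes "k < n"
  shows "fst (x k) \<in> solo (config n x) \<longleftrightarrow> (\<forall>j<n. fst (x j) = fst (x k) \<longrightarrow> j = k)"
  using assms by (auto simp: solo_config_iff)

lemma mark_config:
  assumes "k < n" "fst (x k) \<in> solo (config n x)"
  shows "mark (config n x) (fst (x k)) = snd (x k)"
proof -
  have "(THE y. y \<in># config n x \<and> fst y = fst (x k)) = x k"
    using assms(1) assms(2)[unfolded solo_config_point[OF assms(1)]]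
    by (intro the_equality) (auto simp: set_config)
  thus ?thesis by (simp add: mark_def)
qed

text \<open>
  Turns the sum over jump times of \<open>trajectory_increment\<close> into the sum over points of the Mecke formula.
\<close>
lemma sum_solo_config:
  fixes g :: "real \<times> 'z \<Rightarrow> 'b :: comm_monoid_add"
  shows "(\<Sum>k<n. if fst (x k) \<in> solo (config n x) \<and> fst (x k) \<in> C then g (x k) else 0)
     = (\<Sum>t\<in>solo (config n x) \<inter> C. g (t, mark (config n x) t))"
proof -
  have "(\<Sum>k<n. if fst (x k) \<in> solo (config n x) \<and> fst (x k) \<in> C then g (x k) else 0)
     = (\<Sum>k | k < n \<and> fst (x k) \<in> solo (config n x) \<and> fst (x k) \<in> C. g (x k))"
    by (rule sum.mono_neutral_cong_right) auto
  also have "\<dots> = (\<Sum>t\<in>solo (config n x) \<inter> C. g (t, mark (config n x) t))"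
  proof (rule sum.reindex_bij_witness_not_neutral[where S'="{}" and T'="{}" and j="\<lambda>k. fst (x k)" and i="\<lambda>t. THE k. k < n \<and> fst (x k) = t"])
    fix k assume "k \<in> {k. k < n \<and> fst (x k) \<in> solo (config n x) \<and> fst (x k) \<in> C} - {}"
    hence k: "k < n" "fst (x k) \<in> solo (config n x)" "fst (x k) \<in> C" by auto
    show "(THE k'. k' < n \<and> fst (x k') = fst (x k)) = k"
      using k(1) k(2)[unfolded solo_config_point[OF k(1)]] by (intro the_equality) auto
  next
    fix k assume "k \<in> {k. k < n \<and> fst (x k) \<in> solo (config n x) \<and> fst (x k) \<in> C}"
    thus "g (fst (x k), mark (config n x) (fst (x k))) = g (x k)"
      by (simp add: mark_config)
  next
    fix t assume t: "t \<in> solo (config n x) \<inter> C - {}"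
    hence "\<exists>!k. k < n \<and> fst (x k) = t" by (simp add: solo_config_iff)
    from theI'[OF this] show "fst (x (THE k. k < n \<and> fst (x k) = t)) = t"
      "(THE k. k < n \<and> fst (x k) = t) \<in> {k. k < n \<and> fst (x k) \<in> solo (config n x) \<and> fst (x k) \<in> C} - {}"
      using t by auto
  qed auto
  finally show ?thesis .
qed

text \<open>
  Sorting by time is replaced by a search over all index lists \<open>l\<close> that could be the sorted enumeration.
  There are countably many of them, and each condition on \<open>l\<close> is visibly measurable.
\<close>
lemma trajectory_config_iff:
  "trajectory mv i0 (config n x) C = j \<longleftrightarrow>
    (\<exists>l. sorted_wrt (\<lambda>a b. fst (x a) < fst (x b)) l \<and>
       (\<forall>k. k \<in> set l \<longleftrightarrow> k < n \<and> fst (x k) \<in> C \<and> (\<forall>k'<n. fst (x k') = fst (x k) \<longrightarrow> k' = k)) \<and>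
       foldl (\<lambda>i k. mv (fst (x k)) (snd (x k)) i) i0 l = j)"
    (is "?L \<longleftrightarrow> (\<exists>l. ?S l \<and> ?M l \<and> ?F l = j)")
proof -
  let ?s = "solo (config n x) \<inter> C"
  have fin: "finite ?s" using finite_solo by blast
  have F: "?F l = trajectory mv i0 (config n x) C" if S: "?S l" and M: "?M l" for l
  proof -
    have "map (\<lambda>k. fst (x k)) l = sorted_list_of_set ?s"
    proof (rule strict_sorted_equal)
      show "sorted_wrt (<) (map (\<lambda>k. fst (x k)) l)" using S by (simp add: sorted_wrt_map)
      show "set (map (\<lambda>k. fst (x k)) l) = set (sorted_list_of_set ?s)"
        unfolding set_sorted_list_of_set[OF fin] set_map
      proof (intro equalityI subsetI)
        fix t assume "t \<in> (\<lambda>k. fst (x k)) ` set l"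
        then obtain k where "k \<in> set l" and t: "t = fst (x k)" by blast
        hence k: "k < n" "fst (x k) \<in> C" "\<forall>k'<n. fst (x k') = fst (x k) \<longrightarrow> k' = k"
          using M by blast+
        thus "t \<in> ?s" unfolding t using solo_config_point[OF k(1), of x] by blast
      next
        fix t assume t: "t \<in> ?s"
        then obtain k where k: "k < n" "fst (x k) = t" using solo_config_iff by blast
        hence "\<forall>k'<n. fst (x k') = fst (x k) \<longrightarrow> k' = k"
          using t solo_config_point[OF k(1), of x] by blast
        hence "k \<in> set l" using k t M by blast
        thus "t \<in> (\<lambda>k. fst (x k)) ` set l" using k by blast
      qed
    qed simp
    hence "trajectory mv i0 (config n x) C = foldl (\<lambda>i t. mv t (mark (config n x) t) i) i0 (map (\<lambda>k. fst (x k)) l)"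
      by (simp add: trajectory_def)
    also have "\<dots> = foldl (\<lambda>i k. mv (fst (x k)) (mark (config n x) (fst (x k))) i) i0 l"
      by (simp add: foldl_map)
    also have "\<dots> = ?F l"
      using M by (intro foldl_cong refl) (simp add: mark_config solo_config_point)
    finally show ?thesis by simp
  qed
  have "\<exists>l. ?S l \<and> ?M l"
  proof -
    define ix where "ix t = (THE k. k < n \<and> fst (x k) = t)" for t
    have ix: "ix t < n" "fst (x (ix t)) = t" if "t \<in> ?s" for t
    proof -
      have "\<exists>!k. k < n \<and> fst (x k) = t" using that by (simp add: solo_config_iff)
      from theI'[OF this] show "ix t < n" "fst (x (ix t)) = t" by (auto simp: ix_def)
    qed
    let ?l = "map ix (sorted_list_of_set ?s)"
    have "?S ?l"
      using strict_sorted_list_of_set[of ?s] unfolding sorted_wrt_map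
      by (rule sorted_wrt_mono_rel[rotated]) (use fin ix in auto)
    moreover have "?M ?l"
    proof
      fix k
      show "k \<in> set ?l \<longleftrightarrow> k < n \<and> fst (x k) \<in> C \<and> (\<forall>k'<n. fst (x k') = fst (x k) \<longrightarrow> k' = k)"
      proof
        assume "k \<in> set ?l"
        then obtain t where t: "t \<in> ?s" "k = ix t" using fin by auto
        hence k: "k < n" "fst (x k) = t" using ix by auto
        have "fst (x k) \<in> ?s" using t(1) k(2) by simp
        thus "k < n \<and> fst (x k) \<in> C \<and> (\<forall>k'<n. fst (x k') = fst (x k) \<longrightarrow> k' = k)"
          using k(1) solo_config_point[OF k(1), of x] by blast
      next
        assume k: "k < n \<and> fst (x k) \<in> C \<and> (\<forall>k'<n. fst (x k') = fst (x k) \<longrightarrow> k' = k)"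
        hence "k < n" by blast
        hence t: "fst (x k) \<in> ?s" using k solo_config_point by blast
        from ix[OF t] k have "ix (fst (x k)) = k" by blast
        thus "k \<in> set ?l" using t unfolding set_map set_sorted_list_of_set[OF fin] by (metis image_eqI)
      qed
    qed
    ultimately show ?thesis by blast
  qed
  then obtain l where l: "?S l" "?M l" by blast
  show ?thesis
  proof
    assume ?L
    hence "?F l = j" using F[OF l] by simp
    thus "\<exists>l. ?S l \<and> ?M l \<and> ?F l = j" using l by blast
  next
    assume "\<exists>l. ?S l \<and> ?M l \<and> ?F l = j"
    then obtain l' where "?S l'" "?M l'" "?F l' = j" by blast
    thus ?L using F by simp
  qed
qed

lemma measurable_trajectory_config:
  fixes mv :: "real \<Rightarrow> real \<Rightarrow> 's::countable \<Rightarrow> 's"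
  assumes c[measurable]: "c \<in> measurable Z (count_space UNIV)"
    and p[measurable]: "\<And>k. (\<lambda>z. p z k) \<in> measurable Z (borel :: (real \<times> real) measure)"
    and C[measurable]: "\<And>k. Measurable.pred Z (\<lambda>z. fst (p z k) \<in> C z)"
    and mv[measurable]: "\<And>i. (\<lambda>y. mv (fst y) (snd y) i) \<in> measurable borel (count_space UNIV)"
  shows "(\<lambda>z. trajectory mv i0 (config (c z) (p z)) (C z)) \<in> measurable Z (count_space UNIV)"
proof -
  have [measurable]: "(\<lambda>z. fst (p z k)) \<in> borel_measurable Z" for k
    by (rule measurable_compose[OF p]) (intro borel_measurable_continuous_onI continuous_intros)
  have F[measurable]: "(\<lambda>z. foldl (\<lambda>i k. mv (fst (p z k)) (snd (p z k)) i) i0 l) \<in> measurable Z (count_space UNIV)" for l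
  proof (induction l rule: rev_induct)
    case (snoc k l)
    have "(\<lambda>z. mv (fst (p z k)) (snd (p z k)) i) \<in> measurable Z (count_space UNIV)" for i
      by (rule measurable_compose[OF p mv])
    from measurable_compose_countable[OF this snoc] show ?case by simp
  qed simp
  have "Measurable.pred Z (\<lambda>z. trajectory mv i0 (config (c z) (p z)) (C z) = j)" for j
    unfolding trajectory_config_iff sorted_wrt_iff_nth_less by measurable
  thus ?thesis
    by (intro measurable_count_space_eq2_countable[THEN iffD2])
       (auto simp: pred_def vimage_def Int_def conj_commute)
qed

section \<open>Joint measurability of state processes and the generator\<close>

text \<open>
  A right continuous path is the limit of its values on the grids of mesh \<open>1 / (n + 1)\<close>, read off at the
  next grid point to the right; for fixed \<open>n\<close> only countably many grid values occur.
\<close>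
lemma right_continuous_jointly_measurable:
  fixes X :: "real \<Rightarrow> 'w \<Rightarrow> nat"
  assumes s: "0 \<le> s"
    and adapted: "\<And>v. v \<in> {0..s} \<Longrightarrow> X v \<in> measurable G (count_space UNIV)"
    and right: "\<And>v \<omega>. v \<in> {0..<s} \<Longrightarrow> \<omega> \<in> space G \<Longrightarrow> eventually (\<lambda>r. X r \<omega> = X v \<omega>) (at_right v)"
  shows "(\<lambda>(v, \<omega>). X v \<omega>) \<in> measurable (restrict_space borel {0..s} \<Otimes>\<^sub>M G) (count_space UNIV)"
proof -
  let ?Z = "restrict_space borel {0..s} \<Otimes>\<^sub>M G"
  \<comment> \<open>The grid point is strictly to the right of \<open>v\<close>, except at the endpoint \<open>s\<close>.\<close>
  define a :: "nat \<Rightarrow> int \<Rightarrow> real" where "a n k = max 0 (min s ((of_int k + 1) / real (Suc n)))" for n k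
  have a_in: "a n k \<in> {0..s}" for n k using s by (simp add: a_def)
  have lim: "(\<lambda>n. real (X (a n \<lfloor>v * real (Suc n)\<rfloor>) \<omega>)) \<longlonglongrightarrow> real (X v \<omega>)"
    if v: "v \<in> {0..s}" and w: "\<omega> \<in> space G" for v \<omega>
  proof (rule tendsto_eventually, cases "v = s")
    case True
    have "a n \<lfloor>v * real (Suc n)\<rfloor> = v" for n
    proof -
      have "v * real (Suc n) \<le> of_int \<lfloor>v * real (Suc n)\<rfloor> + 1" by linarith
      hence "v \<le> (of_int \<lfloor>v * real (Suc n)\<rfloor> + 1) / real (Suc n)" by (simp add: pos_le_divide_eq)
      thus ?thesis using True s by (simp add: a_def)
    qed
    thus "\<forall>\<^sub>F n in sequentially. real (X (a n \<lfloor>v * real (Suc n)\<rfloor>) \<omega>) = real (X v \<omega>)" by simp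
  next
    case False
    hence "eventually (\<lambda>r. X r \<omega> = X v \<omega>) (at_right v)" using right v w by auto
    then obtain b where b: "v < b" "\<And>r. v < r \<Longrightarrow> r < b \<Longrightarrow> X r \<omega> = X v \<omega>"
      unfolding eventually_at_right[OF gt_ex[of v, THEN someI_ex]] by blast
    have "eventually (\<lambda>n. 1 / real (Suc n) < b - v) sequentially"
      using b(1) LIMSEQ_inverse_real_of_nat[THEN order_tendstoD(2), of "b - v"] by (simp add: inverse_eq_divide)
    thus "\<forall>\<^sub>F n in sequentially. real (X (a n \<lfloor>v * real (Suc n)\<rfloor>) \<omega>) = real (X v \<omega>)"
    proof eventually_elim
      case (elim n)
      let ?q = "(of_int \<lfloor>v * real (Suc n)\<rfloor> + 1) / real (Suc n)"
      have "v * real (Suc n) < of_int \<lfloor>v * real (Suc n)\<rfloor> + 1" by linarith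
      hence 1: "v < ?q" by (subst pos_less_divide_eq) auto
      have "of_int \<lfloor>v * real (Suc n)\<rfloor> + 1 \<le> v * real (Suc n) + 1" by linarith
      hence "?q \<le> (v * real (Suc n) + 1) / real (Suc n)" by (intro divide_right_mono) auto
      hence 2: "?q \<le> v + 1 / real (Suc n)" by (simp add: add_divide_distrib del: of_nat_Suc)
      have "v < a n \<lfloor>v * real (Suc n)\<rfloor>" "a n \<lfloor>v * real (Suc n)\<rfloor> < b"
        using 1 2 elim v False by (auto simp: a_def min_def max_def)
      thus ?case using b(2) by simp
    qed
  qed
  have "(\<lambda>x. x) \<in> measurable (restrict_space borel {0..s}) (borel :: real measure)"
    by (rule measurable_restrict_space1) simp
  hence [measurable]: "(\<lambda>z. fst z) \<in> borel_measurable ?Z"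
    by (rule measurable_compose[OF measurable_fst])
  have [measurable]: "(\<lambda>z. \<lfloor>fst z * real (Suc n)\<rfloor>) \<in> measurable ?Z (count_space UNIV)" for n
    by measurable
  have "(\<lambda>z. real (X (a n \<lfloor>fst z * real (Suc n)\<rfloor>) (snd z))) \<in> borel_measurable ?Z" for n
  proof (rule measurable_compose_countable[where f="\<lambda>k z. real (X (a n k) (snd z))"])
    fix k show "(\<lambda>z. real (X (a n k) (snd z))) \<in> borel_measurable ?Z"
      using adapted[OF a_in[of n k]] by measurable
  qed measurable
  hence "(\<lambda>z. real (X (fst z) (snd z))) \<in> borel_measurable ?Z"
  proof (rule borel_measurable_LIMSEQ_real[rotated])
    fix z assume "z \<in> space ?Z"
    thus "(\<lambda>n. real (X (a n \<lfloor>fst z * real (Suc n)\<rfloor>) (snd z))) \<longlonglongrightarrow> real (X (fst z) (snd z))"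
      by (intro lim) (auto simp: space_pair_measure space_restrict_space)
  qed
  hence "(\<lambda>z. nat \<lfloor>real (X (fst z) (snd z))\<rfloor>) \<in> measurable ?Z (count_space UNIV)" by measurable
  thus ?thesis by (simp add: case_prod_beta)
qed

text \<open>
  At \<open>i = 0\<close> the term with \<open>i - 1\<close> vanishes, because then \<open>a = 0\<close>.
\<close>
lemma generator_eq:
  assumes "i \<le> N" "a \<le> i"
  shows "generator N lam t a f i =
    (if i < N then lam t * (f (i + 1) - f i) else 0) + real a * (f (i - 1) - f i)"
proof -
  have 1: "(\<Sum>j\<in>{0..N}. (if i < N \<and> j = i + 1 then lam t else 0) * (f j - f i)) =
     (if i < N then lam t * (f (i + 1) - f i) else 0)"
    by (cases "i < N") (simp_all add: if_distrib[of "\<lambda>x. x * _"] sum.delta cong: if_cong)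
  have 2: "(\<Sum>j\<in>{0..N}. (if i = j + 1 then real a else 0) * (f j - f i)) = real a * (f (i - 1) - f i)"
  proof (cases i)
    case (Suc k)
    hence "(\<Sum>j\<in>{0..N}. (if i = j + 1 then real a else 0) * (f j - f i))
       = (\<Sum>j\<in>{0..N}. if k = j then real a * (f j - f i) else 0)" by (intro sum.cong) auto
    thus ?thesis using assms Suc by simp
  qed (use assms in simp)
  have "generator N lam t a f i = (\<Sum>j\<in>{0..N}. (if i < N \<and> j = i + 1 then lam t else 0) * (f j - f i)
     + (if i = j + 1 then real a else 0) * (f j - f i))"
    unfolding generator_def jump_rate_def by (intro sum.cong) auto
  thus ?thesis by (simp only: sum.distrib 1 2)
qed


section \<open>Existence of a process controlled by a feedback rule\<close>

context poisson_configuration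
begin

abbreviation "conf \<omega> \<equiv> config (cnt \<omega>) (pts \<omega>)"

text \<open>
  For bounded \<open>H\<close> and finite intensity both sides of the Mecke formula are finite, which gives
  integrability of the point sum together with its real valued integral.
\<close>
lemma mecke_nonneg:
  fixes H :: "'x \<Rightarrow> 'x multiset \<Rightarrow> real"
  assumes fin: "finite_measure mu"
    and H1[measurable]: "(\<lambda>(y, \<omega>). H y (conf \<omega>)) \<in> borel_measurable (mu \<Otimes>\<^sub>M P)"
    and H2[measurable]: "(\<lambda>(y, \<omega>). H y (add_mset y (conf \<omega>))) \<in> borel_measurable (mu \<Otimes>\<^sub>M P)"
    and H: "\<And>y \<eta>. 0 \<le> H y \<eta>" "\<And>y \<eta>. H y \<eta> \<le> B"
  shows "integrable P (\<lambda>\<omega>. \<Sum>k<cnt \<omega>. H (pts \<omega> k) (conf \<omega>))"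
    and "(\<integral>\<omega>. (\<Sum>k<cnt \<omega>. H (pts \<omega> k) (conf \<omega>)) \<partial>P) = (\<integral>z. H (fst z) (add_mset (fst z) (conf (snd z))) \<partial>(mu \<Otimes>\<^sub>M P))"
proof -
  interpret mu: finite_measure mu by fact
  interpret mP: pair_sigma_finite mu P ..
  have fin2: "finite_measure (mu \<Otimes>\<^sub>M P)" by (rule finite_measure_pair_measure) unfold_locales
  have H2'[measurable]: "(\<lambda>z. H (fst z) (add_mset (fst z) (conf (snd z)))) \<in> borel_measurable (mu \<Otimes>\<^sub>M P)"
    using H2 by (simp add: case_prod_beta)
  have int: "integrable (mu \<Otimes>\<^sub>M P) (\<lambda>z. H (fst z) (add_mset (fst z) (conf (snd z))))"
    using H by (intro finite_measure.integrable_const_bound[OF fin2, of _ B]) (auto)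
  have Hk: "(\<lambda>\<omega>. H (pts \<omega> k) (conf \<omega>)) \<in> borel_measurable P" for k
    by (rule measurable_compose[where f="\<lambda>\<omega>. (pts \<omega> k, \<omega>)", OF _ H1, simplified]) measurable
  have [measurable]: "(\<lambda>\<omega>. \<Sum>k<cnt \<omega>. H (pts \<omega> k) (conf \<omega>)) \<in> borel_measurable P"
    by (rule measurable_compose_countable[where f="\<lambda>n \<omega>. \<Sum>k<n. H (pts \<omega> k) (conf \<omega>)"])
      (use Hk in measurable)
  have "(\<integral>\<^sup>+\<omega>. ennreal (\<Sum>k<cnt \<omega>. H (pts \<omega> k) (conf \<omega>)) \<partial>P)
     = (\<integral>\<^sup>+\<omega>. (\<Sum>k<cnt \<omega>. ennreal (H (pts \<omega> k) (conf \<omega>))) \<partial>P)"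
    using H by (intro nn_integral_cong) (simp add: sum_ennreal)
  also have "\<dots> = (\<integral>\<^sup>+y. \<integral>\<^sup>+\<omega>. ennreal (H y (add_mset y (conf \<omega>))) \<partial>P \<partial>mu)"
    by (rule mecke) measurable
  also have "\<dots> = (\<integral>\<^sup>+z. ennreal (H (fst z) (add_mset (fst z) (conf (snd z)))) \<partial>(mu \<Otimes>\<^sub>M P))"
    by (subst nn_integral_fst[symmetric]) simp_all
  also have "\<dots> = ennreal (\<integral>z. H (fst z) (add_mset (fst z) (conf (snd z))) \<partial>(mu \<Otimes>\<^sub>M P))"
    using int H by (intro nn_integral_eq_integral) auto
  finally have e: "(\<integral>\<^sup>+\<omega>. ennreal (\<Sum>k<cnt \<omega>. H (pts \<omega> k) (conf \<omega>)) \<partial>P) = \<dots>" .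
  have nn: "0 \<le> (\<Sum>k<cnt \<omega>. H (pts \<omega> k) (conf \<omega>))" for \<omega> by (intro sum_nonneg H)
  show "integrable P (\<lambda>\<omega>. \<Sum>k<cnt \<omega>. H (pts \<omega> k) (conf \<omega>))"
    using nn by (intro integrableI_nonneg) (auto simp: e)
  show "(\<integral>\<omega>. (\<Sum>k<cnt \<omega>. H (pts \<omega> k) (conf \<omega>)) \<partial>P) = (\<integral>z. H (fst z) (add_mset (fst z) (conf (snd z))) \<partial>(mu \<Otimes>\<^sub>M P))"
    using nn H by (subst integral_eq_nn_integral) (auto simp: e integral_nonneg)
qed

lemma mecke_bounded:
  fixes H :: "'x \<Rightarrow> 'x multiset \<Rightarrow> real"
  assumes fin: "finite_measure mu"
    and H1[measurable]: "(\<lambda>(y, \<omega>). H y (conf \<omega>)) \<in> borel_measurable (mu \<Otimes>\<^sub>M P)"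
    and H2[measurable]: "(\<lambda>(y, \<omega>). H y (add_mset y (conf \<omega>))) \<in> borel_measurable (mu \<Otimes>\<^sub>M P)"
    and H: "\<And>y \<eta>. \<bar>H y \<eta>\<bar> \<le> B"
  shows "(\<integral>\<omega>. (\<Sum>k<cnt \<omega>. H (pts \<omega> k) (conf \<omega>)) \<partial>P) = (\<integral>z. H (fst z) (add_mset (fst z) (conf (snd z))) \<partial>(mu \<Otimes>\<^sub>M P))"
proof -
  interpret mu: finite_measure mu by fact
  have fin2: "finite_measure (mu \<Otimes>\<^sub>M P)" by (rule finite_measure_pair_measure) unfold_locales
  define Hp Hm where "Hp y \<eta> = max 0 (H y \<eta>)" and "Hm y \<eta> = max 0 (- H y \<eta>)" for y \<eta>
  have eq: "H y \<eta> = Hp y \<eta> - Hm y \<eta>" for y \<eta> by (simp add: Hp_def Hm_def)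
  have m1: "(\<lambda>(y, \<omega>). Hp y (conf \<omega>)) \<in> borel_measurable (mu \<Otimes>\<^sub>M P)"
    "(\<lambda>(y, \<omega>). Hm y (conf \<omega>)) \<in> borel_measurable (mu \<Otimes>\<^sub>M P)"
    "(\<lambda>(y, \<omega>). Hp y (add_mset y (conf \<omega>))) \<in> borel_measurable (mu \<Otimes>\<^sub>M P)"
    "(\<lambda>(y, \<omega>). Hm y (add_mset y (conf \<omega>))) \<in> borel_measurable (mu \<Otimes>\<^sub>M P)"
    unfolding Hp_def Hm_def by measurable
  have b: "0 \<le> Hp y \<eta>" "Hp y \<eta> \<le> B" "0 \<le> Hm y \<eta>" "Hm y \<eta> \<le> B" for y \<eta>
    using H[of y \<eta>] by (auto simp: Hp_def Hm_def)
  have int: "integrable (mu \<Otimes>\<^sub>M P) (\<lambda>z. Hp (fst z) (add_mset (fst z) (conf (snd z))))"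
    "integrable (mu \<Otimes>\<^sub>M P) (\<lambda>z. Hm (fst z) (add_mset (fst z) (conf (snd z))))"
    using b m1(3,4) by (auto intro!: finite_measure.integrable_const_bound[OF fin2, of _ B] simp: case_prod_beta)
  note p = mecke_nonneg[OF fin m1(1,3) b(1,2)] mecke_nonneg[OF fin m1(2,4) b(3,4)]
  show ?thesis
    unfolding eq sum_subtractf by (simp add: p int)
qed

end

text \<open>
  Thinning: a mark \<open>z\<close> uniform on \<open>[0, \<Lambda> + K]\<close> means an arrival if it lies in \<open>[0, l t)\<close>, a departure if it
  lies in \<open>[\<Lambda>, \<Lambda> + U t i)\<close>, and no change otherwise. The two intervals are disjoint as long as \<open>l t \<le> \<Lambda>\<close>.
\<close>
definition unif_move :: "nat \<Rightarrow> real \<Rightarrow> (real \<Rightarrow> real) \<Rightarrow> (real \<Rightarrow> nat \<Rightarrow> nat) \<Rightarrow> real \<Rightarrow> real \<Rightarrow> nat \<Rightarrow> nat" where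
  "unif_move N \<Lambda> l U t z i =
     (if 0 \<le> z \<and> z < l t then (if i < N then i + 1 else i)
      else if \<Lambda> \<le> z \<and> z < \<Lambda> + real (U t i) then i - 1 else i)"

lemma integral_density_indicator:
  fixes f :: "'a \<Rightarrow> real"
  assumes "A \<in> sets M" "f \<in> borel_measurable M"
  shows "(\<integral>x. f x \<partial>density M (indicator A)) = (\<integral>x. indicator A x * f x \<partial>M)"
proof -
  have "density M (indicator A) = density M (\<lambda>x. ennreal (indicator A x))"
    by (simp add: ennreal_indicator)
  thus ?thesis using assms by (simp add: integral_density)
qed

text \<open>
  Integrating out the mark produces the generator under the feedback action \<open>U t i\<close>.
\<close>
lemma unif_move_integral:
  fixes f :: "nat \<Rightarrow> real"
  assumes "0 \<le> l t" "l t \<le> \<Lambda>" "U t i \<le> K"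
  shows "(\<integral>z. f (unif_move N \<Lambda> l U t z i) - f i \<partial>density lborel (indicator {0..\<Lambda> + real K}))
    = (if i < N then l t * (f (i + 1) - f i) else 0) + real (U t i) * (f (i - 1) - f i)"
proof -
  let ?a = "if i < N then f (i + 1) - f i else 0" and ?b = "f (i - 1) - f i"
  have e: "indicator {0..\<Lambda> + real K} z * (f (unif_move N \<Lambda> l U t z i) - f i)
     = indicator {0..<l t} z * ?a + indicator {\<Lambda>..<\<Lambda> + real (U t i)} z * ?b" for z
    using assms by (auto simp: unif_move_def indicator_def)
  have m: "(\<lambda>z. f (unif_move N \<Lambda> l U t z i) - f i) \<in> borel_measurable lborel"
    unfolding unif_move_def by measurable
  have "(\<integral>z. f (unif_move N \<Lambda> l U t z i) - f i \<partial>density lborel (indicator {0..\<Lambda> + real K}))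
     = (\<integral>z. indicator {0..\<Lambda> + real K} z * (f (unif_move N \<Lambda> l U t z i) - f i) \<partial>lborel)"
    using m by (intro integral_density_indicator) auto
  also have "\<dots> = l t * ?a + real (U t i) * ?b"
    unfolding e using assms by (subst Bochner_Integration.integral_add) auto
  finally show ?thesis by simp
qed


text \<open>
  The events that are determined by \<open>h\<close>. With \<open>h\<close> the part of the configuration up to time \<open>r\<close> they form
  the history up to \<open>r\<close>, and invariance under later points is immediate.
\<close>
definition past_events :: "'w measure \<Rightarrow> ('w \<Rightarrow> 'h) \<Rightarrow> 'w set set" where
  "past_events P h = {A \<in> sets P. \<exists>A'. A = {\<omega> \<in> space P. h \<omega> \<in> A'}}"

lemma sigma_algebra_past_events: "sigma_algebra (space P) (past_events P h)"
  unfolding sigma_algebra_iff2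
proof (intro conjI ballI allI impI)
  show "past_events P h \<subseteq> Pow (space P)" by (auto simp: past_events_def)
  have "{} = {\<omega> \<in> space P. h \<omega> \<in> {}}" by simp
  thus "{} \<in> past_events P h" unfolding past_events_def by blast
  fix s assume "s \<in> past_events P h"
  then obtain A' where s: "s \<in> sets P" "s = {\<omega> \<in> space P. h \<omega> \<in> A'}" by (auto simp: past_events_def)
  hence "space P - s = {\<omega> \<in> space P. h \<omega> \<in> - A'}" by auto
  thus "space P - s \<in> past_events P h" using s(1) unfolding past_events_def by blast
next
  fix A :: "nat \<Rightarrow> 'a set" assume A: "range A \<subseteq> past_events P h"
  hence "\<forall>n. \<exists>A'. A n = {\<omega> \<in> space P. h \<omega> \<in> A'}" by (auto simp: past_events_def)
  then obtain A' where "\<And>n. A n = {\<omega> \<in> space P. h \<omega> \<in> A' n}" by metis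
  hence "(\<Union>i. A i) = {\<omega> \<in> space P. h \<omega> \<in> (\<Union>n. A' n)}" by auto
  moreover have "(\<Union>i. A i) \<in> sets P" using A by (auto simp: past_events_def)
  ultimately show "(\<Union>i. A i) \<in> past_events P h" unfolding past_events_def by blast
qed

lemma sets_past_events: "sets (sigma (space P) (past_events P h)) = past_events P h"
proof -
  have "past_events P h \<subseteq> Pow (space P)" using sets.sets_into_space by (auto simp: past_events_def)
  thus ?thesis
    by (simp add: sets_measure_of sigma_algebra.sigma_sets_eq[OF sigma_algebra_past_events])
qed

lemma measurable_past_events:
  assumes X: "X \<in> measurable P (count_space UNIV)" and h: "\<And>\<omega>. \<omega> \<in> space P \<Longrightarrow> X \<omega> = g (h \<omega>)"
  shows "X \<in> measurable (sigma (space P) (past_events P h)) (count_space UNIV)"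
proof (rule measurableI)
  fix A :: "'b set"
  have "X -` A \<inter> space P = {\<omega> \<in> space P. h \<omega> \<in> g -` A}" using h by auto
  moreover have "X -` A \<inter> space P \<in> sets P" using X by (rule measurable_sets) simp
  ultimately have "X -` A \<inter> space P \<in> past_events P h" unfolding past_events_def by blast
  moreover have "space (sigma (space P) (past_events P h)) = space P"
    by (rule space_measure_of) (auto simp: past_events_def dest: sets.sets_into_space)
  ultimately show "X -` A \<inter> space (sigma (space P) (past_events P h)) \<in> sets (sigma (space P) (past_events P h))"
    by (simp add: sets_past_events)
qed simp

text \<open>
  The increment of \<open>f (I s)\<close> on \<open>A\<close> is a sum over points \<open>y\<close> with time in \<open>(r, s]\<close> of terms that depend only
  on \<open>y\<close>, on \<open>A\<close> and on the state just before \<open>y\<close>. After the Mecke formula the point \<open>y\<close> is inserted into an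
  independent configuration; neither \<open>A\<close> nor the state just before \<open>y\<close> notices the insertion. What
  remains is an integral over time and mark, whose mark integral is the generator.
\<close>
lemma feedback_martingale:
  fixes P :: "'w measure" and T \<Lambda> :: real and K :: nat
  defines "mu \<equiv> density lborel (indicator {0..T}) \<Otimes>\<^sub>M density lborel (indicator {0..\<Lambda> + real K}) :: (real \<times> real) measure"
  assumes cfg: "poisson_configuration P mu cnt pts"
  assumes l: "l \<in> borel_measurable borel" "\<And>t. 0 \<le> l t" "\<And>t. l t \<le> \<Lambda>" "\<And>t. t \<in> {0..T} \<Longrightarrow> l t = lam t"
    and U: "\<And>i. (\<lambda>t. U t i) \<in> measurable borel (count_space UNIV)" "\<And>t i. U t i \<le> min i K"
    and i0: "i0 \<le> N"
  defines "I \<equiv> \<lambda>t \<omega>. trajectory (unif_move N \<Lambda> l U) i0 (config (cnt \<omega>) (pts \<omega>)) {..t}"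
  assumes rs: "0 \<le> r" "r \<le> s" "s \<le> T"
    and A: "A \<in> past_events P (\<lambda>\<omega>. {#x \<in># config (cnt \<omega>) (pts \<omega>). fst x \<le> r#})"
  shows "(LINT \<omega>:A|P. f (I s \<omega>) - f (I r \<omega>)
           - (LINT v:{r..s}|lborel. generator N lam v (U v (I v \<omega>)) f (I v \<omega>))) = 0"
proof -
  interpret poisson_configuration P mu cnt pts by fact
  define m1 where "m1 = density lborel (indicator {0..T} :: real \<Rightarrow> ennreal)"
  define m2 where "m2 = density lborel (indicator {0..\<Lambda> + real K} :: real \<Rightarrow> ennreal)"
  have mu: "mu = m1 \<Otimes>\<^sub>M m2" by (simp add: mu_def m1_def m2_def)
  have sm[measurable_cong]: "sets m1 = sets borel" "sets m2 = sets borel" by (simp_all add: m1_def m2_def)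
  have sp[simp]: "space m1 = UNIV" "space m2 = UNIV" by (simp_all add: m1_def m2_def)
  interpret m1: finite_measure m1
    by (rule finite_measureI) (simp add: m1_def emeasure_density emeasure_lborel_Icc_eq)
  interpret m2: finite_measure m2
    by (rule finite_measureI) (simp add: m2_def emeasure_density emeasure_lborel_Icc_eq)
  have fin: "finite_measure mu" unfolding mu by (rule finite_measure_pair_measure) unfold_locales
  then interpret mu: finite_measure mu .
  have smu[measurable_cong]: "sets mu = sets borel"
    unfolding mu by (simp add: borel_prod[symmetric] sm cong: sets_pair_measure_cong)
  have spmu[simp]: "space mu = UNIV" unfolding mu by (simp add: space_pair_measure)
  interpret mP: pair_sigma_finite mu P ..
  interpret mm: pair_sigma_finite m1 m2 ..
  let ?mv = "unif_move N \<Lambda> l U"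
  note l(1)[measurable] U(1)[measurable]
  have pts_b[measurable]: "(\<lambda>\<omega>. pts \<omega> k) \<in> measurable P borel" for k
    using measurable_pts[of k] measurable_cong_sets[OF refl smu] by blast
  have [measurable]: "(\<lambda>\<omega>. fst (pts \<omega> k)) \<in> borel_measurable P" for k
    by (rule measurable_compose[OF pts_b]) (intro borel_measurable_continuous_onI continuous_intros)
  have fst_b[measurable]: "fst \<in> measurable borel (borel :: real measure)" "snd \<in> measurable borel (borel :: real measure)"
    by (auto intro!: borel_measurable_continuous_onI continuous_intros)
  have mv[measurable]: "(\<lambda>y. ?mv (fst y) (snd y) i) \<in> measurable borel (count_space UNIV)" for i
    unfolding unif_move_def by measurable
  have mv_le: "i \<le> N \<Longrightarrow> ?mv t z i \<le> N" for t z i by (auto simp: unif_move_def)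
  \<comment> \<open>\<open>J\<close> is the state just before \<open>t\<close>; it agrees with \<open>I\<close> off the finitely many jump times.\<close>
  define J where "J t \<omega> = trajectory ?mv i0 (conf \<omega>) {..<t}" for t \<omega>
  have J_le: "J t \<omega> \<le> N" for t \<omega> unfolding J_def by (rule trajectory_invariant) (auto intro: i0 mv_le)
  have I_le: "I t \<omega> \<le> N" for t \<omega> unfolding I_def by (rule trajectory_invariant) (auto intro: i0 mv_le)
  have J_meas[measurable]: "(\<lambda>z. J (fst z) (snd z)) \<in> measurable (borel \<Otimes>\<^sub>M P) (count_space UNIV)"
    unfolding J_def
    by (rule measurable_trajectory_config[OF _ _ _ mv]; (unfold lessThan_iff)?; measurable)
  have I_meas[measurable]: "I t \<in> measurable P (count_space UNIV)" for t
    unfolding I_def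
    by (rule measurable_trajectory_config[OF _ _ _ mv]; (unfold atMost_iff)?; measurable)
  have sA[measurable]: "A \<in> sets P" using A by (simp add: past_events_def)
  obtain A' where A': "A = {\<omega> \<in> space P. {#x \<in># conf \<omega>. fst x \<le> r#} \<in> A'}"
    using A by (auto simp: past_events_def)
  define g where "g t z i = f (?mv t z i) - f i" for t z i
  define B where "B = 2 * (\<Sum>i\<le>N. \<bar>f i\<bar>)"
  have f_le: "\<bar>f i\<bar> \<le> (\<Sum>i\<le>N. \<bar>f i\<bar>)" if "i \<le> N" for i
    using that by (intro member_le_sum) auto
  have B0: "0 \<le> B" by (simp add: B_def sum_nonneg)
  have g_le: "\<bar>g t z i\<bar> \<le> B" if "i \<le> N" for t z i
    unfolding g_def B_def using f_le[OF mv_le[OF that, of t z]] f_le[OF that] by linarith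
  define H where "H y \<eta> = (if {#x \<in># \<eta>. fst x \<le> r#} \<in> A' \<and> fst y \<in> solo \<eta> \<and> fst y \<in> {r<..s}
     then g (fst y) (snd y) (trajectory ?mv i0 \<eta> {..<fst y}) else 0)" for y \<eta>
  have H_le: "\<bar>H y \<eta>\<bar> \<le> B" for y \<eta>
    unfolding H_def using g_le[OF trajectory_invariant[of "\<lambda>i. i \<le> N"], OF i0 mv_le] B0 by auto
  have g_meas[measurable]: "(\<lambda>y. g (fst y) (snd y) i) \<in> borel_measurable borel" for i
    unfolding g_def by measurable
  have gJ_meas[measurable]: "(\<lambda>z. g (fst (fst z)) (snd (fst z)) (J (fst (fst z)) (snd z))) \<in> borel_measurable (mu \<Otimes>\<^sub>M P)"
  proof (rule measurable_compose_countable[where f="\<lambda>i z. g (fst (fst z)) (snd (fst z)) i"])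
    show "(\<lambda>z. g (fst (fst z)) (snd (fst z)) i) \<in> borel_measurable (mu \<Otimes>\<^sub>M P)" for i
      by (rule measurable_compose[OF _ g_meas[of i], where f=fst]) measurable
    show "(\<lambda>z. J (fst (fst z)) (snd z)) \<in> measurable (mu \<Otimes>\<^sub>M P) (count_space UNIV)"
      by (rule measurable_compose[OF _ J_meas, where f="\<lambda>z. (fst (fst z), snd z)", simplified]) measurable
  qed
  have A'_iff: "{#x \<in># conf \<omega>. fst x \<le> r#} \<in> A' \<longleftrightarrow> \<omega> \<in> A" if "\<omega> \<in> space P" for \<omega>
    using that by (simp add: A')
  \<comment> \<open>An inserted point is effective exactly if its time is not yet occupied.\<close>
  define fresh where "fresh y \<omega> \<longleftrightarrow> (\<forall>k<cnt \<omega>. fst (pts \<omega> k) \<noteq> fst y)" for y :: "real \<times> real" and \<omega>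
  have H_add: "H y (add_mset y (conf \<omega>)) =
     (if \<omega> \<in> A \<and> fresh y \<omega> \<and> fst y \<in> {r<..s} then g (fst y) (snd y) (J (fst y) \<omega>) else 0)"
    if w: "\<omega> \<in> space P" for y \<omega>
  proof (cases "fst y \<in> {r<..s}")
    case True
    have 1: "{#x \<in># add_mset y (conf \<omega>). fst x \<le> r#} = {#x \<in># conf \<omega>. fst x \<le> r#}" using True by simp
    have "{#x \<in># conf \<omega>. fst x = fst y#} = {#} \<longleftrightarrow> fresh y \<omega>"
      unfolding fresh_def set_mset_eq_empty_iff[symmetric] set_mset_filter set_config by blast
    hence 2: "fst y \<in> solo (add_mset y (conf \<omega>)) \<longleftrightarrow> fresh y \<omega>" by (simp add: solo_def)
    have 3: "trajectory ?mv i0 (add_mset y (conf \<omega>)) {..<fst y} = J (fst y) \<omega>"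
      unfolding J_def by (rule trajectory_restrict) simp
    show ?thesis unfolding H_def 1 2 3 A'_iff[OF w] by simp
  qed (simp add: H_def)
  have [measurable]: "Measurable.pred (mu \<Otimes>\<^sub>M P) (\<lambda>z. fresh (fst z) (snd z))"
    unfolding fresh_def by measurable
  have m1H: "(\<lambda>(y, \<omega>). H y (config (cnt \<omega>) (pts \<omega>))) \<in> borel_measurable (mu \<Otimes>\<^sub>M P)"
  proof -
    have s: "fst y \<in> solo (config (cnt \<omega>) (pts \<omega>)) \<longleftrightarrow>
        (\<exists>k<cnt \<omega>. fst (pts \<omega> k) = fst y \<and> (\<forall>j<cnt \<omega>. fst (pts \<omega> j) = fst y \<longrightarrow> j = k))" for y :: "real \<times> real" and \<omega>
      by (auto simp: solo_config_iff)
    have [measurable]: "Measurable.pred (mu \<Otimes>\<^sub>M P) (\<lambda>z. fst (fst z) \<in> solo (conf (snd z)))"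
      unfolding s by measurable
    have "(\<lambda>z. if snd z \<in> A \<and> fst (fst z) \<in> solo (conf (snd z)) \<and> fst (fst z) \<in> {r<..s} then g (fst (fst z)) (snd (fst z)) (J (fst (fst z)) (snd z)) else 0)
      \<in> borel_measurable (mu \<Otimes>\<^sub>M P)" by measurable
    also have "?this \<longleftrightarrow> ?thesis"
      by (intro measurable_cong) (auto simp: H_def A'_iff J_def space_pair_measure)
    finally show ?thesis .
  qed
  have m2H: "(\<lambda>z. if snd z \<in> A \<and> fresh (fst z) (snd z) \<and> fst (fst z) \<in> {r<..s} then g (fst (fst z)) (snd (fst z)) (J (fst (fst z)) (snd z)) else 0)
      \<in> borel_measurable (mu \<Otimes>\<^sub>M P)" by measurable
  have m2H': "(\<lambda>(y, \<omega>). H y (add_mset y (config (cnt \<omega>) (pts \<omega>)))) \<in> borel_measurable (mu \<Otimes>\<^sub>M P)"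
    using m2H by (subst measurable_cong[where g="\<lambda>z. if snd z \<in> A \<and> fresh (fst z) (snd z) \<and> fst (fst z) \<in> {r<..s} then g (fst (fst z)) (snd (fst z)) (J (fst (fst z)) (snd z)) else 0"])
      (auto simp: space_pair_measure H_add)
  have inc: "indicator A \<omega> * (f (I s \<omega>) - f (I r \<omega>)) = (\<Sum>k<cnt \<omega>. H (pts \<omega> k) (config (cnt \<omega>) (pts \<omega>)))"
    if w: "\<omega> \<in> space P" for \<omega>
  proof (cases "\<omega> \<in> A")
    case True
    have "f (I s \<omega>) - f (I r \<omega>) = (\<Sum>t\<in>solo (conf \<omega>) \<inter> {r<..s}. g t (mark (conf \<omega>) t) (J t \<omega>))"
      unfolding I_def J_def g_def by (rule trajectory_increment[OF rs(2)])
    also have "\<dots> = (\<Sum>k<cnt \<omega>. H (pts \<omega> k) (conf \<omega>))"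
      by (subst sum_solo_config[symmetric, where g="\<lambda>y. g (fst y) (snd y) (J (fst y) \<omega>)", simplified])
        (auto intro!: sum.cong simp: H_def A'_iff[OF w] True J_def)
    finally show ?thesis using True by simp
  next
    case False
    thus ?thesis by (simp add: H_def A'_iff[OF w])
  qed
  define D where "D z = (if snd z \<in> A \<and> fresh (fst z) (snd z) \<and> fst (fst z) \<in> {r<..s} then g (fst (fst z)) (snd (fst z)) (J (fst (fst z)) (snd z)) else 0)" for z
  have D_meas[measurable]: "D \<in> borel_measurable (mu \<Otimes>\<^sub>M P)" using m2H by (simp add: D_def[abs_def])
  have D_le: "\<bar>D z\<bar> \<le> B" for z using g_le[OF J_le] B0 by (simp add: D_def)
  have fin2: "finite_measure (mu \<Otimes>\<^sub>M P)" by (rule finite_measure_pair_measure) unfold_locales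
  have D_int: "integrable (mu \<Otimes>\<^sub>M P) D"
    using D_le by (intro finite_measure.integrable_const_bound[OF fin2, of _ B]) auto
  have gen: "(\<integral>y. D (y, \<omega>) \<partial>mu) = indicator A \<omega> * (LINT v:{r..s}|lborel. generator N lam v (U v (I v \<omega>)) f (I v \<omega>))"
    if w: "\<omega> \<in> space P" for \<omega>
  proof (cases "\<omega> \<in> A")
    case True
    have Dw_meas: "(\<lambda>y. D (y, \<omega>)) \<in> borel_measurable mu" using w by measurable
    have "(\<integral>y. D (y, \<omega>) \<partial>mu) = (\<integral>t. \<integral>z. D ((t, z), \<omega>) \<partial>m2 \<partial>m1)"
    proof -
      have "AE y in mu. norm (D (y, \<omega>)) \<le> B" unfolding real_norm_def by (intro AE_I2 D_le)
      from mu.integrable_const_bound[OF this Dw_meas]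
      have "integrable (m1 \<Otimes>\<^sub>M m2) (\<lambda>y. D (y, \<omega>))" unfolding mu .
      from mm.integral_fst'[OF this] show ?thesis unfolding mu by (rule sym)
    qed
    also have "\<dots> = (\<integral>t. indicator {0..T} t * (\<integral>z. D ((t, z), \<omega>) \<partial>m2) \<partial>lborel)"
    proof -
      have "(\<lambda>t. \<integral>z. D ((t, z), \<omega>) \<partial>m2) \<in> borel_measurable m1"
        by (rule m2.borel_measurable_lebesgue_integral) (use Dw_meas in \<open>simp add: mu case_prod_beta\<close>)
      hence "(\<lambda>t. \<integral>z. D ((t, z), \<omega>) \<partial>m2) \<in> borel_measurable lborel" by (simp add: m1_def)
      thus ?thesis unfolding m1_def
        by (intro integral_density_indicator) auto
    qed
    also have "\<dots> = (\<integral>v. indicator {r..s} v *\<^sub>R generator N lam v (U v (I v \<omega>)) f (I v \<omega>) \<partial>lborel)"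
    proof (rule integral_cong_AE)
      have "finite (insert r ((\<lambda>k. fst (pts \<omega> k)) ` {..<cnt \<omega>} \<union> solo (conf \<omega>)))" using finite_solo by blast
      hence "AE t in lborel. t \<notin> insert r ((\<lambda>k. fst (pts \<omega> k)) ` {..<cnt \<omega>} \<union> solo (conf \<omega>))"
        by (intro AE_not_in finite_imp_null_set_lborel)
      thus "AE t in lborel. indicator {0..T} t * (\<integral>z. D ((t, z), \<omega>) \<partial>m2) = indicator {r..s} t *\<^sub>R generator N lam t (U t (I t \<omega>)) f (I t \<omega>)"
      proof eventually_elim
        case (elim t)
        have IJ: "I t \<omega> = J t \<omega>" unfolding I_def J_def
          using elim by (intro trajectory_cong_set) (auto simp: less_le)
        show ?case
        proof (cases "t \<in> {r..s}")
          case t: True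
          hence t2: "t \<in> {r<..s}" "t \<in> {0..T}" using elim rs by auto
          have "fresh (t, z) \<omega>" for z using elim by (auto simp: fresh_def)
          hence "(\<integral>z. D ((t, z), \<omega>) \<partial>m2) = (\<integral>z. f (?mv t z (J t \<omega>)) - f (J t \<omega>) \<partial>m2)"
            using True t2 by (simp add: D_def g_def)
          also have "\<dots> = generator N lam t (U t (I t \<omega>)) f (I t \<omega>)"
          proof -
            have u: "U t (J t \<omega>) \<le> K" "U t (J t \<omega>) \<le> J t \<omega>" using U(2)[of t "J t \<omega>"] by auto
            show ?thesis
              unfolding m2_def IJ unif_move_integral[of l t \<Lambda> U "J t \<omega>" K, OF l(2,3) u(1)] generator_eq[OF J_le u(2)]
              using l(4)[OF t2(2)] by simp
          qed
          finally show ?thesis using t t2 by simp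
        next
          case False
          hence "t \<notin> {r<..s}" by auto
          hence "D ((t, z), \<omega>) = 0" for z by (simp only: D_def fst_conv simp_thms if_False)
          thus ?thesis using False by simp
        qed
      qed
    next
      have "(\<lambda>t. \<integral>z. D ((t, z), \<omega>) \<partial>m2) \<in> borel_measurable m1"
        by (rule m2.borel_measurable_lebesgue_integral) (use Dw_meas in \<open>simp add: mu case_prod_beta\<close>)
      hence "(\<lambda>t. \<integral>z. D ((t, z), \<omega>) \<partial>m2) \<in> borel_measurable lborel" by (simp add: m1_def)
      thus "(\<lambda>t. indicator {0..T} t * (\<integral>z. D ((t, z), \<omega>) \<partial>m2)) \<in> borel_measurable lborel" by measurable
    next
      have I2[measurable]: "(\<lambda>t. I t \<omega>) \<in> measurable borel (count_space UNIV)"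
        unfolding I_def
        by (rule measurable_trajectory_config[OF _ _ _ mv]; (unfold atMost_iff)?; use w in measurable)
      have UI[measurable]: "(\<lambda>t. U t (I t \<omega>)) \<in> measurable borel (count_space UNIV)"
        by (rule measurable_compose_countable[OF U(1) I2])
      have "(\<lambda>v. indicator {r..s} v *\<^sub>R ((if I v \<omega> < N then l v * (f (I v \<omega> + 1) - f (I v \<omega>)) else 0) + real (U v (I v \<omega>)) * (f (I v \<omega> - 1) - f (I v \<omega>)))) \<in> borel_measurable lborel"
        by measurable
      also have "(\<lambda>v. indicator {r..s} v *\<^sub>R ((if I v \<omega> < N then l v * (f (I v \<omega> + 1) - f (I v \<omega>)) else 0) + real (U v (I v \<omega>)) * (f (I v \<omega> - 1) - f (I v \<omega>))))
         = (\<lambda>v. indicator {r..s} v *\<^sub>R generator N lam v (U v (I v \<omega>)) f (I v \<omega>))"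
      proof
        fix v
        have "U v (I v \<omega>) \<le> I v \<omega>" using U(2)[of v "I v \<omega>"] by simp
        thus "indicator {r..s} v *\<^sub>R ((if I v \<omega> < N then l v * (f (I v \<omega> + 1) - f (I v \<omega>)) else 0) + real (U v (I v \<omega>)) * (f (I v \<omega> - 1) - f (I v \<omega>)))
          = indicator {r..s} v *\<^sub>R generator N lam v (U v (I v \<omega>)) f (I v \<omega>)"
          using l(4)[of v] rs by (subst generator_eq[OF I_le]) (auto simp: indicator_def)
      qed
      finally show "(\<lambda>v. indicator {r..s} v *\<^sub>R generator N lam v (U v (I v \<omega>)) f (I v \<omega>)) \<in> borel_measurable lborel" .
    qed
    finally show ?thesis using True by (simp add: set_lebesgue_integral_def)
  next
    case False thus ?thesis by (simp add: D_def)
  qed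
  have f_diff: "\<bar>f (I s \<omega>) - f (I r \<omega>)\<bar> \<le> B" for \<omega>
    using f_le[OF I_le[of s \<omega>]] f_le[OF I_le[of r \<omega>]] unfolding B_def by linarith
  have f_int: "integrable P (\<lambda>\<omega>. indicator A \<omega> * (f (I s \<omega>) - f (I r \<omega>)))"
    by (intro integrable_const_bound[of _ B]) (auto simp: indicator_def f_diff B0)
  have D_int2: "integrable P (\<lambda>\<omega>. \<integral>y. D (y, \<omega>) \<partial>mu)"
    using mP.integrable_snd[of "\<lambda>y \<omega>. D (y, \<omega>)"] D_int by simp
  have "(\<integral>\<omega>. indicator A \<omega> * (f (I s \<omega>) - f (I r \<omega>)) \<partial>P)
     = (\<integral>\<omega>. (\<Sum>k<cnt \<omega>. H (pts \<omega> k) (config (cnt \<omega>) (pts \<omega>))) \<partial>P)"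
    by (intro Bochner_Integration.integral_cong refl inc)
  also have "\<dots> = (\<integral>z. H (fst z) (add_mset (fst z) (config (cnt (snd z)) (pts (snd z)))) \<partial>(mu \<Otimes>\<^sub>M P))"
    by (rule mecke_bounded[OF fin m1H m2H' H_le])
  also have "\<dots> = (\<integral>z. D z \<partial>(mu \<Otimes>\<^sub>M P))"
    by (intro Bochner_Integration.integral_cong refl)
      (auto simp: D_def space_pair_measure H_add)
  also have "\<dots> = (\<integral>\<omega>. \<integral>y. D (y, \<omega>) \<partial>mu \<partial>P)"
    using mP.integral_snd[of "\<lambda>y \<omega>. D (y, \<omega>)"] D_int by simp
  finally have main: "(\<integral>\<omega>. indicator A \<omega> * (f (I s \<omega>) - f (I r \<omega>)) \<partial>P) = (\<integral>\<omega>. \<integral>y. D (y, \<omega>) \<partial>mu \<partial>P)" .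
  have "(LINT \<omega>:A|P. f (I s \<omega>) - f (I r \<omega>)
           - (LINT v:{r..s}|lborel. generator N lam v (U v (I v \<omega>)) f (I v \<omega>)))
     = (\<integral>\<omega>. indicator A \<omega> * (f (I s \<omega>) - f (I r \<omega>)) - (\<integral>y. D (y, \<omega>) \<partial>mu) \<partial>P)"
    unfolding set_lebesgue_integral_def[where M=P]
    by (intro Bochner_Integration.integral_cong refl) (simp add: gen right_diff_distrib)
  also have "\<dots> = 0" using f_int D_int2 main by simp
  finally show ?thesis .
qed

text \<open>
  The state process of \<open>feedback_martingale\<close> on the rectangle \<open>[0, T] \<times> [0, \<Lambda> + K]\<close>. On the event that there
  is no point at all it stays at \<open>i0\<close>, hence the positive probabilities.
\<close>
lemma feedback_process_exists:
  fixes T \<Lambda> :: real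
  assumes T: "0 < T" and \<Lambda>: "0 < \<Lambda>"
    and l: "l \<in> borel_measurable borel" "\<And>t. 0 \<le> l t" "\<And>t. l t \<le> \<Lambda>" "\<And>t. t \<in> {0..T} \<Longrightarrow> l t = lam t"
    and U: "\<And>i. (\<lambda>t. U t i) \<in> measurable borel (count_space UNIV)" "\<And>t i. U t i \<le> min i K"
    and i0: "i0 \<le> N"
  shows "\<exists>(P :: (nat \<Rightarrow> real) measure) F I. admissible N K T lam P F I (\<lambda>s \<omega>. U s (I s \<omega>))
           \<and> (\<forall>t. 0 < measure P {\<omega> \<in> space P. I t \<omega> = i0})"
proof -
  define m1 where "m1 = density lborel (indicator {0..T} :: real \<Rightarrow> ennreal)"
  define m2 where "m2 = density lborel (indicator {0..\<Lambda> + real K} :: real \<Rightarrow> ennreal)"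
  have sm[measurable_cong]: "sets m1 = sets borel" "sets m2 = sets borel" by (simp_all add: m1_def m2_def)
  have e: "emeasure m1 (space m1) = ennreal T" "emeasure m2 (space m2) = ennreal (\<Lambda> + real K)"
    using T \<Lambda> by (simp_all add: m1_def m2_def emeasure_density emeasure_lborel_Icc_eq)
  interpret m1: finite_measure m1 by (rule finite_measureI) (simp add: e)
  interpret m2: finite_measure m2 by (rule finite_measureI) (simp add: e)
  let ?mu = "m1 \<Otimes>\<^sub>M m2"
  have "sets ?mu = sets borel"
    by (simp add: borel_prod[symmetric] sm cong: sets_pair_measure_cong)
  moreover have "emeasure ?mu (space ?mu) \<noteq> 0"
    unfolding space_pair_measure by (subst m2.emeasure_pair_measure_Times) (use T \<Lambda> in \<open>auto simp: e\<close>)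
  moreover have "finite_measure ?mu" by (rule finite_measure_pair_measure) unfold_locales
  ultimately obtain P :: "(nat \<Rightarrow> real) measure" and cnt pts where cfg: "poisson_configuration P ?mu cnt pts"
    using poisson_configuration_exists by blast
  interpret poisson_configuration P ?mu cnt pts by fact
  have smu[measurable_cong]: "sets ?mu = sets borel" by fact
  let ?mv = "unif_move N \<Lambda> l U"
  define h where "h r \<omega> = {#x \<in># conf \<omega>. fst x \<le> r#}" for r \<omega>
  define F where "F r = sigma (space P) (past_events P (h r))" for r
  define I where "I t \<omega> = trajectory ?mv i0 (conf \<omega>) {..t}" for t \<omega>
  note l(1)[measurable] U(1)[measurable]
  have sub: "past_events P (h r) \<subseteq> Pow (space P)" for r
    using sets.sets_into_space by (auto simp: past_events_def)
  have spF: "space (F r) = space P" for r unfolding F_def by (rule space_measure_of[OF sub])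
  have seF: "sets (F r) = past_events P (h r)" for r unfolding F_def by (rule sets_past_events)
  have pts_b[measurable]: "(\<lambda>\<omega>. pts \<omega> k) \<in> measurable P borel" for k
    using measurable_pts[of k] measurable_cong_sets[OF refl smu] by blast
  have [measurable]: "(\<lambda>\<omega>. fst (pts \<omega> k)) \<in> borel_measurable P" for k
    by (rule measurable_compose[OF pts_b]) (intro borel_measurable_continuous_onI continuous_intros)
  have fst_b[measurable]: "fst \<in> measurable borel (borel :: real measure)" "snd \<in> measurable borel (borel :: real measure)"
    by (auto intro!: borel_measurable_continuous_onI continuous_intros)
  have mv: "(\<lambda>y. ?mv (fst y) (snd y) i) \<in> measurable borel (count_space UNIV)" for i
    unfolding unif_move_def by measurable
  have I_P: "I t \<in> measurable P (count_space UNIV)" for t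
    unfolding I_def
    by (rule measurable_trajectory_config[OF _ _ _ mv]; (unfold atMost_iff)?; measurable)
  have I_F: "I t \<in> measurable (F t) (count_space UNIV)" for t
    unfolding F_def
  proof (rule measurable_past_events[OF I_P])
    show "I t \<omega> = trajectory ?mv i0 (h t \<omega>) {..t}" for \<omega>
      unfolding I_def h_def by (rule trajectory_restrict) (simp add: filter_filter_mset)
  qed
  have mono: "past_events P (h r) \<subseteq> past_events P (h s)" if "r \<le> s" for r s
  proof
    fix A assume A: "A \<in> past_events P (h r)"
    then obtain A' where A': "A = {\<omega> \<in> space P. h r \<omega> \<in> A'}" by (auto simp: past_events_def)
    have "h r \<omega> = {#x \<in># h s \<omega>. fst x \<le> r#}" for \<omega>
      using that by (auto simp: h_def filter_filter_mset intro!: filter_mset_cong)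
    hence "A = {\<omega> \<in> space P. h s \<omega> \<in> {\<eta>. {#x \<in># \<eta>. fst x \<le> r#} \<in> A'}}" using A' by auto
    thus "A \<in> past_events P (h s)" using A unfolding past_events_def by blast
  qed
  have sF: "sets (F r) \<subseteq> sets (F s)" if "r \<le> s" for r s using mono[OF that] by (simp add: seF)
  have I_le: "I t \<omega> \<le> N" for t \<omega>
    unfolding I_def by (rule trajectory_invariant) (use i0 in \<open>auto simp: unif_move_def\<close>)
  have "admissible N K T lam P F I (\<lambda>s \<omega>. U s (I s \<omega>))"
    unfolding admissible_def
  proof (intro conjI)
    show "prob_space P" by unfold_locales
    show "filtration (space P) F" by unfold_locales (auto simp: spF sF subset_iff dest: sF)
    show "\<forall>s. subalgebra P (F s)" by (auto simp: subalgebra_def spF seF past_events_def)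
    show "\<forall>s\<in>{0..T}. I s \<in> measurable (F s) (count_space UNIV)" using I_F by blast
    show "\<forall>s\<in>{0..T}. \<forall>\<omega>\<in>space P. I s \<omega> \<in> {0..N}" using I_le by simp
    show "\<forall>s\<in>{0..<T}. \<forall>\<omega>\<in>space P. \<forall>\<^sub>F r in at_right s. I r \<omega> = I s \<omega>"
      unfolding I_def by (intro ballI eventually_trajectory_right)
    show "\<forall>s\<in>{0<..T}. \<forall>\<omega>\<in>space P. \<exists>j. \<forall>\<^sub>F r in at_left s. I r \<omega> = j"
      unfolding I_def by (intro ballI exI) (rule eventually_trajectory_left)
    show "\<forall>s\<in>{0..T}. (\<lambda>(v, \<omega>). U v (I v \<omega>)) \<in> measurable (restrict_space borel {0..s} \<Otimes>\<^sub>M F s) (count_space UNIV)"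
    proof
      fix s assume s: "s \<in> {0..T}"
      let ?Z = "restrict_space borel {0..s} \<Otimes>\<^sub>M F s"
      have "(\<lambda>(v, \<omega>). I v \<omega>) \<in> measurable ?Z (count_space UNIV)"
      proof (rule right_continuous_jointly_measurable)
        fix v assume v: "v \<in> {0..s}"
        have "subalgebra (F s) (F v)" using v sF by (auto simp: subalgebra_def spF)
        thus "I v \<in> measurable (F s) (count_space UNIV)"
          using I_F[of v] by (rule measurable_from_subalg)
      next
        fix v \<omega> show "\<forall>\<^sub>F r in at_right v. I r \<omega> = I v \<omega>"
          unfolding I_def by (rule eventually_trajectory_right)
      qed (use s in auto)
      moreover have "(\<lambda>x. x) \<in> measurable (restrict_space borel {0..s}) (borel :: real measure)"
        by (rule measurable_restrict_space1) simp
      hence "(\<lambda>z. U (fst z) i) \<in> measurable ?Z (count_space UNIV)" for i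
        by (intro measurable_compose[OF measurable_compose[OF measurable_fst] U(1)])
      ultimately have "(\<lambda>z. U (fst z) (case z of (v, \<omega>) \<Rightarrow> I v \<omega>)) \<in> measurable ?Z (count_space UNIV)"
        by (rule measurable_compose_countable[rotated])
      thus "(\<lambda>(v, \<omega>). U v (I v \<omega>)) \<in> measurable ?Z (count_space UNIV)"
        by (simp add: case_prod_beta)
    qed
    show "\<forall>s\<in>{0..T}. \<forall>\<omega>\<in>space P. U s (I s \<omega>) \<in> feasible K (I s \<omega>)"
      using U(2) by (simp add: feasible_def)
    show "\<forall>f r s A. 0 \<le> r \<longrightarrow> r \<le> s \<longrightarrow> s \<le> T \<longrightarrow> A \<in> sets (F r) \<longrightarrow>
        (LINT \<omega>:A|P. f (I s \<omega>) - f (I r \<omega>)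
           - (LINT v:{r..s}|lborel. generator N lam v (U v (I v \<omega>)) f (I v \<omega>))) = 0"
    proof (intro allI impI)
      fix f :: "nat \<Rightarrow> real" and r s A
      assume "0 \<le> r" "r \<le> s" "s \<le> T" "A \<in> sets (F r)"
      thus "(LINT \<omega>:A|P. f (I s \<omega>) - f (I r \<omega>)
           - (LINT v:{r..s}|lborel. generator N lam v (U v (I v \<omega>)) f (I v \<omega>))) = 0"
        unfolding I_def seF
        by (intro feedback_martingale[OF cfg[unfolded m1_def m2_def]])
          (use l U i0 in \<open>auto simp: h_def[abs_def]\<close>)
    qed
  qed
  moreover have "0 < prob {\<omega> \<in> space P. I t \<omega> = i0}" for t
  proof -
    have "I t \<omega> = i0" if "cnt \<omega> = 0" for \<omega>
      using that by (simp add: I_def config_def trajectory_def solo_def)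
    hence "{\<omega> \<in> space P. cnt \<omega> = 0} \<subseteq> {\<omega> \<in> space P. I t \<omega> = i0}" by auto
    moreover have "{\<omega> \<in> space P. I t \<omega> = i0} \<in> sets P" using I_P[of t] by measurable
    ultimately show ?thesis using empty_pos finite_measure_mono by (meson less_le_trans)
  qed
  ultimately show ?thesis by blast
qed

section \<open>Dynkin formula for admissible processes\<close>

lemma abs_integral_bounded_le:
  fixes f :: "'a \<Rightarrow> real"
  assumes "finite_measure M" and C: "0 \<le> C" "\<And>x. x \<in> space M \<Longrightarrow> \<bar>f x\<bar> \<le> C"
  shows "\<bar>\<integral>x. f x \<partial>M\<bar> \<le> C * measure M (space M)"
proof (cases "integrable M f")
  case True
  interpret finite_measure M by fact
  have "\<bar>\<integral>x. f x \<partial>M\<bar> \<le> (\<integral>x. \<bar>f x\<bar> \<partial>M)" by (rule integral_abs_bound)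
  also have "\<dots> \<le> (\<integral>x. C \<partial>M)" using True C by (intro integral_mono) auto
  finally show ?thesis by (simp add: mult.commute)
next
  case False
  thus ?thesis using C(1) by (simp add: not_integrable_integral_eq)
qed

lemma Fubini_bounded:
  fixes f :: "'a \<Rightarrow> 'b \<Rightarrow> real"
  assumes "finite_measure M1" "finite_measure M2"
    and f: "(\<lambda>z. f (fst z) (snd z)) \<in> borel_measurable (M1 \<Otimes>\<^sub>M M2)"
    and C: "\<And>x y. x \<in> space M1 \<Longrightarrow> y \<in> space M2 \<Longrightarrow> \<bar>f x y\<bar> \<le> C"
  shows "(\<integral>x. \<integral>y. f x y \<partial>M2 \<partial>M1) = (\<integral>y. \<integral>x. f x y \<partial>M1 \<partial>M2)"
proof -
  interpret M1: finite_measure M1 by fact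
  interpret M2: finite_measure M2 by fact
  interpret pair_sigma_finite M1 M2 ..
  have "finite_measure (M1 \<Otimes>\<^sub>M M2)" by (rule finite_measure_pair_measure) fact+
  hence "integrable (M1 \<Otimes>\<^sub>M M2) (\<lambda>z. f (fst z) (snd z))"
    by (rule finite_measure.integrable_const_bound[where B=C]) (use f C in \<open>auto intro!: AE_I2 simp: space_pair_measure\<close>)
  hence "integrable (M1 \<Otimes>\<^sub>M M2) (case_prod f)" by (simp add: case_prod_beta')
  from Fubini_integral[OF this] show ?thesis by simp
qed

text \<open>
  A finite measure of its own, so that Fubini's theorem applies to bounded measurable integrands
  without further integrability proofs.
\<close>
definition time_measure :: "real \<Rightarrow> real \<Rightarrow> real measure" where
  "time_measure a b = restrict_space lborel {a..b}"

lemma space_time_measure: "space (time_measure a b) = {a..b}"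
  by (simp add: time_measure_def space_restrict_space)

lemma finite_time_measure: "finite_measure (time_measure a b)"
  by (rule finite_measureI)
    (simp add: time_measure_def emeasure_restrict_space space_restrict_space emeasure_lborel_Icc_eq)

lemma measurable_time_measure: "f \<in> measurable borel M \<Longrightarrow> f \<in> measurable (time_measure a b) M"
  unfolding time_measure_def by (rule measurable_restrict_space1) simp

lemma measurable_time_measure_ident: "(\<lambda>x. x) \<in> measurable (time_measure a b) borel"
  by (rule measurable_time_measure) simp

lemma integral_time_measure:
  fixes f :: "real \<Rightarrow> real"
  shows "(\<integral>x. f x \<partial>time_measure a b) = (LINT x:{a..b}|lborel. f x)"
  by (simp add: time_measure_def integral_restrict_space set_lebesgue_integral_def)

lemma admissible_jointly_measurable:
  assumes adm: "admissible N K T lam P F I u" and t: "0 \<le> t" "t \<le> T"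
  shows "(\<lambda>z. I (fst z) (snd z)) \<in> measurable (time_measure t T \<Otimes>\<^sub>M P) (count_space UNIV)"
    and "(\<lambda>z. u (fst z) (snd z)) \<in> measurable (time_measure t T \<Otimes>\<^sub>M P) (count_space UNIV)"
proof -
  let ?Z = "restrict_space borel {0..T} \<Otimes>\<^sub>M F T"
  have sub: "subalgebra P (F T)" and filt: "filtration (space P) F" using adm by (auto simp: admissible_def)
  interpret filtration "space P" F by (rule filt)
  have "(\<lambda>x. x) \<in> measurable P (F T)"
    using sub by (auto simp: measurable_def subalgebra_def sets.sets_into_space Int_absorb2)
  moreover have "(\<lambda>x. x) \<in> measurable (time_measure t T) (restrict_space borel {0..T})"
    unfolding time_measure_def using t by (intro measurable_restrict_space3) auto
  ultimately have id: "(\<lambda>z. (fst z, snd z)) \<in> measurable (time_measure t T \<Otimes>\<^sub>M P) ?Z"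
    by (intro measurable_Pair measurable_compose[OF measurable_fst] measurable_compose[OF measurable_snd])
  have u: "(\<lambda>(v, \<omega>). u v \<omega>) \<in> measurable ?Z (count_space UNIV)"
    using adm t by (auto simp: admissible_def)
  from measurable_compose[OF id this]
  show "(\<lambda>z. u (fst z) (snd z)) \<in> measurable (time_measure t T \<Otimes>\<^sub>M P) (count_space UNIV)"
    by simp
  have "(\<lambda>(v, \<omega>). I v \<omega>) \<in> measurable ?Z (count_space UNIV)"
  proof (rule right_continuous_jointly_measurable)
    fix v assume v: "v \<in> {0..T}"
    have "subalgebra (F T) (F v)" using v sets_F_mono[of v T] by (auto simp: subalgebra_def space_F)
    moreover have "I v \<in> measurable (F v) (count_space UNIV)" using adm v by (auto simp: admissible_def)
    ultimately show "I v \<in> measurable (F T) (count_space UNIV)" by (rule measurable_from_subalg)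
  next
    fix v \<omega> assume "v \<in> {0..<T}" "\<omega> \<in> space (F T)"
    thus "\<forall>\<^sub>F r in at_right v. I r \<omega> = I v \<omega>" using adm by (auto simp: admissible_def space_F)
  qed (use t in auto)
  from measurable_compose[OF id this]
  show "(\<lambda>z. I (fst z) (snd z)) \<in> measurable (time_measure t T \<Otimes>\<^sub>M P) (count_space UNIV)"
    by simp
qed

lemma integrable_time_section:
  fixes f :: "real \<Rightarrow> 'w \<Rightarrow> real"
  assumes P: "finite_measure P" and A: "A \<in> sets P"
    and f: "(\<lambda>z. f (fst z) (snd z)) \<in> borel_measurable (time_measure t T \<Otimes>\<^sub>M P)"
    and f_le: "\<forall>v\<in>{t..T}. \<forall>\<omega>\<in>space P. \<bar>f v \<omega>\<bar> \<le> D"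
  shows "\<omega> \<in> space P \<Longrightarrow> integrable (time_measure t T) (\<lambda>v. f v \<omega>)"
    and "integrable P (\<lambda>\<omega>. indicator A \<omega> * (\<integral>v. f v \<omega> \<partial>time_measure t T))"
proof -
  let ?B = "time_measure t T"
  interpret P: finite_measure P by fact
  interpret B: finite_measure ?B by (rule finite_time_measure)
  show "integrable ?B (\<lambda>v. f v \<omega>)" if w: "\<omega> \<in> space P"
  proof (rule B.integrable_const_bound[of _ D])
    show "AE v in ?B. norm (f v \<omega>) \<le> D" using f_le w by (intro AE_I2) (simp add: space_time_measure)
    have "(\<lambda>v. (v, \<omega>)) \<in> measurable ?B (?B \<Otimes>\<^sub>M P)" using w by simp
    from measurable_compose[OF this f] show "(\<lambda>v. f v \<omega>) \<in> borel_measurable ?B" by simp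
  qed
  show "integrable P (\<lambda>\<omega>. indicator A \<omega> * (\<integral>v. f v \<omega> \<partial>?B))"
  proof (rule P.integrable_const_bound[of _ "\<bar>D\<bar> * measure ?B (space ?B)"])
    have "\<bar>indicator A \<omega> * (\<integral>v. f v \<omega> \<partial>?B)\<bar> \<le> \<bar>\<integral>v. f v \<omega> \<partial>?B\<bar>" for \<omega>
      by (simp add: indicator_def)
    moreover have "\<bar>\<integral>v. f v \<omega> \<partial>?B\<bar> \<le> \<bar>D\<bar> * measure ?B (space ?B)" if "\<omega> \<in> space P" for \<omega>
    proof (rule abs_integral_bounded_le[OF finite_time_measure])
      fix v assume "v \<in> space ?B"
      hence "\<bar>f v \<omega>\<bar> \<le> D" using f_le that by (simp add: space_time_measure)
      thus "\<bar>f v \<omega>\<bar> \<le> \<bar>D\<bar>" by linarith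
    qed simp
    ultimately show "AE \<omega> in P. norm (indicator A \<omega> * (\<integral>v. f v \<omega> \<partial>?B)) \<le> \<bar>D\<bar> * measure ?B (space ?B)"
      unfolding real_norm_def by (intro AE_I2) (rule order_trans)
    have "(\<lambda>\<omega>. \<integral>v. f v \<omega> \<partial>?B) \<in> borel_measurable P"
      using measurable_compose[OF measurable_pair_swap' f]
      by (intro B.borel_measurable_lebesgue_integral) (simp add: case_prod_beta)
    thus "(\<lambda>\<omega>. indicator A \<omega> * (\<integral>v. f v \<omega> \<partial>?B)) \<in> borel_measurable P" using A by measurable
  qed
qed

text \<open>
  Reduces the martingale problem for time dependent functions to the one for indicators of states.
\<close>
lemma generator_linear:
  assumes "i \<le> N"
  shows "generator N lam v a w i = (\<Sum>j\<le>N. w j * generator N lam v a (indicator {j}) i)"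
proof -
  have w: "w k = (\<Sum>j\<le>N. w j * indicator {j} k)" if "k \<le> N" for k
    using that by (simp add: indicator_def if_distrib[of "\<lambda>x. _ * x"] cong: if_cong)
  have "w k - w i = (\<Sum>j\<le>N. w j * (indicator {j} k - indicator {j} i))" if "k \<in> {0..N}" for k
    using w[of k] w[OF assms] that by (simp add: right_diff_distrib sum_subtractf)
  hence "generator N lam v a w i = (\<Sum>k\<in>{0..N}. jump_rate N lam v a i k * (\<Sum>j\<le>N. w j * (indicator {j} k - indicator {j} i)))"
    unfolding generator_def by (intro sum.cong) simp_all
  also have "\<dots> = (\<Sum>j\<le>N. w j * generator N lam v a (indicator {j}) i)"
    unfolding generator_def sum_distrib_left by (subst sum.swap) (simp add: ac_simps)
  finally show ?thesis .
qed

lemma abs_generator_le: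
  assumes i: "i \<le> N" "a \<in> feasible K i" and lam: "0 \<le> lam v" "lam v \<le> \<Lambda>" and f: "\<And>j. j \<le> N \<Longrightarrow> \<bar>f j\<bar> \<le> C"
  shows "\<bar>generator N lam v a f i\<bar> \<le> (\<Lambda> + real K) * (2 * C)"
proof -
  have C: "0 \<le> C" using f[of 0] by simp
  have a: "a \<le> i" "a \<le> K" using i by (auto simp: feasible_def)
  have "\<bar>if i < N then lam v * (f (i + 1) - f i) else 0\<bar> \<le> \<Lambda> * (2 * C)"
    using f[of "i + 1"] f[of i] lam C i by (auto simp: abs_mult intro!: mult_mono)
  moreover have "\<bar>real a * (f (i - 1) - f i)\<bar> \<le> real K * (2 * C)"
  proof -
    have "i - 1 \<le> N" using i by simp
    thus ?thesis unfolding abs_mult using f[of "i - 1"] f[of i] i a by (intro mult_mono) auto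
  qed
  ultimately show ?thesis
    unfolding generator_eq[OF i(1) a(1)] by (simp add: distrib_right)
qed

lemma generator_jointly_measurable:
  assumes adm: "admissible N K T lam P F I u" and t: "0 \<le> t" "t \<le> T"
    and lam: "l \<in> borel_measurable borel" "\<And>v. v \<in> {0..T} \<Longrightarrow> l v = lam v"
    and f: "\<And>j. f j \<in> borel_measurable (time_measure t T)"
  shows "(\<lambda>z. generator N lam (fst z) (u (fst z) (snd z)) (\<lambda>j. f j (fst z)) (I (fst z) (snd z)))
    \<in> borel_measurable (time_measure t T \<Otimes>\<^sub>M P)" (is "?g \<in> borel_measurable ?Z")
proof -
  note [measurable] = admissible_jointly_measurable[OF adm t]
  have l': "l \<in> borel_measurable (time_measure t T)" by (rule measurable_time_measure[OF lam(1)])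
  have [measurable]: "(\<lambda>z. l (fst z)) \<in> borel_measurable ?Z" by (rule measurable_compose[OF measurable_fst l'])
  have fj: "(\<lambda>z. f j (fst z)) \<in> borel_measurable ?Z" for j by (rule measurable_compose[OF measurable_fst f])
  have fg: "(\<lambda>z. f (g z) (fst z)) \<in> borel_measurable ?Z" if "g \<in> measurable ?Z (count_space UNIV)" for g
    by (rule measurable_compose_countable[where f="\<lambda>j z. f j (fst z)" and g=g, OF fj that])
  have "(\<lambda>z. I (fst z) (snd z)) \<in> measurable ?Z (count_space UNIV)"
    "(\<lambda>z. I (fst z) (snd z) + 1) \<in> measurable ?Z (count_space UNIV)"
    "(\<lambda>z. I (fst z) (snd z) - 1) \<in> measurable ?Z (count_space UNIV)"
    by measurable
  note [measurable] = this[THEN fg]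
  have "(\<lambda>z. (if I (fst z) (snd z) < N then l (fst z) * (f (I (fst z) (snd z) + 1) (fst z) - f (I (fst z) (snd z)) (fst z)) else 0)
     + real (u (fst z) (snd z)) * (f (I (fst z) (snd z) - 1) (fst z) - f (I (fst z) (snd z)) (fst z))) \<in> borel_measurable ?Z"
    by measurable
  also have "?this \<longleftrightarrow> ?g \<in> borel_measurable ?Z"
  proof (rule measurable_cong)
    fix z assume "z \<in> space ?Z"
    hence z: "fst z \<in> {0..T}" "snd z \<in> space P" using t by (auto simp: space_pair_measure space_time_measure)
    hence "I (fst z) (snd z) \<le> N" "u (fst z) (snd z) \<le> I (fst z) (snd z)"
      using adm by (auto simp: admissible_def feasible_def)
    thus "(if I (fst z) (snd z) < N then l (fst z) * (f (I (fst z) (snd z) + 1) (fst z) - f (I (fst z) (snd z)) (fst z)) else 0)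
     + real (u (fst z) (snd z)) * (f (I (fst z) (snd z) - 1) (fst z) - f (I (fst z) (snd z)) (fst z)) = ?g z"
      using lam(2)[OF z(1)] by (simp add: generator_eq)
  qed
  finally show ?thesis .
qed

text \<open>
  Write \<open>w j v\<close> as the integral of \<open>H j\<close> over \<open>[v, T]\<close> and decompose the generator term into indicators of
  states. Exchanging the two time integrals leaves, for each \<open>j\<close> and each \<open>x\<close>, the integral over \<open>[t, x]\<close> of
  the generator of the indicator of \<open>j\<close>; by the martingale problem its expectation is that of
  \<open>1{I x = j} - 1{I t = j}\<close>. Summation over \<open>j\<close> gives \<open>H (I x) x - H (I t) x\<close>, and the second part
  integrates to \<open>w (I t) t\<close>. The exchange plays the role of an integration by parts, so \<open>w\<close> need not be
  differentiable in time.
\<close>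
lemma dynkin_formula:
  assumes adm: "admissible N K T lam P F I u" and t: "0 \<le> t" "t \<le> T"
    and A: "A \<in> sets (F t)"
    and lam: "l \<in> borel_measurable borel" "\<And>v. v \<in> {0..T} \<Longrightarrow> l v = lam v" "\<And>v. v \<in> {0..T} \<Longrightarrow> 0 \<le> lam v \<and> lam v \<le> \<Lambda>"
    and H: "\<And>j. H j \<in> borel_measurable borel" "\<And>j v. \<bar>H j v\<bar> \<le> C"
    and w: "\<And>j v. w j v = (LINT x:{v..T}|lborel. H j x)"
  shows "(LINT \<omega>:A|P. w (I t \<omega>) t) = (LINT \<omega>:A|P. LINT v:{t..T}|lborel.
     H (I v \<omega>) v - generator N lam v (u v \<omega>) (\<lambda>j. w j v) (I v \<omega>))"
proof -
  let ?B = "time_measure t T"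
  have prob: "prob_space P" and sub: "subalgebra P (F t)" using adm by (auto simp: admissible_def)
  interpret prob_space P by fact
  interpret B: finite_measure ?B by (rule finite_time_measure)
  have finB: "finite_measure ?B" and finP: "finite_measure P" by unfold_locales
  have spB: "space ?B = {t..T}" by (rule space_time_measure)
  have sA[measurable]: "A \<in> sets P" using A sub by (auto simp: subalgebra_def)
  have I_le: "I v \<omega> \<le> N" and u_f: "u v \<omega> \<in> feasible K (I v \<omega>)" if "v \<in> {t..T}" "\<omega> \<in> space P" for v \<omega>
    using adm that t by (auto simp: admissible_def)
  have ind[measurable]: "(indicator {j} :: nat \<Rightarrow> real) \<in> borel_measurable (count_space UNIV)" for j by simp
  note IU[measurable] = admissible_jointly_measurable[OF adm t]
  have C: "0 \<le> C" using H(2)[of 0 0] by linarith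
  have \<Lambda>: "0 \<le> \<Lambda>" using lam(3)[of t] t by auto
  have HB[measurable]: "H j \<in> borel_measurable ?B" for j
    by (rule measurable_time_measure[OF H(1)])
  have fstB[measurable]: "(\<lambda>z. fst z) \<in> borel_measurable (?B \<Otimes>\<^sub>M Z)" for Z :: "'z measure"
    by (rule measurable_compose[OF measurable_fst measurable_time_measure_ident])
  have sndB[measurable]: "(\<lambda>z. snd z) \<in> borel_measurable (Z \<Otimes>\<^sub>M ?B)" for Z :: "'z measure"
    by (rule measurable_compose[OF measurable_snd measurable_time_measure_ident])
  have w_B: "w j v = (\<integral>x. (if v \<le> x then H j x else 0) \<partial>?B)" if "v \<in> {t..T}" for j v
    unfolding integral_time_measure w set_lebesgue_integral_def using that
    by (intro Bochner_Integration.integral_cong) (auto simp: indicator_def)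
  have wB_meas[measurable]: "w j \<in> borel_measurable ?B" for j
  proof -
    have "(\<lambda>v. \<integral>x. (if v \<le> x then H j x else 0) \<partial>?B) \<in> borel_measurable ?B"
      by (rule B.borel_measurable_lebesgue_integral) measurable
    also have "?this \<longleftrightarrow> ?thesis" by (intro measurable_cong) (simp add: w_B spB)
    finally show ?thesis .
  qed
  define W where "W = C * measure ?B (space ?B)"
  have w_le: "\<bar>w j v\<bar> \<le> W" if "v \<in> {t..T}" for j v
    unfolding w_B[OF that] W_def using H(2) C by (intro abs_integral_bounded_le finB) auto
  define G where "G j v \<omega> = generator N lam v (u v \<omega>) (indicator {j}) (I v \<omega>)" for j v \<omega>
  define \<Gamma> where "\<Gamma> = (\<Lambda> + real K) * 2"
  have G_le: "\<bar>G j v \<omega>\<bar> \<le> \<Gamma>" if "v \<in> {t..T}" "\<omega> \<in> space P" for j v \<omega>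
    unfolding G_def \<Gamma>_def
    using abs_generator_le[OF I_le[OF that] u_f[OF that], of lam v \<Lambda> "indicator {j}" 1] lam(3)[of v] that t
    by (auto simp: indicator_def)
  have \<Gamma>: "0 \<le> \<Gamma>" using \<Lambda> by (simp add: \<Gamma>_def)
  have G_meas[measurable]: "(\<lambda>z. G j (fst z) (snd z)) \<in> borel_measurable (?B \<Otimes>\<^sub>M P)" for j
    unfolding G_def by (rule generator_jointly_measurable[OF adm t lam(1,2)]) auto
  have G_meas'[measurable]: "(\<lambda>z. G j (snd z) (fst z)) \<in> borel_measurable (P \<Otimes>\<^sub>M ?B)" for j
    using measurable_compose[OF measurable_pair_swap' G_meas[of j]] by (simp add: case_prod_beta)
  have I_meas': "(\<lambda>z. I (snd z) (fst z)) \<in> measurable (P \<Otimes>\<^sub>M ?B) (count_space UNIV)"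
    using measurable_compose[OF measurable_pair_swap' IU(1)] by (simp add: case_prod_beta)
  note I_meas'[measurable]
  let ?a = "indicator A :: _ \<Rightarrow> real"
  have a_le: "\<bar>?a \<omega> * x\<bar> \<le> \<bar>x\<bar>" for \<omega> x by (simp add: indicator_def)
  have I_meas: "I v \<in> measurable P (count_space UNIV)" if "v \<in> {t..T}" for v
    using measurable_compose[OF measurable_Pair1'[of v ?B P] IU(1)] that by (simp add: spB)
  define \<delta> where "\<delta> j v \<omega> = (indicator {j} (I v \<omega>) - indicator {j} (I t \<omega>) :: real)" for j v \<omega>
  have It[measurable]: "I t \<in> measurable P (count_space UNIV)" using I_meas[of t] t by auto
  have d_meas[measurable]: "(\<lambda>z. \<delta> j (fst z) (snd z)) \<in> borel_measurable (?B \<Otimes>\<^sub>M P)" for j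
    unfolding \<delta>_def
    by (intro borel_measurable_diff measurable_compose[OF IU(1) ind]
        measurable_compose[OF measurable_compose[OF measurable_snd It] ind])
  have d_le: "\<bar>\<delta> j v \<omega>\<bar> \<le> 1" for j v \<omega> by (simp add: \<delta>_def indicator_def)
  define \<gamma> where "\<gamma> j v = (\<integral>\<omega>. ?a \<omega> * G j v \<omega> \<partial>P)" for j v
  have g_meas[measurable]: "\<gamma> j \<in> borel_measurable ?B" for j
    unfolding \<gamma>_def[abs_def] by (rule borel_measurable_lebesgue_integral) measurable
  have g_le: "\<bar>\<gamma> j v\<bar> \<le> \<Gamma>" if "v \<in> {t..T}" for j v
    using abs_integral_bounded_le[OF finP \<Gamma>, of "\<lambda>\<omega>. ?a \<omega> * G j v \<omega>"] G_le[OF that] a_le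
    by (auto simp: \<gamma>_def prob_space intro: order_trans[OF a_le])
  \<comment> \<open>The martingale problem for the indicator of \<open>j\<close>, with expectation and time integral exchanged.\<close>
  have mart: "(\<integral>v. (if v \<le> x then \<gamma> j v else 0) \<partial>?B) = (\<integral>\<omega>. ?a \<omega> * \<delta> j x \<omega> \<partial>P)" if x: "x \<in> {t..T}" for j x
  proof -
    have "(\<integral>v. (if v \<le> x then \<gamma> j v else 0) \<partial>?B) = (\<integral>v. \<integral>\<omega>. (if v \<le> x then ?a \<omega> * G j v \<omega> else 0) \<partial>P \<partial>?B)"
      by (intro Bochner_Integration.integral_cong refl) (simp add: \<gamma>_def)
    also have "\<dots> = (\<integral>\<omega>. \<integral>v. (if v \<le> x then ?a \<omega> * G j v \<omega> else 0) \<partial>?B \<partial>P)"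
      using G_le \<Gamma> by (intro Fubini_bounded[where C=\<Gamma>] finB finP) (auto simp: spB intro: order_trans[OF a_le])
    also have "\<dots> = (\<integral>\<omega>. ?a \<omega> * (LINT v:{t..x}|lborel. G j v \<omega>) \<partial>P)"
    proof (intro Bochner_Integration.integral_cong refl)
      fix \<omega>
      have "(\<integral>v. (if v \<le> x then ?a \<omega> * G j v \<omega> else 0) \<partial>?B) = (\<integral>v. ?a \<omega> * (indicator {t..x} v * G j v \<omega>) \<partial>lborel)"
        unfolding integral_time_measure set_lebesgue_integral_def using x
        by (intro Bochner_Integration.integral_cong) (auto simp: indicator_def)
      thus "(\<integral>v. (if v \<le> x then ?a \<omega> * G j v \<omega> else 0) \<partial>?B) = ?a \<omega> * (LINT v:{t..x}|lborel. G j v \<omega>)"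
        by (simp add: set_lebesgue_integral_def)
    qed
    also have "\<dots> = (\<integral>\<omega>. ?a \<omega> * \<delta> j x \<omega> \<partial>P)"
    proof -
      have "(LINT \<omega>:A|P. indicator {j} (I x \<omega>) - indicator {j} (I t \<omega>)
           - (LINT v:{t..x}|lborel. generator N lam v (u v \<omega>) (indicator {j} :: nat \<Rightarrow> real) (I v \<omega>))) = 0"
        using adm t x A unfolding admissible_def by auto
      hence 0: "(\<integral>\<omega>. ?a \<omega> * \<delta> j x \<omega> - ?a \<omega> * (LINT v:{t..x}|lborel. G j v \<omega>) \<partial>P) = 0"
        by (simp add: set_lebesgue_integral_def[where M=P] \<delta>_def G_def right_diff_distrib)
      have Ix[measurable]: "I x \<in> measurable P (count_space UNIV)" by (rule I_meas[OF x])
      have 1: "integrable P (\<lambda>\<omega>. ?a \<omega> * \<delta> j x \<omega>)"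
      proof (rule integrable_const_bound[of _ 1])
        show "AE \<omega> in P. norm (?a \<omega> * \<delta> j x \<omega>) \<le> 1"
          unfolding real_norm_def by (intro AE_I2 order_trans[OF a_le d_le])
        have "(\<lambda>\<omega>. \<delta> j x \<omega>) \<in> borel_measurable P"
          unfolding \<delta>_def by (intro borel_measurable_diff measurable_compose[OF Ix ind] measurable_compose[OF It ind])
        thus "(\<lambda>\<omega>. ?a \<omega> * \<delta> j x \<omega>) \<in> borel_measurable P" by measurable
      qed
      have "(LINT v:{t..x}|lborel. G j v \<omega>) = (\<integral>v. (if v \<le> x then G j v \<omega> else 0) \<partial>?B)" for \<omega>
        unfolding integral_time_measure set_lebesgue_integral_def using x
        by (intro Bochner_Integration.integral_cong) (auto simp: indicator_def)
      moreover have "(\<lambda>\<omega>. \<integral>v. (if v \<le> x then G j v \<omega> else 0) \<partial>?B) \<in> borel_measurable P"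
        by (rule B.borel_measurable_lebesgue_integral) measurable
      moreover have "\<bar>\<integral>v. (if v \<le> x then G j v \<omega> else 0) \<partial>?B\<bar> \<le> \<Gamma> * measure ?B (space ?B)" if "\<omega> \<in> space P" for \<omega>
        using G_le[OF _ that] \<Gamma> by (intro abs_integral_bounded_le finB) (auto simp: spB)
      ultimately have 2: "integrable P (\<lambda>\<omega>. ?a \<omega> * (LINT v:{t..x}|lborel. G j v \<omega>))"
        by (intro integrable_const_bound[of _ "\<Gamma> * measure ?B (space ?B)"]) (auto intro!: AE_I2 order_trans[OF a_le])
      from 0 1 2 show ?thesis by simp
    qed
    finally show ?thesis .
  qed
  have HI_meas: "(\<lambda>z. H (I (fst z) (snd z)) (fst z)) \<in> borel_measurable (?B \<Otimes>\<^sub>M P)"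
    by (rule measurable_compose_countable[where f="\<lambda>j z. H j (fst z)"], rule measurable_compose[OF measurable_fst HB]) measurable
  have j: "(\<integral>\<omega>. ?a \<omega> * (\<integral>v. w j v * G j v \<omega> \<partial>?B) \<partial>P) = (\<integral>\<omega>. ?a \<omega> * (\<integral>x. H j x * \<delta> j x \<omega> \<partial>?B) \<partial>P)" for j
  proof -
    have "(\<integral>\<omega>. ?a \<omega> * (\<integral>v. w j v * G j v \<omega> \<partial>?B) \<partial>P) = (\<integral>\<omega>. \<integral>v. ?a \<omega> * (w j v * G j v \<omega>) \<partial>?B \<partial>P)"
      by simp
    also have "\<dots> = (\<integral>v. \<integral>\<omega>. ?a \<omega> * (w j v * G j v \<omega>) \<partial>P \<partial>?B)"
    proof (rule Fubini_bounded[OF finP finB, where C="W * \<Gamma>"])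
      have "(\<lambda>z. w j (snd z)) \<in> borel_measurable (P \<Otimes>\<^sub>M ?B)" by (rule measurable_compose[OF measurable_snd wB_meas])
      thus "(\<lambda>z. ?a (fst z) * (w j (snd z) * G j (snd z) (fst z))) \<in> borel_measurable (P \<Otimes>\<^sub>M ?B)" by measurable
      fix \<omega> v assume "\<omega> \<in> space P" "v \<in> space ?B"
      thus "\<bar>?a \<omega> * (w j v * G j v \<omega>)\<bar> \<le> W * \<Gamma>"
        using w_le[of v j] G_le[of v \<omega> j] by (intro order_trans[OF a_le]) (auto simp: abs_mult spB intro!: mult_mono order_trans[OF abs_ge_zero])
    qed
    also have "\<dots> = (\<integral>v. w j v * \<gamma> j v \<partial>?B)"
      unfolding \<gamma>_def by (simp add: mult.left_commute[of "?a _"])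
    also have "\<dots> = (\<integral>v. \<integral>x. (if v \<le> x then H j x * \<gamma> j v else 0) \<partial>?B \<partial>?B)"
    proof (intro Bochner_Integration.integral_cong refl)
      fix v assume "v \<in> space ?B"
      hence "w j v * \<gamma> j v = (\<integral>x. (if v \<le> x then H j x else 0) * \<gamma> j v \<partial>?B)" by (simp add: w_B spB)
      also have "\<dots> = (\<integral>x. (if v \<le> x then H j x * \<gamma> j v else 0) \<partial>?B)"
        by (intro Bochner_Integration.integral_cong) auto
      finally show "w j v * \<gamma> j v = \<dots>" .
    qed
    also have "\<dots> = (\<integral>x. \<integral>v. (if v \<le> x then H j x * \<gamma> j v else 0) \<partial>?B \<partial>?B)"
    proof (rule Fubini_bounded[OF finB finB, where C="C * \<Gamma>"])
      have [measurable]: "(\<lambda>z. H j (snd z)) \<in> borel_measurable (?B \<Otimes>\<^sub>M ?B)" "(\<lambda>z. \<gamma> j (fst z)) \<in> borel_measurable (?B \<Otimes>\<^sub>M ?B)"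
        by (rule measurable_compose[OF measurable_snd HB], rule measurable_compose[OF measurable_fst g_meas])
      show "(\<lambda>z. if fst z \<le> snd z then H j (snd z) * \<gamma> j (fst z) else 0) \<in> borel_measurable (?B \<Otimes>\<^sub>M ?B)"
        by measurable
      fix v x assume "v \<in> space ?B" "x \<in> space ?B"
      thus "\<bar>if v \<le> x then H j x * \<gamma> j v else 0\<bar> \<le> C * \<Gamma>"
        using H(2)[of j x] g_le[of v j] C \<Gamma> by (auto simp: abs_mult spB intro!: mult_mono)
    qed
    also have "\<dots> = (\<integral>x. H j x * (\<integral>\<omega>. ?a \<omega> * \<delta> j x \<omega> \<partial>P) \<partial>?B)"
    proof (intro Bochner_Integration.integral_cong refl)
      fix x assume x: "x \<in> space ?B"
      have "(\<integral>v. (if v \<le> x then H j x * \<gamma> j v else 0) \<partial>?B) = (\<integral>v. H j x * (if v \<le> x then \<gamma> j v else 0) \<partial>?B)"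
        by (intro Bochner_Integration.integral_cong) auto
      thus "(\<integral>v. (if v \<le> x then H j x * \<gamma> j v else 0) \<partial>?B) = H j x * (\<integral>\<omega>. ?a \<omega> * \<delta> j x \<omega> \<partial>P)"
        using mart[of x j] x by (simp add: spB)
    qed
    also have "\<dots> = (\<integral>x. \<integral>\<omega>. ?a \<omega> * (H j x * \<delta> j x \<omega>) \<partial>P \<partial>?B)"
      by (simp add: mult.left_commute[of "?a _"])
    also have "\<dots> = (\<integral>\<omega>. \<integral>x. ?a \<omega> * (H j x * \<delta> j x \<omega>) \<partial>?B \<partial>P)"
    proof (rule Fubini_bounded[OF finB finP, where C="C * 1"])
      have "(\<lambda>z. H j (fst z)) \<in> borel_measurable (?B \<Otimes>\<^sub>M P)" by (rule measurable_compose[OF measurable_fst HB])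
      thus "(\<lambda>z. ?a (snd z) * (H j (fst z) * \<delta> j (fst z) (snd z))) \<in> borel_measurable (?B \<Otimes>\<^sub>M P)" by measurable
      fix x \<omega>
      have "\<bar>H j x * \<delta> j x \<omega>\<bar> \<le> C * 1"
        unfolding abs_mult using H(2) d_le C by (intro mult_mono) auto
      thus "\<bar>?a \<omega> * (H j x * \<delta> j x \<omega>)\<bar> \<le> C * 1" by (rule order_trans[OF a_le])
    qed
    finally show ?thesis by simp
  qed
  have HI: "(\<lambda>z. H (I (fst z) (snd z)) (fst z)) \<in> borel_measurable (?B \<Otimes>\<^sub>M P)"
    and wG: "(\<lambda>z. w j (fst z) * G j (fst z) (snd z)) \<in> borel_measurable (?B \<Otimes>\<^sub>M P)"
    and Hd: "(\<lambda>z. H j (fst z) * \<delta> j (fst z) (snd z)) \<in> borel_measurable (?B \<Otimes>\<^sub>M P)" for j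
    by (rule HI_meas, (intro borel_measurable_times G_meas d_meas
        measurable_compose[OF measurable_fst wB_meas] measurable_compose[OF measurable_fst HB])+)
  have HI_le: "\<forall>v\<in>{t..T}. \<forall>\<omega>\<in>space P. \<bar>H (I v \<omega>) v\<bar> \<le> C" using H(2) by blast
  have wG_le: "\<forall>v\<in>{t..T}. \<forall>\<omega>\<in>space P. \<bar>w j v * G j v \<omega>\<bar> \<le> W * \<Gamma>" for j
    using w_le[of _ j] G_le[of _ _ j] by (auto simp: abs_mult intro!: mult_mono order_trans[OF abs_ge_zero w_le])
  have Hd_le: "\<forall>v\<in>{t..T}. \<forall>\<omega>\<in>space P. \<bar>H j v * \<delta> j v \<omega>\<bar> \<le> C * 1" for j
    unfolding abs_mult using H(2) d_le C by (intro ballI mult_mono) auto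
  note int1 = integrable_time_section(1)[OF finP sA HI HI_le] integrable_time_section(1)[OF finP sA wG wG_le]
    integrable_time_section(1)[OF finP sA Hd Hd_le]
  note intH = integrable_time_section(2)[OF finP sA HI HI_le] and intG = integrable_time_section(2)[OF finP sA wG wG_le]
    and intD = integrable_time_section(2)[OF finP sA Hd Hd_le]
  have split: "(\<integral>\<omega>. X \<omega> - (\<Sum>j\<le>N. Y j \<omega>) \<partial>P) = (\<integral>\<omega>. X \<omega> \<partial>P) - (\<Sum>j\<le>N. \<integral>\<omega>. Y j \<omega> \<partial>P)"
    if "integrable P X" "\<And>j. integrable P (Y j)" for X :: "'a \<Rightarrow> real" and Y using that by simp
  have "(LINT \<omega>:A|P. LINT v:{t..T}|lborel. H (I v \<omega>) v - generator N lam v (u v \<omega>) (\<lambda>j. w j v) (I v \<omega>))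
     = (\<integral>\<omega>. ?a \<omega> * (\<integral>v. H (I v \<omega>) v \<partial>?B) - (\<Sum>j\<le>N. ?a \<omega> * (\<integral>v. w j v * G j v \<omega> \<partial>?B)) \<partial>P)"
    unfolding set_lebesgue_integral_def[where M=P] integral_time_measure[symmetric]
  proof (intro Bochner_Integration.integral_cong refl)
    fix \<omega> assume w: "\<omega> \<in> space P"
    have "(\<integral>v. H (I v \<omega>) v - generator N lam v (u v \<omega>) (\<lambda>j. w j v) (I v \<omega>) \<partial>?B)
       = (\<integral>v. H (I v \<omega>) v - (\<Sum>j\<le>N. w j v * G j v \<omega>) \<partial>?B)"
      unfolding G_def using I_le[OF _ w]
      by (intro Bochner_Integration.integral_cong refl arg_cong2[where f="(-)"] generator_linear) (auto simp: spB)
    also have "\<dots> = (\<integral>v. H (I v \<omega>) v \<partial>?B) - (\<Sum>j\<le>N. \<integral>v. w j v * G j v \<omega> \<partial>?B)"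
      using int1[OF w] by simp
    finally show "?a \<omega> *\<^sub>R (\<integral>v. H (I v \<omega>) v - generator N lam v (u v \<omega>) (\<lambda>j. w j v) (I v \<omega>) \<partial>?B)
      = ?a \<omega> * (\<integral>v. H (I v \<omega>) v \<partial>?B) - (\<Sum>j\<le>N. ?a \<omega> * (\<integral>v. w j v * G j v \<omega> \<partial>?B))"
      by (simp add: right_diff_distrib sum_distrib_left)
  qed
  also have "\<dots> = (\<integral>\<omega>. ?a \<omega> * (\<integral>v. H (I v \<omega>) v \<partial>?B) \<partial>P) - (\<Sum>j\<le>N. \<integral>\<omega>. ?a \<omega> * (\<integral>x. H j x * \<delta> j x \<omega> \<partial>?B) \<partial>P)"
    unfolding split[OF intH intG] j ..
  also have "\<dots> = (\<integral>\<omega>. ?a \<omega> * (\<integral>v. H (I v \<omega>) v \<partial>?B) - (\<Sum>j\<le>N. ?a \<omega> * (\<integral>x. H j x * \<delta> j x \<omega> \<partial>?B)) \<partial>P)"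
    by (rule split[OF intH intD, symmetric])
  also have "\<dots> = (LINT \<omega>:A|P. w (I t \<omega>) t)"
    unfolding set_lebesgue_integral_def
  proof (intro Bochner_Integration.integral_cong refl)
    fix \<omega> assume om: "\<omega> \<in> space P"
    have tt: "t \<in> {t..T}" using t by auto
    have "(\<Sum>j\<le>N. \<integral>x. H j x * \<delta> j x \<omega> \<partial>?B) = (\<integral>x. (\<Sum>j\<le>N. H j x * \<delta> j x \<omega>) \<partial>?B)"
      using int1(3)[OF om] by simp
    also have "\<dots> = (\<integral>x. H (I x \<omega>) x - H (I t \<omega>) x \<partial>?B)"
    proof (intro Bochner_Integration.integral_cong refl)
      fix x assume "x \<in> space ?B"
      hence "I x \<omega> \<le> N" "I t \<omega> \<le> N" using I_le om tt by (auto simp: spB)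
      thus "(\<Sum>j\<le>N. H j x * \<delta> j x \<omega>) = H (I x \<omega>) x - H (I t \<omega>) x"
        by (simp add: \<delta>_def right_diff_distrib sum_subtractf indicator_def if_distrib[of "\<lambda>x. _ * x"] cong: if_cong)
    qed
    also have "\<dots> = (\<integral>v. H (I v \<omega>) v \<partial>?B) - (\<integral>x. H (I t \<omega>) x \<partial>?B)"
    proof -
      have "integrable ?B (H (I t \<omega>))" using H(2) by (intro B.integrable_const_bound[of _ C]) auto
      thus ?thesis using int1(1)[OF om] by simp
    qed
    also have "(\<integral>x. H (I t \<omega>) x \<partial>?B) = w (I t \<omega>) t" by (simp add: w integral_time_measure)
    finally have "(\<Sum>j\<le>N. \<integral>x. H j x * \<delta> j x \<omega> \<partial>?B) = (\<integral>v. H (I v \<omega>) v \<partial>?B) - w (I t \<omega>) t" .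
    thus "?a \<omega> * (\<integral>v. H (I v \<omega>) v \<partial>?B) - (\<Sum>j\<le>N. ?a \<omega> * (\<integral>x. H j x * \<delta> j x \<omega> \<partial>?B)) = ?a \<omega> *\<^sub>R w (I t \<omega>) t"
      unfolding sum_distrib_left[symmetric] by (simp only: right_diff_distrib real_scaleR_def)
  qed
  finally show ?thesis by simp
qed

section \<open>The backward differential system of the marginal costs\<close>

lemma integrable_time_measure_bounded:
  fixes f :: "real \<Rightarrow> real"
  assumes "f \<in> borel_measurable borel" "\<And>s. s \<in> {a..b} \<Longrightarrow> \<bar>f s\<bar> \<le> C"
  shows "integrable (time_measure a b) f"
proof (rule finite_measure.integrable_const_bound[OF finite_time_measure, of _ C])
  show "AE s in time_measure a b. norm (f s) \<le> C"
    using assms(2) by (intro AE_I2) (simp add: space_time_measure)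
qed (rule measurable_time_measure[OF assms(1)])

lemma integral_time_measure_if:
  fixes f :: "real \<Rightarrow> real"
  shows "(\<integral>s. f s \<partial>time_measure a b) = (\<integral>s. (if a \<le> s \<and> s \<le> b then f s else 0) \<partial>lborel)"
  unfolding integral_time_measure set_lebesgue_integral_def
  by (intro Bochner_Integration.integral_cong) (auto simp: indicator_def)

lemma integral_time_measure_shift:
  fixes f :: "real \<Rightarrow> real"
  shows "(\<integral>s. f s \<partial>time_measure (a + L) b) = (\<integral>s. f (s + L) \<partial>time_measure a (b - L))"
  unfolding integral_time_measure_if
  by (subst lborel_integral_real_affine[where c=1 and t=L])
    (auto simp: add.commute le_diff_eq intro!: Bochner_Integration.integral_cong)

lemma integral_time_measure_mono_right:
  fixes f :: "real \<Rightarrow> real"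
  assumes "f \<in> borel_measurable borel" "\<And>s. 0 \<le> f s" "\<And>s. f s \<le> C" "b \<le> b'"
  shows "(\<integral>s. f s \<partial>time_measure a b) \<le> (\<integral>s. f s \<partial>time_measure a b')"
proof -
  have "integrable lborel (\<lambda>s. if a \<le> s \<and> s \<le> x then f s else 0)" for x
  proof -
    have "integrable (restrict_space lborel {a..x}) f"
      using integrable_time_measure_bounded[OF assms(1), of a x C] assms(2,3)
      unfolding time_measure_def by auto
    hence "integrable lborel (\<lambda>s. indicator {a..x} s *\<^sub>R f s)"
      by (subst (asm) integrable_restrict_space) auto
    thus ?thesis by (rule Bochner_Integration.integrable_cong[THEN iffD1, rotated 2]) (auto simp: indicator_def)
  qed
  thus ?thesis unfolding integral_time_measure_if
    using assms by (intro integral_mono) auto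
qed

lemma integral_exp_kernel:
  fixes R :: real
  assumes "a \<le> b"
  shows "(\<integral>s. R * exp (- R * (b - s)) \<partial>time_measure a b) = 1 - exp (- R * (b - a))"
    and "(\<integral>s. R * exp (- R * (s - a)) \<partial>time_measure a b) = 1 - exp (- R * (b - a))"
proof -
  have "(\<integral>s. indicator {a..b} s *\<^sub>R (R * exp (- R * (b - s))) \<partial>lborel) = exp (- R * (b - b)) - exp (- R * (b - a))"
    by (rule integral_FTC_Icc[OF assms])
      (auto intro!: derivative_eq_intros continuous_intros simp flip: has_real_derivative_iff_has_vector_derivative)
  thus "(\<integral>s. R * exp (- R * (b - s)) \<partial>time_measure a b) = 1 - exp (- R * (b - a))"
    unfolding integral_time_measure set_lebesgue_integral_def diff_self mult_zero_right exp_zero .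
  have "(\<integral>s. indicator {a..b} s *\<^sub>R (R * exp (- R * (s - a))) \<partial>lborel) = - exp (- R * (b - a)) - - exp (- R * (a - a))"
    by (rule integral_FTC_Icc[OF assms])
      (auto intro!: derivative_eq_intros continuous_intros simp flip: has_real_derivative_iff_has_vector_derivative)
  thus "(\<integral>s. R * exp (- R * (s - a)) \<partial>time_measure a b) = 1 - exp (- R * (b - a))"
    unfolding integral_time_measure set_lebesgue_integral_def diff_self mult_zero_right exp_zero by linarith
qed

text \<open>
  Solutions of \<open>- y' = f - R * y\<close> with \<open>y T = 0\<close>, in discounted form on the assumption side and in undiscounted
  integral form in the conclusion. Fubini's theorem replaces differentiation, so \<open>f\<close> need only be
  measurable.
\<close>
lemma variation_of_constants:
  fixes f y :: "real \<Rightarrow> real"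
  assumes f: "f \<in> borel_measurable borel" "\<And>s. \<bar>f s\<bar> \<le> C" and R: "0 \<le> R"
    and y: "\<And>t. y t = (\<integral>s. exp (- R * (s - t)) * f s \<partial>time_measure t T)"
    and y_int: "integrable (time_measure t T) y"
  shows "y t = (\<integral>s. f s - R * y s \<partial>time_measure t T)"
proof -
  let ?B = "time_measure t T"
  have C: "0 \<le> C" using f(2)[of 0] by linarith
  note fin = finite_time_measure
  have [measurable]: "(\<lambda>z. fst z) \<in> borel_measurable (?B \<Otimes>\<^sub>M ?B)" "(\<lambda>z. snd z) \<in> borel_measurable (?B \<Otimes>\<^sub>M ?B)"
    "(\<lambda>z. f (snd z)) \<in> borel_measurable (?B \<Otimes>\<^sub>M ?B)"
    by (rule measurable_compose[OF measurable_fst measurable_time_measure_ident]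
        measurable_compose[OF measurable_snd measurable_time_measure_ident]
        measurable_compose[OF measurable_snd measurable_time_measure[OF f(1)]])+
  have "(\<integral>s. R * y s \<partial>?B) = (\<integral>s. \<integral>v. (if s \<le> v then R * exp (- R * (v - s)) * f v else 0) \<partial>?B \<partial>?B)"
  proof (intro Bochner_Integration.integral_cong refl)
    fix s assume "s \<in> space ?B"
    hence s: "s \<in> {t..T}" by (simp add: space_time_measure)
    have "R * y s = (\<integral>v. R * exp (- R * (v - s)) * f v \<partial>time_measure s T)" unfolding y by (simp add: mult.assoc)
    also have "\<dots> = (\<integral>v. (if s \<le> v then R * exp (- R * (v - s)) * f v else 0) \<partial>?B)"
      unfolding integral_time_measure_if using s by (intro Bochner_Integration.integral_cong) auto
    finally show "R * y s = \<dots>" .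
  qed
  also have "\<dots> = (\<integral>v. \<integral>s. (if s \<le> v then R * exp (- R * (v - s)) * f v else 0) \<partial>?B \<partial>?B)"
  proof (rule Fubini_bounded[OF fin fin, where C="R * C"])
    show "(\<lambda>z. if fst z \<le> snd z then R * exp (- R * (snd z - fst z)) * f (snd z) else 0) \<in> borel_measurable (?B \<Otimes>\<^sub>M ?B)"
      by measurable
    fix s v
    have "\<bar>R * (exp (- R * (v - s)) * f v)\<bar> \<le> R * (1 * C)" if "s \<le> v"
      unfolding abs_mult using that R f(2)[of v] C by (intro mult_mono) auto
    thus "\<bar>if s \<le> v then R * exp (- R * (v - s)) * f v else 0\<bar> \<le> R * C"
      using R C by (auto simp: mult.assoc)
  qed
  also have "\<dots> = (\<integral>v. f v - exp (- R * (v - t)) * f v \<partial>?B)"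
  proof (intro Bochner_Integration.integral_cong refl)
    fix v assume "v \<in> space ?B"
    hence v: "v \<in> {t..T}" by (simp add: space_time_measure)
    have "(\<integral>s. (if s \<le> v then R * exp (- R * (v - s)) * f v else 0) \<partial>?B) = (\<integral>s. R * exp (- R * (v - s)) * f v \<partial>time_measure t v)"
      unfolding integral_time_measure_if using v by (intro Bochner_Integration.integral_cong) auto
    also have "\<dots> = (1 - exp (- R * (v - t))) * f v"
      using integral_exp_kernel(1)[of t v R] v by simp
    finally show "(\<integral>s. (if s \<le> v then R * exp (- R * (v - s)) * f v else 0) \<partial>?B) = f v - exp (- R * (v - t)) * f v"
      by (simp add: algebra_simps)
  qed
  also have "\<dots> = (\<integral>v. f v \<partial>?B) - y t"
  proof -
    have "\<bar>exp (- R * (v - t)) * f v\<bar> \<le> 1 * C" if "v \<in> {t..T}" for v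
      unfolding abs_mult using that R f(2)[of v] C by (intro mult_mono) auto
    hence "integrable ?B (\<lambda>v. exp (- R * (v - t)) * f v)"
      using f(1) by (intro integrable_time_measure_bounded[of _ _ _ "1 * C"]) auto
    moreover have "integrable ?B f" using f by (intro integrable_time_measure_bounded[of _ _ _ C]) auto
    ultimately show ?thesis by (simp add: y)
  qed
  finally have "y t = (\<integral>v. f v \<partial>?B) - (\<integral>s. R * y s \<partial>?B)" by simp
  also have "\<dots> = (\<integral>s. f s - R * y s \<partial>?B)"
    using y_int f by (subst Bochner_Integration.integral_diff) (auto intro!: integrable_time_measure_bounded[of _ _ _ C])
  finally show ?thesis .
qed

text \<open>
  Here \<open>l\<close> and \<open>c\<close> stand for the arrival rate and the energy price, extended from the horizon to the whole
  line, and \<open>\<Lambda>\<close> bounds the arrival rate.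
\<close>
locale marginal_system =
  fixes N K :: nat and p T \<Lambda> :: real and l c :: "real \<Rightarrow> real"
  assumes p: "0 \<le> p" and \<Lambda>: "0 \<le> \<Lambda>"
    and l_meas[measurable]: "l \<in> borel_measurable borel" and c_meas[measurable]: "c \<in> borel_measurable borel"
    and l: "\<And>s. 0 \<le> l s" "\<And>s. l s \<le> \<Lambda>" and c: "\<And>s. 0 \<le> c s"
begin

text \<open>
  Discounting at this rate makes the right-hand side \<open>\<Phi>\<close> below monotone.
\<close>
definition R :: real where "R = \<Lambda> + real K"

lemma R_nonneg: "0 \<le> R" using \<Lambda> by (simp add: R_def)

text \<open>
  The right-hand side of the backward system for the marginal costs, plus the term \<open>R * d i\<close> that the
  discount factor compensates. At \<open>i = 1\<close> the last coefficient is zero, so index \<open>0\<close> does not enter.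
\<close>
definition \<Phi> :: "real \<Rightarrow> (nat \<Rightarrow> real) \<Rightarrow> nat \<Rightarrow> real" where
  "\<Phi> s d i = R * d i + l s * (d (i + 1) - d i) - real (min i K) * max 0 (d i - c s)
     + real (min (i - 1) K) * max 0 (d (i - 1) - c s)"

text \<open>
  The slope in \<open>d i\<close> is at least \<open>R - l s - K\<close>, which is nonnegative by the choice of \<open>R\<close>; the neighbours have
  nonnegative coefficients.
\<close>
lemma \<Phi>_mono:
  assumes "\<And>j. d j \<le> d' j"
  shows "\<Phi> s d i \<le> \<Phi> s d' i"
proof -
  have 1: "(R - l s) * d i - real (min i K) * max 0 (d i - c s) \<le> (R - l s) * d' i - real (min i K) * max 0 (d' i - c s)"
  proof -
    have "real (min i K) * (max 0 (d' i - c s) - max 0 (d i - c s)) \<le> real K * (d' i - d i)"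
      using assms[of i] by (intro mult_mono) auto
    also have "\<dots> \<le> (R - l s) * (d' i - d i)"
      using assms[of i] l(2)[of s] by (intro mult_right_mono) (auto simp: R_def)
    finally show ?thesis by (simp add: algebra_simps)
  qed
  have 2: "l s * d (i + 1) \<le> l s * d' (i + 1)" using l assms by (intro mult_left_mono) auto
  have 3: "real (min (i - 1) K) * max 0 (d (i - 1) - c s) \<le> real (min (i - 1) K) * max 0 (d' (i - 1) - c s)"
    using assms[of "i - 1"] by (intro mult_left_mono) auto
  show ?thesis using 1 2 3 unfolding \<Phi>_def by (simp add: algebra_simps)
qed

text \<open>
  The constants \<open>0\<close> and \<open>p\<close> are a sub- and a supersolution.
\<close>
lemma \<Phi>_bounds:
  assumes "\<And>j. 0 \<le> d j" "\<And>j. d j \<le> p"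
  shows "0 \<le> \<Phi> s d i" "\<Phi> s d i \<le> R * p"
proof -
  have "\<Phi> s (\<lambda>_. 0) i = 0" using c[of s] by (simp add: \<Phi>_def)
  thus "0 \<le> \<Phi> s d i" using \<Phi>_mono[of "\<lambda>_. 0" d s i] assms by simp
  have "\<Phi> s d i \<le> \<Phi> s (\<lambda>_. p) i" using assms by (intro \<Phi>_mono)
  also have "\<dots> \<le> R * p"
  proof -
    have "real (min (i - 1) K) * max 0 (p - c s) \<le> real (min i K) * max 0 (p - c s)"
      by (intro mult_right_mono) auto
    thus ?thesis by (simp add: \<Phi>_def)
  qed
  finally show "\<Phi> s d i \<le> R * p" .
qed

definition profile :: "(real \<Rightarrow> nat \<Rightarrow> real) \<Rightarrow> bool" where
  "profile d \<longleftrightarrow> (\<forall>t i. 0 \<le> d t i \<and> d t i \<le> p) \<and> (\<forall>i. (\<lambda>t. d t i) \<in> borel_measurable borel)"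

text \<open>
  Above \<open>N\<close> the profile is \<open>p\<close>: the price of a lost arrival acts as the marginal cost of a unit \<open>N + 1\<close>.
\<close>
definition step :: "(real \<Rightarrow> nat \<Rightarrow> real) \<Rightarrow> real \<Rightarrow> nat \<Rightarrow> real" where
  "step d t i = (if i = 0 then 0 else if i \<le> N then \<integral>s. exp (- R * (s - t)) * \<Phi> s (d s) i \<partial>time_measure t T else p)"

lemma measurable_\<Phi>:
  assumes "profile d"
  shows "(\<lambda>s. \<Phi> s (d s) i) \<in> borel_measurable borel"
proof -
  have [measurable]: "(\<lambda>t. d t i) \<in> borel_measurable borel" for i using assms by (simp add: profile_def)
  show ?thesis unfolding \<Phi>_def by measurable
qed

lemma kernel_bounds:
  assumes d: "profile d" and "t \<le> s"
  shows "0 \<le> exp (- R * (s - t)) * \<Phi> s (d s) i" "exp (- R * (s - t)) * \<Phi> s (d s) i \<le> R * p"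
    "exp (- R * (s - t)) * \<Phi> s (d s) i \<le> R * exp (- R * (s - t)) * p"
proof -
  have b: "0 \<le> \<Phi> s (d s) i" "\<Phi> s (d s) i \<le> R * p"
    using \<Phi>_bounds[of "d s"] d by (auto simp: profile_def)
  show 0: "0 \<le> exp (- R * (s - t)) * \<Phi> s (d s) i" using b by simp
  have "exp (- R * (s - t)) \<le> 1" using assms(2) R_nonneg by simp
  hence "exp (- R * (s - t)) * \<Phi> s (d s) i \<le> 1 * \<Phi> s (d s) i" using b by (intro mult_right_mono) auto
  thus "exp (- R * (s - t)) * \<Phi> s (d s) i \<le> R * p" using b by linarith
  have "exp (- R * (s - t)) * \<Phi> s (d s) i \<le> exp (- R * (s - t)) * (R * p)" using b by (intro mult_left_mono) auto
  thus "exp (- R * (s - t)) * \<Phi> s (d s) i \<le> R * exp (- R * (s - t)) * p" by (simp add: mult_ac)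
qed

lemma kernel_integrable:
  assumes "profile d"
  shows "integrable (time_measure t b) (\<lambda>s. exp (- R * (s - t)) * \<Phi> s (d s) i)"
proof (rule integrable_time_measure_bounded[where C="R * p"])
  have [measurable]: "(\<lambda>s. \<Phi> s (d s) i) \<in> borel_measurable borel" by (rule measurable_\<Phi>[OF assms])
  show "(\<lambda>s. exp (- R * (s - t)) * \<Phi> s (d s) i) \<in> borel_measurable borel" by measurable
  show "\<bar>exp (- R * (s - t)) * \<Phi> s (d s) i\<bar> \<le> R * p" if "s \<in> {t..b}" for s
    using kernel_bounds[OF assms, of t s i] that by auto
qed

lemma step_profile:
  assumes d: "profile d"
  shows "profile (step d)"
proof -
  have "0 \<le> step d t i \<and> step d t i \<le> p" for t i
  proof (cases "1 \<le> i \<and> i \<le> N")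
    case True
    have "0 \<le> (\<integral>s. exp (- R * (s - t)) * \<Phi> s (d s) i \<partial>time_measure t T)"
      using kernel_bounds[OF d, of t _ i] by (intro integral_nonneg_AE AE_I2) (simp add: space_time_measure)
    moreover have "(\<integral>s. exp (- R * (s - t)) * \<Phi> s (d s) i \<partial>time_measure t T) \<le> p"
    proof (cases "t \<le> T")
      case tT: True
      have "integrable (time_measure t T) (\<lambda>s. R * exp (- R * (s - t)))"
        by (rule integrable_time_measure_bounded[where C=R]) (use R_nonneg in \<open>auto simp: mult_left_le\<close>)
      hence "(\<integral>s. exp (- R * (s - t)) * \<Phi> s (d s) i \<partial>time_measure t T) \<le> (\<integral>s. R * exp (- R * (s - t)) * p \<partial>time_measure t T)"
        using kernel_bounds[OF d, of t _ i] kernel_integrable[OF d, of t T i]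
        by (intro integral_mono) (auto simp: space_time_measure)
      also have "\<dots> = (1 - exp (- R * (T - t))) * p" using integral_exp_kernel(2)[OF tT, of R] by simp
      also have "\<dots> \<le> 1 * p" using p by (intro mult_right_mono) auto
      finally show ?thesis by simp
    next
      case False
      thus ?thesis using p by (simp add: integral_time_measure set_lebesgue_integral_def)
    qed
    ultimately show ?thesis using True by (simp add: step_def)
  qed (use p in \<open>auto simp: step_def\<close>)
  moreover have "(\<lambda>t. step d t i) \<in> borel_measurable borel" for i
  proof -
    have [measurable]: "(\<lambda>s. \<Phi> s (d s) i) \<in> borel_measurable borel" by (rule measurable_\<Phi>[OF d])
    have "(\<lambda>t. \<integral>s. exp (- R * (s - t)) * \<Phi> s (d s) i \<partial>time_measure t T) \<in> borel_measurable borel"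
      unfolding integral_time_measure_if by (rule lborel.borel_measurable_lebesgue_integral) measurable
    thus ?thesis unfolding step_def by measurable
  qed
  ultimately show ?thesis by (simp add: profile_def)
qed

lemma step_mono:
  assumes d: "profile d" "profile d'" and le: "\<And>t j. d t j \<le> d' t j"
  shows "step d t i \<le> step d' t i"
proof -
  have "(\<integral>s. exp (- R * (s - t)) * \<Phi> s (d s) i \<partial>time_measure t T) \<le> (\<integral>s. exp (- R * (s - t)) * \<Phi> s (d' s) i \<partial>time_measure t T)"
    by (intro integral_mono kernel_integrable d mult_left_mono \<Phi>_mono le exp_ge_zero)
  thus ?thesis by (simp add: step_def)
qed

text \<open>
  Starting below the solution gives an increasing sequence, so that convergence needs no contraction
  estimate.
\<close>
definition iterate :: "nat \<Rightarrow> real \<Rightarrow> nat \<Rightarrow> real" where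
  "iterate n = (step ^^ n) (\<lambda>t i. if i \<le> N then 0 else p)"

lemma iterate_Suc: "iterate (Suc n) = step (iterate n)"
  by (simp add: iterate_def)

lemma iterate_profile: "profile (iterate n)"
  by (induction n) (auto simp: iterate_Suc step_profile, auto simp: iterate_def profile_def p)

lemma iterate_mono: "iterate n t i \<le> iterate (Suc n) t i"
proof (induction n arbitrary: t i)
  case 0
  have "0 \<le> iterate (Suc 0) t i" using iterate_profile[of "Suc 0"] unfolding profile_def by blast
  moreover have "iterate (Suc 0) t i = p" if "N < i" using that by (simp add: iterate_Suc step_def)
  ultimately show ?case by (auto simp: iterate_def[of 0])
next
  case (Suc n)
  show ?case
    using step_mono[OF iterate_profile[of n] iterate_profile[of "Suc n"] Suc, of t i] by (simp only: iterate_Suc)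
qed

lemma iterate_top: "N < i \<Longrightarrow> iterate n t i = p"
  by (cases n) (auto simp: iterate_Suc step_def, simp add: iterate_def)

definition \<Delta> :: "real \<Rightarrow> nat \<Rightarrow> real" where
  "\<Delta> t i = lim (\<lambda>n. iterate n t i)"

lemma iterate_tendsto: "(\<lambda>n. iterate n t i) \<longlonglongrightarrow> \<Delta> t i"
proof -
  have "incseq (\<lambda>n. iterate n t i)" by (rule incseq_SucI) (rule iterate_mono)
  moreover have "\<forall>n. iterate n t i \<le> p" using iterate_profile by (auto simp: profile_def)
  ultimately obtain x where "(\<lambda>n. iterate n t i) \<longlonglongrightarrow> x" by (rule incseq_convergent)
  thus ?thesis unfolding \<Delta>_def by (simp add: limI)
qed

lemma \<Delta>_profile: "profile \<Delta>"
proof -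
  have "0 \<le> \<Delta> t i" "\<Delta> t i \<le> p" for t i
    using iterate_profile by (auto simp: profile_def intro: LIMSEQ_le_const[OF iterate_tendsto] LIMSEQ_le_const2[OF iterate_tendsto])
  moreover have "(\<lambda>t. \<Delta> t i) \<in> borel_measurable borel" for i
    by (rule borel_measurable_LIMSEQ_real[OF iterate_tendsto]) (use iterate_profile in \<open>auto simp: profile_def\<close>)
  ultimately show ?thesis by (simp add: profile_def)
qed

lemma \<Delta>_top: "N < i \<Longrightarrow> \<Delta> t i = p"
  using iterate_tendsto[of t i] by (simp add: iterate_top LIMSEQ_const_iff)

lemma \<Delta>_fixed_point: "\<Delta> t i = step \<Delta> t i"
proof (rule LIMSEQ_unique)
  show "(\<lambda>n. iterate (Suc n) t i) \<longlonglongrightarrow> \<Delta> t i" by (rule LIMSEQ_Suc[OF iterate_tendsto])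
  show "(\<lambda>n. iterate (Suc n) t i) \<longlonglongrightarrow> step \<Delta> t i"
  proof (cases "1 \<le> i \<and> i \<le> N")
    case True
    have "(\<lambda>n. \<integral>s. exp (- R * (s - t)) * \<Phi> s (iterate n s) i \<partial>time_measure t T)
        \<longlonglongrightarrow> (\<integral>s. exp (- R * (s - t)) * \<Phi> s (\<Delta> s) i \<partial>time_measure t T)"
    proof (rule integral_dominated_convergence[where w="\<lambda>_. R * p"])
      show "(\<lambda>s. exp (- R * (s - t)) * \<Phi> s (\<Delta> s) i) \<in> borel_measurable (time_measure t T)"
        using kernel_integrable[OF \<Delta>_profile] by (rule borel_measurable_integrable)
      show "(\<lambda>s. exp (- R * (s - t)) * \<Phi> s (iterate n s) i) \<in> borel_measurable (time_measure t T)" for n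
        using kernel_integrable[OF iterate_profile] by (rule borel_measurable_integrable)
      show "integrable (time_measure t T) (\<lambda>_. R * p)" by (intro integrable_time_measure_bounded) auto
      show "AE s in time_measure t T. (\<lambda>n. exp (- R * (s - t)) * \<Phi> s (iterate n s) i) \<longlonglongrightarrow> exp (- R * (s - t)) * \<Phi> s (\<Delta> s) i"
        unfolding \<Phi>_def by (intro AE_I2 tendsto_intros iterate_tendsto)
      show "AE s in time_measure t T. norm (exp (- R * (s - t)) * \<Phi> s (iterate n s) i) \<le> R * p" for n
        using kernel_bounds[OF iterate_profile[of n], of t _ i] by (intro AE_I2) (simp add: space_time_measure)
    qed
    thus ?thesis using True by (simp add: iterate_Suc step_def)
  qed (auto simp: iterate_Suc step_def)
qed

text \<open>
  Passed on from every iterate to the limit. For an iterate, the integral that defines its value at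
  \<open>t + L\<close> is shifted by one period. The shift shortens the interval from \<open>[t, T]\<close> to \<open>[t, T - L]\<close>, which lowers
  the value since the integrand is nonnegative, and by induction it lowers the integrand, since \<open>\<Phi>\<close> is
  monotone.
\<close>
lemma \<Delta>_periodic_decreasing:
  assumes L: "0 \<le> L" and per: "\<And>s. 0 \<le> s \<Longrightarrow> s < T - L \<Longrightarrow> l (s + L) = l s \<and> c (s + L) = c s"
    and t: "0 \<le> t" "t \<le> T - L"
  shows "\<Delta> (t + L) i \<le> \<Delta> t i"
proof -
  have "iterate n (t + L) i \<le> iterate n t i" if "0 \<le> t" "t \<le> T - L" for n t i
    using that
  proof (induction n arbitrary: t i)
    case 0 show ?case by (simp add: iterate_def)
  next
    case (Suc n)
    note d = iterate_profile[of n]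
    show ?case
    proof (cases "1 \<le> i \<and> i \<le> N")
      case True
      have "iterate (Suc n) (t + L) i = (\<integral>s. exp (- R * (s - (t + L))) * \<Phi> s (iterate n s) i \<partial>time_measure (t + L) T)"
        using True by (simp add: iterate_Suc step_def)
      also have "\<dots> = (\<integral>s. exp (- R * (s - t)) * \<Phi> (s + L) (iterate n (s + L)) i \<partial>time_measure t (T - L))"
        unfolding integral_time_measure_shift by simp
      also have "\<dots> \<le> (\<integral>s. exp (- R * (s - t)) * \<Phi> s (iterate n s) i \<partial>time_measure t (T - L))"
      proof (rule integral_mono_AE)
        have [measurable]: "(\<lambda>s. \<Phi> s (iterate n s) i) \<in> borel_measurable borel" by (rule measurable_\<Phi>[OF d])
        have [measurable]: "(\<lambda>s. \<Phi> (s + L) (iterate n (s + L)) i) \<in> borel_measurable borel"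
          by (rule measurable_compose[of "\<lambda>s. s + L" borel borel "\<lambda>s. \<Phi> s (iterate n s) i"]) measurable
        show "integrable (time_measure t (T - L)) (\<lambda>s. exp (- R * (s - t)) * \<Phi> (s + L) (iterate n (s + L)) i)"
        proof (rule integrable_time_measure_bounded[where C="R * p"])
          show "\<bar>exp (- R * (s - t)) * \<Phi> (s + L) (iterate n (s + L)) i\<bar> \<le> R * p" if "s \<in> {t..T - L}" for s
            using kernel_bounds[OF d, of "t + L" "s + L" i] that by auto
        qed measurable
        show "integrable (time_measure t (T - L)) (\<lambda>s. exp (- R * (s - t)) * \<Phi> s (iterate n s) i)"
          by (rule kernel_integrable[OF d])
        \<comment> \<open>Periodicity compares half-open periods and may fail at the right endpoint.\<close>
        have "AE s in lborel. s \<noteq> T - L" by (rule AE_lborel_singleton)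
        hence "AE s in time_measure t (T - L). s \<noteq> T - L"
          unfolding time_measure_def by (subst AE_restrict_space_iff) auto
        moreover have "AE s in time_measure t (T - L). s \<in> {t..T - L}"
          by (rule AE_I2) (simp add: space_time_measure)
        ultimately show "AE s in time_measure t (T - L). exp (- R * (s - t)) * \<Phi> (s + L) (iterate n (s + L)) i \<le> exp (- R * (s - t)) * \<Phi> s (iterate n s) i"
        proof eventually_elim
          case (elim s)
          hence s: "0 \<le> s" "s < T - L" using Suc.prems by auto
          have "\<Phi> (s + L) (iterate n (s + L)) i = \<Phi> s (iterate n (s + L)) i" using per[OF s] by (simp add: \<Phi>_def)
          also have "\<dots> \<le> \<Phi> s (iterate n s) i" using s by (intro \<Phi>_mono Suc.IH) auto
          finally show ?case by (intro mult_left_mono) auto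
        qed
      qed
      also have "\<dots> = (\<integral>s. (if t \<le> s then exp (- R * (s - t)) * \<Phi> s (iterate n s) i else 0) \<partial>time_measure t (T - L))"
        by (intro Bochner_Integration.integral_cong) (auto simp: space_time_measure)
      also have "\<dots> \<le> (\<integral>s. (if t \<le> s then exp (- R * (s - t)) * \<Phi> s (iterate n s) i else 0) \<partial>time_measure t T)"
      proof (rule integral_time_measure_mono_right[where C="R * p"])
        have [measurable]: "(\<lambda>s. \<Phi> s (iterate n s) i) \<in> borel_measurable borel" by (rule measurable_\<Phi>[OF d])
        show "(\<lambda>s. if t \<le> s then exp (- R * (s - t)) * \<Phi> s (iterate n s) i else 0) \<in> borel_measurable borel" by measurable
      qed (use kernel_bounds[OF d, of t _ i] L R_nonneg p in auto)
      also have "\<dots> = (\<integral>s. exp (- R * (s - t)) * \<Phi> s (iterate n s) i \<partial>time_measure t T)"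
        by (intro Bochner_Integration.integral_cong) (auto simp: space_time_measure)
      also have "\<dots> = iterate (Suc n) t i" using True by (simp add: iterate_Suc step_def)
      finally show ?thesis .
    qed (auto simp: iterate_Suc step_def)
  qed
  from this[OF t] show ?thesis
    by (intro LIMSEQ_le[OF iterate_tendsto iterate_tendsto]) auto
qed

text \<open>
  Minimum over the feasible actions of cost rate plus generator applied to \<open>w\<close>, written in terms of the
  marginal costs; so \<open>w\<close> below satisfies the Hamilton-Jacobi-Bellman equation in integrated form.
\<close>
definition H :: "nat \<Rightarrow> real \<Rightarrow> real" where
  "H i s = l s * \<Delta> s (i + 1) - real (min i K) * max 0 (\<Delta> s i - c s)"

definition w :: "nat \<Rightarrow> real \<Rightarrow> real" where
  "w i t = (LINT s:{t..T}|lborel. H i s)"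

lemma \<Delta>_measurable[measurable]: "(\<lambda>t. \<Delta> t i) \<in> borel_measurable borel"
  using \<Delta>_profile by (simp add: profile_def)

lemma \<Delta>_bounds: "0 \<le> \<Delta> t i" "\<Delta> t i \<le> p"
  using \<Delta>_profile by (auto simp: profile_def)

lemma H_measurable: "H i \<in> borel_measurable borel"
  unfolding H_def by measurable

lemma H_bound: "\<bar>H i s\<bar> \<le> \<Lambda> * p + real K * p"
proof -
  have "\<bar>l s * \<Delta> s (i + 1)\<bar> \<le> \<Lambda> * p"
    unfolding abs_mult using l[of s] \<Delta>_bounds[of s "i + 1"] by (intro mult_mono) auto
  moreover have "\<bar>real (min i K) * max 0 (\<Delta> s i - c s)\<bar> \<le> real K * p"
    unfolding abs_mult using c[of s] \<Delta>_bounds[of s i] p by (intro mult_mono) auto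
  ultimately show ?thesis unfolding H_def by linarith
qed

text \<open>
  Both sides solve the same linear terminal value problem, as \<open>H i - H (i - 1) = \<Phi> i - R * \<Delta> i\<close>.
\<close>
lemma w_diff:
  assumes i: "1 \<le> i" "i \<le> N"
  shows "w i t - w (i - 1) t = \<Delta> t i"
proof -
  have y: "\<Delta> t i = (\<integral>s. exp (- R * (s - t)) * \<Phi> s (\<Delta> s) i \<partial>time_measure t T)" for t
    using i by (subst \<Delta>_fixed_point) (simp add: step_def)
  have b: "0 \<le> \<Phi> s (\<Delta> s) i" "\<Phi> s (\<Delta> s) i \<le> R * p" for s
    using \<Phi>_bounds[of "\<Delta> s"] \<Delta>_bounds by auto
  have "\<Delta> t i = (\<integral>s. \<Phi> s (\<Delta> s) i - R * \<Delta> s i \<partial>time_measure t T)"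
  proof (rule variation_of_constants[where C="R * p"])
    show "integrable (time_measure t T) (\<lambda>s. \<Delta> s i)"
      using \<Delta>_bounds by (intro integrable_time_measure_bounded[where C=p]) auto
  qed (use y b R_nonneg in \<open>auto intro: measurable_\<Phi>[OF \<Delta>_profile]\<close>)
  also have "\<dots> = (\<integral>s. H i s - H (i - 1) s \<partial>time_measure t T)"
    using i by (intro Bochner_Integration.integral_cong refl) (auto simp: H_def \<Phi>_def algebra_simps)
  also have "\<dots> = w i t - w (i - 1) t"
    unfolding w_def integral_time_measure[symmetric]
    by (intro Bochner_Integration.integral_diff integrable_time_measure_bounded[OF H_measurable H_bound])
  finally show ?thesis by simp
qed

text \<open>
  At \<open>i = N\<close> the penalty for a lost arrival takes the place of the upward jump, in agreement with
  \<open>\<Delta> s (N + 1) = p\<close>.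
\<close>
lemma hjb_identity:
  assumes i: "i \<le> N" and a: "a \<le> i" and lam: "l s = lam s"
  shows "cost_rate N p lam e s i a + generator N lam s a (\<lambda>j. w j s) i = l s * \<Delta> s (i + 1) + real a * (e s - \<Delta> s i)"
proof -
  have up: "(if i < N then lam s * (w (i + 1) s - w i s) else 0) + p * lam s * (if i = N then 1 else 0) = l s * \<Delta> s (i + 1)"
    using i lam w_diff[of "i + 1" s] \<Delta>_top[of "i + 1" s] by auto
  have down: "real a * (w (i - 1) s - w i s) = - (real a * \<Delta> s i)"
  proof (cases "i = 0")
    case False
    thus ?thesis using w_diff[of i s] i by (simp add: algebra_simps flip: minus_mult_right)
  qed (use a in simp)
  have "generator N lam s a (\<lambda>j. w j s) i = (if i < N then lam s * (w (i + 1) s - w i s) else 0) + real a * (w (i - 1) s - w i s)"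
    by (rule generator_eq[OF i a])
  thus ?thesis using up down unfolding cost_rate_def by (simp add: right_diff_distrib mult.commute[of "e s"])
qed

text \<open>
  The action enters linearly with slope \<open>c s - \<Delta> s i\<close>, so the minimum is attained at an endpoint of the
  feasible interval.
\<close>
lemma hjb_inequality:
  assumes i: "i \<le> N" and a: "a \<in> feasible K i" and lam: "l s = lam s" and e: "c s = e s"
  shows "H i s \<le> cost_rate N p lam e s i a + generator N lam s a (\<lambda>j. w j s) i"
proof -
  have a': "a \<le> i" "a \<le> min i K" using a by (auto simp: feasible_def)
  have "real a * (\<Delta> s i - e s) \<le> real a * max 0 (\<Delta> s i - e s)" by (intro mult_left_mono) auto
  also have "\<dots> \<le> real (min i K) * max 0 (\<Delta> s i - e s)" using a' by (intro mult_right_mono) auto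
  finally show ?thesis unfolding hjb_identity[where lam=lam and s=s, OF i a'(1) lam] H_def e by (simp add: algebra_simps)
qed

text \<open>
  The bang-bang minimiser of the Bellman equation.
\<close>
definition U :: "real \<Rightarrow> nat \<Rightarrow> nat" where
  "U s i = (if c s < \<Delta> s i then min i K else 0)"

lemma U_le: "U s i \<le> min i K" by (simp add: U_def)

lemma U_measurable: "(\<lambda>s. U s i) \<in> measurable borel (count_space UNIV)"
  unfolding U_def by measurable

lemma hjb_equality:
  assumes i: "i \<le> N" and lam: "l s = lam s" and e: "c s = e s"
  shows "H i s = cost_rate N p lam e s i (U s i) + generator N lam s (U s i) (\<lambda>j. w j s) i"
proof -
  have "U s i \<le> i" using U_le[of s i] by simp
  moreover have "H i s = l s * \<Delta> s (i + 1) + real (U s i) * (e s - \<Delta> s i)"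
    using e by (auto simp: H_def U_def algebra_simps)
  ultimately show ?thesis using hjb_identity[where lam=lam and s=s, OF i _ lam, of "U s i" e] by simp
qed

end

section \<open>Verification theorem and identification of the value function\<close>

text \<open>
  A coefficient is continuous off a finite set, and finitely many point values do not affect
  measurability. Outside the horizon it is arbitrary, hence the truncation.
\<close>
lemma coefficient_truncation:
  assumes "coefficient T g"
  shows "(\<lambda>t. indicator {0..T} t * g t) \<in> borel_measurable borel"
    and "\<exists>C. \<forall>t\<in>{0..T}. g t \<le> C"
proof -
  obtain D where D: "finite D" "g C1_differentiable_on ({0..T} - D)"
    using assms by (auto simp: coefficient_def)
  let ?S = "{0..T} - D"
  have S[measurable]: "?S \<in> sets borel" using D(1) by (intro sets.Diff) (auto intro: finite_imp_closed borel_closed)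
  have "(\<lambda>t. indicator ?S t *\<^sub>R g t) \<in> borel_measurable borel"
    by (rule borel_measurable_continuous_on_indicator[OF S C1_differentiable_imp_continuous_on[OF D(2)]])
  moreover have "(\<lambda>t. \<Sum>d\<in>D \<inter> {0..T}. indicator {d} t * g d) \<in> borel_measurable borel"
    by measurable
  ultimately have "(\<lambda>t. indicator ?S t *\<^sub>R g t + (\<Sum>d\<in>D \<inter> {0..T}. indicator {d} t * g d)) \<in> borel_measurable borel"
    by (rule borel_measurable_add)
  also have "(\<lambda>t. indicator ?S t *\<^sub>R g t + (\<Sum>d\<in>D \<inter> {0..T}. indicator {d} t * g d)) = (\<lambda>t. indicator {0..T} t * g t)"
  proof
    fix t
    have "(\<Sum>d\<in>D \<inter> {0..T}. indicator {d} t * g d) = (\<Sum>d\<in>D \<inter> {0..T}. if t = d then g d else 0)"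
      by (intro sum.cong) (auto simp: indicator_def)
    also have "\<dots> = (if t \<in> D \<inter> {0..T} then g t else 0)" using D(1) by simp
    finally show "indicator ?S t *\<^sub>R g t + (\<Sum>d\<in>D \<inter> {0..T}. indicator {d} t * g d) = indicator {0..T} t * g t"
      by (auto simp: indicator_def)
  qed
  finally show "(\<lambda>t. indicator {0..T} t * g t) \<in> borel_measurable borel" .
  have "bounded (g ` {0..T})" using assms by (simp add: coefficient_def)
  thus "\<exists>C. \<forall>t\<in>{0..T}. g t \<le> C" unfolding bounded_iff by (auto simp: abs_le_iff)
qed

context marginal_system
begin

text \<open>
  The Dynkin formula on the event that the state at time \<open>t\<close> is \<open>i\<close> expresses \<open>w i t\<close> as the mean of an integral
  whose integrand is at most the cost rate, with equality under the minimising action.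
\<close>
lemma verification:
  assumes adm: "admissible N K T lam P F I u" and t: "0 \<le> t" "t \<le> T" and i: "i \<le> N"
    and lam: "\<And>s. s \<in> {0..T} \<Longrightarrow> l s = lam s" and e: "\<And>s. s \<in> {0..T} \<Longrightarrow> c s = e s" "\<And>s. s \<in> {0..T} \<Longrightarrow> e s \<le> E"
    and pos: "0 < measure P {\<omega> \<in> space P. I t \<omega> = i}"
  shows "w i t \<le> cost_to_go N T p lam e P I u t i"
    and "(\<And>s \<omega>. s \<in> {0..T} \<Longrightarrow> \<omega> \<in> space P \<Longrightarrow> u s \<omega> = U s (I s \<omega>)) \<Longrightarrow>
      cost_to_go N T p lam e P I u t i = w i t"
proof -
  let ?B = "time_measure t T" and ?A = "{\<omega> \<in> space P. I t \<omega> = i}"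
  have prob: "prob_space P" and sub: "\<And>s. subalgebra P (F s)" and It: "I t \<in> measurable (F t) (count_space UNIV)"
    using adm t by (auto simp: admissible_def)
  interpret prob_space P by fact
  have finP: "finite_measure P" by unfold_locales
  have "I t -` {i} \<inter> space (F t) \<in> sets (F t)" using It by (rule measurable_sets) simp
  hence A: "?A \<in> sets (F t)" using sub[of t] by (simp add: subalgebra_def vimage_def Int_def conj_commute)
  hence AP: "?A \<in> sets P" using sub[of t] by (auto simp: subalgebra_def)
  have I_le: "I v \<omega> \<le> N" and u_f: "u v \<omega> \<in> feasible K (I v \<omega>)" if "v \<in> {t..T}" "\<omega> \<in> space P" for v \<omega>
    using adm that t by (auto simp: admissible_def)
  have lam_b: "0 \<le> lam v \<and> lam v \<le> \<Lambda>" if "v \<in> {0..T}" for v using l[of v] lam[OF that] by simp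
  define Q where "Q v \<omega> = H (I v \<omega>) v - generator N lam v (u v \<omega>) (\<lambda>j. w j v) (I v \<omega>)" for v \<omega>
  define Z where "Z v \<omega> = cost_rate N p lam e v (I v \<omega>) (u v \<omega>)" for v \<omega>
  note IU[measurable] = admissible_jointly_measurable[OF adm t]
  have w_meas: "w j \<in> borel_measurable ?B" for j
  proof -
    have [measurable]: "H j \<in> borel_measurable borel" by (rule H_measurable)
    have "(\<lambda>v. \<integral>s. (if v \<le> s \<and> s \<le> T then H j s else 0) \<partial>lborel) \<in> borel_measurable borel"
      by (rule lborel.borel_measurable_lebesgue_integral) measurable
    hence "w j \<in> borel_measurable borel"
      unfolding w_def[abs_def] integral_time_measure[symmetric] integral_time_measure_if .
    thus ?thesis by (rule measurable_time_measure)
  qed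
  define W where "W = (\<Lambda> * p + real K * p) * measure (time_measure 0 T) (space (time_measure 0 T))"
  have w_le: "\<bar>w j v\<bar> \<le> W" if "v \<in> {t..T}" for j v
  proof -
    have "w j v = (\<integral>s. (if v \<le> s then H j s else 0) \<partial>time_measure 0 T)"
      unfolding w_def integral_time_measure[symmetric] integral_time_measure_if
      using that t by (intro Bochner_Integration.integral_cong) auto
    also have "\<bar>\<dots>\<bar> \<le> W" unfolding W_def
      using H_bound \<Lambda> p by (intro abs_integral_bounded_le finite_time_measure) auto
    finally show ?thesis .
  qed
  have HI: "(\<lambda>z. H (I (fst z) (snd z)) (fst z)) \<in> borel_measurable (?B \<Otimes>\<^sub>M P)"
    by (rule measurable_compose_countable[where f="\<lambda>j z. H j (fst z)"],
        rule measurable_compose[OF measurable_fst measurable_time_measure[OF H_measurable]], rule IU(1))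
  have Q_meas: "(\<lambda>z. Q (fst z) (snd z)) \<in> borel_measurable (?B \<Otimes>\<^sub>M P)"
    unfolding Q_def
    by (intro borel_measurable_diff HI generator_jointly_measurable[OF adm t l_meas lam] w_meas)
  have Q_le: "\<bar>Q v \<omega>\<bar> \<le> (\<Lambda> * p + real K * p) + (\<Lambda> + real K) * (2 * W)" if "v \<in> {t..T}" "\<omega> \<in> space P" for v \<omega>
  proof -
    have "\<bar>generator N lam v (u v \<omega>) (\<lambda>j. w j v) (I v \<omega>)\<bar> \<le> (\<Lambda> + real K) * (2 * W)"
      using lam_b[of v] t that by (intro abs_generator_le I_le u_f w_le) auto
    thus ?thesis using H_bound[of "I v \<omega>" v] unfolding Q_def by linarith
  qed
  have Z_meas: "(\<lambda>z. Z (fst z) (snd z)) \<in> borel_measurable (?B \<Otimes>\<^sub>M P)"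
  proof -
    have [measurable]: "(\<lambda>z. l (fst z)) \<in> borel_measurable (?B \<Otimes>\<^sub>M P)" "(\<lambda>z. c (fst z)) \<in> borel_measurable (?B \<Otimes>\<^sub>M P)"
      by (rule measurable_compose[OF measurable_fst measurable_time_measure[OF l_meas]]
          measurable_compose[OF measurable_fst measurable_time_measure[OF c_meas]])+
    have "(\<lambda>z. c (fst z) * real (u (fst z) (snd z)) + p * l (fst z) * (if I (fst z) (snd z) = N then 1 else 0))
        \<in> borel_measurable (?B \<Otimes>\<^sub>M P)" by measurable
    also have "?this \<longleftrightarrow> ?thesis"
      using t lam e(1) by (intro measurable_cong) (auto simp: Z_def cost_rate_def space_pair_measure space_time_measure)
    finally show ?thesis .
  qed
  have Z_le: "\<bar>Z v \<omega>\<bar> \<le> \<bar>E\<bar> * real K + p * \<Lambda>" if "v \<in> {t..T}" "\<omega> \<in> space P" for v \<omega>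
  proof -
    have v: "v \<in> {0..T}" using that t by auto
    have "\<bar>e v * real (u v \<omega>)\<bar> \<le> \<bar>E\<bar> * real K"
      unfolding abs_mult using e(1)[OF v] e(2)[OF v] c[of v] u_f[OF that] by (intro mult_mono) (auto simp: feasible_def)
    moreover have "\<bar>p * lam v * (if I v \<omega> = N then 1 else 0)\<bar> \<le> p * \<Lambda>"
      using lam_b[OF v] p \<Lambda> by (auto simp: abs_mult intro!: mult_mono)
    ultimately show ?thesis unfolding Z_def cost_rate_def by linarith
  qed
  have "\<forall>v\<in>{t..T}. \<forall>\<omega>\<in>space P. \<bar>Q v \<omega>\<bar> \<le> (\<Lambda> * p + real K * p) + (\<Lambda> + real K) * (2 * W)"
    "\<forall>v\<in>{t..T}. \<forall>\<omega>\<in>space P. \<bar>Z v \<omega>\<bar> \<le> \<bar>E\<bar> * real K + p * \<Lambda>"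
    using Q_le Z_le by blast+
  note int = integrable_time_section[OF finP AP Q_meas this(1)] integrable_time_section[OF finP AP Z_meas this(2)]
  have "(LINT \<omega>:?A|P. w (I t \<omega>) t) = (LINT \<omega>:?A|P. LINT v:{t..T}|lborel. Q v \<omega>)"
    unfolding Q_def
    by (rule dynkin_formula[OF adm t A l_meas lam lam_b H_measurable H_bound w_def])
  moreover have "(LINT \<omega>:?A|P. w (I t \<omega>) t) = (\<integral>\<omega>. indicator ?A \<omega> * w i t \<partial>P)"
    unfolding set_lebesgue_integral_def by (intro Bochner_Integration.integral_cong) (auto simp: indicator_def)
  ultimately have dyn: "w i t * measure P ?A = (\<integral>\<omega>. indicator ?A \<omega> * (\<integral>v. Q v \<omega> \<partial>?B) \<partial>P)"
    using AP by (simp add: set_lebesgue_integral_def[where M=P] integral_time_measure[symmetric])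
  have J: "cost_to_go N T p lam e P I u t i = (\<integral>\<omega>. indicator ?A \<omega> * (\<integral>v. Z v \<omega> \<partial>?B) \<partial>P) / measure P ?A"
    by (simp add: cost_to_go_def Z_def set_lebesgue_integral_def[where M=P] integral_time_measure)
  have "(\<integral>\<omega>. indicator ?A \<omega> * (\<integral>v. Q v \<omega> \<partial>?B) \<partial>P) \<le> (\<integral>\<omega>. indicator ?A \<omega> * (\<integral>v. Z v \<omega> \<partial>?B) \<partial>P)"
  proof (rule integral_mono[OF int(2) int(4)])
    fix \<omega> assume om: "\<omega> \<in> space P"
    have "(\<integral>v. Q v \<omega> \<partial>?B) \<le> (\<integral>v. Z v \<omega> \<partial>?B)"
    proof (rule integral_mono[OF int(1)[OF om] int(3)[OF om]])
      fix v assume "v \<in> space ?B"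
      hence v: "v \<in> {t..T}" "v \<in> {0..T}" using t by (auto simp: space_time_measure)
      show "Q v \<omega> \<le> Z v \<omega>"
        using hjb_inequality[where lam=lam and s=v and e=e, OF I_le[OF v(1) om] u_f[OF v(1) om] lam[OF v(2)] e(1)[OF v(2)]]
        by (simp add: Q_def Z_def)
    qed
    thus "indicator ?A \<omega> * (\<integral>v. Q v \<omega> \<partial>?B) \<le> indicator ?A \<omega> * (\<integral>v. Z v \<omega> \<partial>?B)"
      by (intro mult_left_mono) auto
  qed
  thus "w i t \<le> cost_to_go N T p lam e P I u t i"
    unfolding J dyn[symmetric] using pos by (simp add: pos_le_divide_eq)
  assume opt: "\<And>s \<omega>. s \<in> {0..T} \<Longrightarrow> \<omega> \<in> space P \<Longrightarrow> u s \<omega> = U s (I s \<omega>)"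
  have "(\<integral>\<omega>. indicator ?A \<omega> * (\<integral>v. Q v \<omega> \<partial>?B) \<partial>P) = (\<integral>\<omega>. indicator ?A \<omega> * (\<integral>v. Z v \<omega> \<partial>?B) \<partial>P)"
  proof (intro Bochner_Integration.integral_cong refl arg_cong2[where f="(*)"])
    fix \<omega> v assume om: "\<omega> \<in> space P" and "v \<in> space ?B"
    hence v: "v \<in> {t..T}" "v \<in> {0..T}" using t by (auto simp: space_time_measure)
    show "Q v \<omega> = Z v \<omega>"
      using hjb_equality[where lam=lam and s=v and e=e, OF I_le[OF v(1) om] lam[OF v(2)] e(1)[OF v(2)]] opt[OF v(2) om]
      by (simp add: Q_def Z_def)
  qed
  thus "cost_to_go N T p lam e P I u t i = w i t"
    unfolding J using dyn pos by (simp add: divide_eq_eq)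
qed

lemma value_function_eq:
  assumes T: "0 < T" and \<Lambda>_pos: "0 < \<Lambda>" and t: "0 \<le> t" "t \<le> T" and i: "i \<le> N"
    and lam: "\<And>s. s \<in> {0..T} \<Longrightarrow> l s = lam s" and e: "\<And>s. s \<in> {0..T} \<Longrightarrow> c s = e s" "\<And>s. s \<in> {0..T} \<Longrightarrow> e s \<le> E"
  shows "V N K T p lam e t i = w i t"
  unfolding V_def
proof (rule cInf_eq_minimum)
  obtain P :: "(nat \<Rightarrow> real) measure" and F I where
    adm: "admissible N K T lam P F I (\<lambda>s \<omega>. U s (I s \<omega>))" and pos: "\<And>t. 0 < measure P {\<omega> \<in> space P. I t \<omega> = i}"
    using feedback_process_exists[OF T \<Lambda>_pos l_meas l lam U_measurable U_le i] by blast
  have "cost_to_go N T p lam e P I (\<lambda>s \<omega>. U s (I s \<omega>)) t i = w i t"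
    by (rule verification(2)[OF adm t i lam e pos]) auto
  thus "w i t \<in> {cost_to_go N T p lam e P I u t i | (P :: (nat \<Rightarrow> real) measure) F I u.
            admissible N K T lam P F I u \<and> 0 < measure P {\<omega> \<in> space P. I t \<omega> = i}}"
    using adm pos by (auto intro!: exI)
next
  fix x assume "x \<in> {cost_to_go N T p lam e P I u t i | (P :: (nat \<Rightarrow> real) measure) F I u.
            admissible N K T lam P F I u \<and> 0 < measure P {\<omega> \<in> space P. I t \<omega> = i}}"
  then obtain P :: "(nat \<Rightarrow> real) measure" and F I u where x: "x = cost_to_go N T p lam e P I u t i"
    and adm: "admissible N K T lam P F I u" and pos: "0 < measure P {\<omega> \<in> space P. I t \<omega> = i}" by blast
  show "w i t \<le> x" unfolding x by (rule verification(1)[OF adm t i lam e pos])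
qed

end


section \<open>Monotonicity across periods\<close>

theorem theorem4:
  fixes N K M :: nat
    and T L p :: real
    and lam e lam0 e0 :: "real \<Rightarrow> real"
  assumes "1 \<le> N" and "1 \<le> K" and "0 < p"
    and "coefficient T lam" and "coefficient T e"
    and "1 \<le> M" and "0 < L" and "T = real M * L"
    and "\<And>m s. m \<in> {1..M} \<Longrightarrow> s \<in> {0..<L} \<Longrightarrow> lam ((real m - 1) * L + s) = lam0 s"
    and "\<And>m s. m \<in> {1..M} \<Longrightarrow> s \<in> {0..<L} \<Longrightarrow> e ((real m - 1) * L + s) = e0 s"
  shows "(\<forall>m\<in>{1..M - 1}. \<forall>i\<in>{1..N}. \<forall>s\<in>{0..L}.
            marginal N K T p lam e i (real m * L + s)
              \<le> marginal N K T p lam e i ((real m - 1) * L + s))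
       \<and> (\<forall>m\<in>{1..M - 1}. \<forall>s\<in>{0..<L}.
            active_set N K T p lam e (real m * L + s)
              \<subseteq> active_set N K T p lam e ((real m - 1) * L + s)
          \<and> i_min N K T p lam e ((real m - 1) * L + s)
              \<le> i_min N K T p lam e (real m * L + s))"
proof -
  have T: "0 < T" using assms(6,7,8) by simp
  obtain \<Lambda> where \<Lambda>: "\<And>t. t \<in> {0..T} \<Longrightarrow> lam t \<le> \<Lambda>" using coefficient_truncation(2)[OF assms(4)] by blast
  obtain E where E: "\<And>t. t \<in> {0..T} \<Longrightarrow> e t \<le> E" using coefficient_truncation(2)[OF assms(5)] by blast
  have lam_pos: "0 < lam t" and e_pos: "0 < e t" if "t \<in> {0..T}" for t
    using assms(4,5) that by (auto simp: coefficient_def)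
  have \<Lambda>_pos: "0 < \<Lambda>" using lam_pos[of 0] \<Lambda>[of 0] T by auto
  define l where "l t = indicator {0..T} t * lam t" for t
  define c where "c t = indicator {0..T} t * e t" for t
  have l_eq: "l s = lam s" and c_eq: "c s = e s" if "s \<in> {0..T}" for s using that by (auto simp: l_def c_def)
  interpret marginal_system N K p T \<Lambda> l c
  proof
    show "l \<in> borel_measurable borel" "c \<in> borel_measurable borel"
      unfolding l_def[abs_def] c_def[abs_def] by (intro coefficient_truncation(1) assms)+
    show "0 \<le> l s" "l s \<le> \<Lambda>" "0 \<le> c s" for s
      using lam_pos[of s] e_pos[of s] \<Lambda>[of s] \<Lambda>_pos by (auto simp: l_def c_def indicator_def)
  qed (use assms(3) \<Lambda>_pos in auto)
  have marg: "marginal N K T p lam e i t = \<Delta> t i" if t: "t \<in> {0..T}" and i: "i \<in> {1..N}" for t i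
  proof -
    have V_eq: "V N K T p lam e t j = w j t" if "j \<le> N" for j
      by (rule value_function_eq[OF T \<Lambda>_pos _ _ that l_eq c_eq E]) (use t in auto)
    have "i \<le> N" "i - 1 \<le> N" using i by auto
    thus ?thesis using w_diff[of i t] i by (simp only: marginal_def V_eq) simp
  qed
  have period: "l (s + L) = l s \<and> c (s + L) = c s" if s: "0 \<le> s" "s < T - L" for s
  proof -
    \<comment> \<open>\<open>s\<close> lies in period number \<open>k + 1\<close>, at offset \<open>r\<close>.\<close>
    define k where "k = nat \<lfloor>s / L\<rfloor>"
    define r where "r = s - real k * L"
    have k: "real k \<le> s / L" "s / L < real k + 1"
      using s assms(7) by (auto simp: k_def of_nat_nat)
    have r: "r \<in> {0..<L}" using k assms(7) by (auto simp: r_def field_simps)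
    have "s / L < real M - 1" using s assms(7,8) by (simp add: field_simps)
    hence kM: "k + 1 < M" using k by linarith
    hence m: "Suc k \<in> {1..M}" "Suc (Suc k) \<in> {1..M}" by auto
    have e1: "(real (Suc k) - 1) * L + r = s" "(real (Suc (Suc k)) - 1) * L + r = s + L"
      by (auto simp: r_def algebra_simps)
    have "lam s = lam (s + L)" "e s = e (s + L)"
      using assms(9)[OF m(1) r] assms(9)[OF m(2) r] assms(10)[OF m(1) r] assms(10)[OF m(2) r] unfolding e1 by auto
    thus ?thesis using l_eq[of s] l_eq[of "s + L"] c_eq[of s] c_eq[of "s + L"] s assms(7) by auto
  qed
  have range: "(real m - 1) * L + s \<in> {0..T}" "real m * L + s \<in> {0..T}" "(real m - 1) * L + s \<le> T - L" "0 \<le> (real m - 1) * L + s"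
    if "m \<in> {1..M - 1}" "s \<in> {0..L}" for m s
  proof -
    have "(real m + 1) * L \<le> real M * L" using that(1) assms(7) by (intro mult_right_mono) auto
    hence 1: "real m * L + L \<le> T" unfolding distrib_right assms(8) by linarith
    have "1 * L \<le> real m * L" using that(1) assms(7) by (intro mult_right_mono) auto
    hence 2: "L \<le> real m * L" by linarith
    have 3: "(real m - 1) * L = real m * L - L" unfolding left_diff_distrib by linarith
    have 4: "0 \<le> s" "s \<le> L" using that(2) by auto
    show "(real m - 1) * L + s \<in> {0..T}" "real m * L + s \<in> {0..T}" "(real m - 1) * L + s \<le> T - L" "0 \<le> (real m - 1) * L + s"
      unfolding atLeastAtMost_iff 3 using 1 2 4 by ((intro conjI)?; linarith)+
  qed
  have mono: "marginal N K T p lam e i (real m * L + s) \<le> marginal N K T p lam e i ((real m - 1) * L + s)"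
    if m: "m \<in> {1..M - 1}" and i: "i \<in> {1..N}" and s: "s \<in> {0..L}" for m i s
  proof -
    have "\<Delta> ((real m - 1) * L + s + L) i \<le> \<Delta> ((real m - 1) * L + s) i"
      using \<Delta>_periodic_decreasing[OF _ period range(4)[OF m s] range(3)[OF m s], of i] assms(7) by simp
    moreover have "(real m - 1) * L + s + L = real m * L + s" by (simp add: algebra_simps)
    ultimately show ?thesis using range[OF m s] i by (simp add: marg)
  qed
  have sub: "active_set N K T p lam e (real m * L + s) \<subseteq> active_set N K T p lam e ((real m - 1) * L + s)"
    if m: "m \<in> {1..M - 1}" and s: "s \<in> {0..<L}" for m s
  proof -
    have m2: "m \<in> {1..M}" "Suc m \<in> {1..M}" using m by auto
    have "e (real m * L + s) = e ((real m - 1) * L + s)"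
      using assms(10)[OF m2(1) s] assms(10)[OF m2(2) s] by simp
    moreover have "s \<in> {0..L}" using s by auto
    ultimately show ?thesis using mono[OF m] unfolding active_set_def by fastforce
  qed
  have "i_min N K T p lam e ((real m - 1) * L + s) \<le> i_min N K T p lam e (real m * L + s)"
    if m: "m \<in> {1..M - 1}" and s: "s \<in> {0..<L}" for m s
  proof -
    let ?A = "active_set N K T p lam e (real m * L + s)" and ?B = "active_set N K T p lam e ((real m - 1) * L + s)"
    have fin: "finite ?B" and B: "?B \<subseteq> {1..N}" by (auto simp: active_set_def)
    show ?thesis
    proof (cases "?A = {}")
      case True
      show ?thesis
      proof (cases "?B = {}")
        case False
        hence "Min ?B \<le> N" using Min_in[OF fin False] B by auto
        thus ?thesis using True False by (simp add: i_min_def)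
      qed (simp add: True i_min_def)
    next
      case False
      hence "?B \<noteq> {}" using sub[OF m s] by auto
      thus ?thesis using False Min_antimono[OF sub[OF m s] False fin] by (simp add: i_min_def)
    qed
  qed
  thus ?thesis using mono sub by blast
qed

end
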